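(* M-EPVCB is W[1]-hard when parameterized by $k_1$.
   Context: Graphs are finite, simple, undirected. For $V_0\subseteq V(G)$, $E(V_0)$ denotes the set of edges with at least one endpoint in $V_0$. M-EPVCB: given a bipartite graph $G=(V,E)$, an edge-weight function $w:E\to\mathbb{N}$ (positive integers), and positive integers $k_1,k_2,k_3$, decide whether there exists $V_0\subseteq V$ with $|V_0|\le k_1$ such that $\sum_{e\in E(V_0)}w(e)\ge k_2$ and $E(V_0)$ contains a matching $M$ with $\sum_{e\in M}w(e)\ge k_3$. *)

theory Defs
  imports Main "HOL-Library.Log_Nat"
begin

section \<open>Machine model: random access machines\<close>

text \<open>
  Structured programs for a random access machine with finitely many unbounded arrays of natural
  numbers (\<open>Get a e\<close> is cell \<open>e\<close> of array \<open>a\<close>; cell \<open>0\<close> serves as a plain register), and a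
  write-only output tape. The operations are addition and truncated subtraction, without
  multiplication, so that under the uniform cost measure bit lengths grow by at most a constant per
  step and running times agree with those of Turing machines up to a polynomial. The output is
  emitted one number at a time, so its length is bounded by the running time.
\<close>

datatype exp = Const nat | Get nat exp | Add exp exp | Sub exp exp

datatype com =
    Skip
  | Put nat exp exp
  | Emit exp
  | Seq com com
  | Cond exp com com
  | While exp com

type_synonym memory = "nat \<Rightarrow> nat \<Rightarrow> nat"
type_synonym config = "memory \<times> nat list"

primrec exp_val :: "memory \<Rightarrow> exp \<Rightarrow> nat" where
  "exp_val m (Const n) = n"
| "exp_val m (Get a e) = m a (exp_val m e)"
| "exp_val m (Add e e') = exp_val m e + exp_val m e'"
| "exp_val m (Sub e e') = exp_val m e - exp_val m e'"

inductive exec :: "com \<Rightarrow> config \<Rightarrow> nat \<Rightarrow> config \<Rightarrow> bool" where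
  Skip: "exec Skip s 1 s"
| Put: "exec (Put a i e) (m, out) 1 (m(a := (m a)(exp_val m i := exp_val m e)), out)"
| Emit: "exec (Emit e) (m, out) 1 (m, out @ [exp_val m e])"
| Seq: "exec c s t s' \<Longrightarrow> exec c' s' t' s'' \<Longrightarrow> exec (Seq c c') s (t + t') s''"
| Cond_true: "exp_val (fst s) b \<noteq> 0 \<Longrightarrow> exec c s t s' \<Longrightarrow> exec (Cond b c c') s (t + 1) s'"
| Cond_false: "exp_val (fst s) b = 0 \<Longrightarrow> exec c' s t s' \<Longrightarrow> exec (Cond b c c') s (t + 1) s'"
| While_false: "exp_val (fst s) b = 0 \<Longrightarrow> exec (While b c) s 1 s"
| While_true: "exp_val (fst s) b \<noteq> 0 \<Longrightarrow> exec c s t s' \<Longrightarrow> exec (While b c) s' t' s''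
    \<Longrightarrow> exec (While b c) s (t + t' + 1) s''"

text \<open>The input word is in array \<open>0\<close>, its length in cell \<open>0\<close> of array \<open>1\<close>; all other cells are \<open>0\<close>.\<close>

definition init :: "nat list \<Rightarrow> memory" where
  "init xs = (\<lambda>a i. if a = 0 \<and> i < length xs then xs ! i
                    else if a = 1 \<and> i = 0 then length xs else 0)"

definition computes_in :: "com \<Rightarrow> nat list \<Rightarrow> nat list \<Rightarrow> nat \<Rightarrow> bool" where
  "computes_in p xs ys t \<longleftrightarrow> (\<exists>m. exec p (init xs, []) t (m, ys))"

definition computable :: "(nat \<Rightarrow> nat) \<Rightarrow> bool" where
  "computable f \<longleftrightarrow> (\<exists>p. \<forall>n. \<exists>t. computes_in p [n] [f n] t)"


section \<open>Parameterized problems and reductions\<close>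

text \<open>
  An instance is a pair of a word and a parameter value. Words are finite sequences of natural
  numbers, measured by the total length of the binary representations.
\<close>

type_synonym param_problem = "(nat list \<times> nat) set"

definition word_size :: "nat list \<Rightarrow> nat" where
  "word_size xs = (\<Sum>n\<leftarrow>xs. floorlog 2 n + 1)"

definition fpt_reducible :: "param_problem \<Rightarrow> param_problem \<Rightarrow> bool" (infix "\<le>\<^sub>f\<^sub>p\<^sub>t" 50) where
  "A \<le>\<^sub>f\<^sub>p\<^sub>t B \<longleftrightarrow> (\<exists>p f g c. computable f \<and> computable g \<and>
     (\<forall>x k. \<exists>x' k' t. computes_in p (k # x) (k' # x') t \<and>
        ((x, k) \<in> A \<longleftrightarrow> (x', k') \<in> B) \<and>
        k' \<le> g k \<and>
        t \<le> f k * (word_size x + 1) ^ c))"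


section \<open>Boolean circuits and the W-hierarchy\<close>

text \<open>
  A circuit is a directed acyclic graph, given as the list of its nodes in a topological order with
  the output node last; nodes are referred to by their position, and a node carries the list of its
  in-neighbours.
\<close>

datatype gate = Input | Neg nat | And "nat list" | Or "nat list"

type_synonym circuit = "gate list"

primrec preds :: "gate \<Rightarrow> nat list" where
  "preds Input = []"
| "preds (Neg j) = [j]"
| "preds (And js) = js"
| "preds (Or js) = js"

definition is_circuit :: "circuit \<Rightarrow> bool" where
  "is_circuit C \<longleftrightarrow> C \<noteq> [] \<and>
     (\<forall>i < length C. distinct (preds (C ! i)) \<and> (\<forall>j \<in> set (preds (C ! i)). j < i) \<and>
        (\<forall>js. C ! i = And js \<or> C ! i = Or js \<longrightarrow> length js \<ge> 2))"

definition input_nodes :: "circuit \<Rightarrow> nat set" where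
  "input_nodes C = {i. i < length C \<and> C ! i = Input}"

declare conj_cong [fundef_cong]

text \<open>The conditions \<open>j < i\<close> hold in every circuit; they only serve termination.\<close>

fun node_val :: "circuit \<Rightarrow> nat set \<Rightarrow> nat \<Rightarrow> bool" where
  "node_val C S i = (case C ! i of
       Input \<Rightarrow> i \<in> S
     | Neg j \<Rightarrow> \<not> (j < i \<and> node_val C S j)
     | And js \<Rightarrow> (\<forall>j \<in> set js. j < i \<longrightarrow> node_val C S j)
     | Or js \<Rightarrow> (\<exists>j \<in> set js. j < i \<and> node_val C S j))"

declare conj_cong [fundef_cong del]
declare node_val.simps [simp del]

text \<open>\<open>S\<close> is the set of input nodes that are assigned true.\<close>

definition satisfies :: "nat set \<Rightarrow> circuit \<Rightarrow> bool" where
  "satisfies S C \<longleftrightarrow> S \<subseteq> input_nodes C \<and> node_val C S (length C - 1)"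

definition input_output_path :: "circuit \<Rightarrow> nat list \<Rightarrow> bool" where
  "input_output_path C p \<longleftrightarrow> p \<noteq> [] \<and> hd p \<in> input_nodes C \<and> last p = length C - 1 \<and>
     set p \<subseteq> {..<length C} \<and> successively (\<lambda>i j. i \<in> set (preds (C ! j))) p"

definition large :: "gate \<Rightarrow> bool" where
  "large g \<longleftrightarrow> length (preds g) > 2"

definition depth_le :: "circuit \<Rightarrow> nat \<Rightarrow> bool" where
  "depth_le C d \<longleftrightarrow> (\<forall>p. input_output_path C p \<longrightarrow> length p - 1 \<le> d)"

definition weft_le :: "circuit \<Rightarrow> nat \<Rightarrow> bool" where
  "weft_le C t \<longleftrightarrow> (\<forall>p. input_output_path C p \<longrightarrow> length (filter (\<lambda>i. large (C ! i)) p) \<le> t)"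

primrec encode_gate :: "gate \<Rightarrow> nat list" where
  "encode_gate Input = [0]"
| "encode_gate (Neg j) = [1, j]"
| "encode_gate (And js) = 2 # length js # js"
| "encode_gate (Or js) = 3 # length js # js"

definition encode_circuit :: "circuit \<Rightarrow> nat list" where
  "encode_circuit C = length C # concat (map encode_gate C)"

text \<open>Weighted circuit satisfiability for circuits of weft at most \<open>t\<close> and depth at most \<open>d\<close>.\<close>

definition WCS :: "nat \<Rightarrow> nat \<Rightarrow> param_problem" where
  "WCS t d = {(encode_circuit C, k) | C k.
     is_circuit C \<and> weft_le C t \<and> depth_le C d \<and> (\<exists>S. satisfies S C \<and> card S = k)}"

definition W :: "nat \<Rightarrow> param_problem set" where
  "W t = {A. \<exists>d\<ge>1. A \<le>\<^sub>f\<^sub>p\<^sub>t WCS t d}"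

definition W_hard :: "nat \<Rightarrow> param_problem \<Rightarrow> bool" where
  "W_hard t B \<longleftrightarrow> (\<forall>A \<in> W t. A \<le>\<^sub>f\<^sub>p\<^sub>t B)"


section \<open>The problem M-EPVCB\<close>

definition simple_graph :: "'v set \<Rightarrow> 'v set set \<Rightarrow> bool" where
  "simple_graph V E \<longleftrightarrow> finite V \<and> (\<forall>e \<in> E. e \<subseteq> V \<and> card e = 2)"

definition bipartite :: "'v set \<Rightarrow> 'v set set \<Rightarrow> bool" where
  "bipartite V E \<longleftrightarrow> (\<exists>X Y. X \<union> Y = V \<and> X \<inter> Y = {} \<and> (\<forall>e \<in> E. \<exists>x \<in> X. \<exists>y \<in> Y. e = {x, y}))"

definition covered_edges :: "'v set set \<Rightarrow> 'v set \<Rightarrow> 'v set set" where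
  "covered_edges E V\<^sub>0 = {e \<in> E. e \<inter> V\<^sub>0 \<noteq> {}}"

definition matching :: "'v set set \<Rightarrow> bool" where
  "matching M \<longleftrightarrow> (\<forall>e \<in> M. \<forall>e' \<in> M. e \<noteq> e' \<longrightarrow> e \<inter> e' = {})"

definition MEPVC_solution ::
  "'v set \<Rightarrow> 'v set set \<Rightarrow> ('v set \<Rightarrow> nat) \<Rightarrow> nat \<Rightarrow> nat \<Rightarrow> nat \<Rightarrow> 'v set \<Rightarrow> bool" where
  "MEPVC_solution V E w k\<^sub>1 k\<^sub>2 k\<^sub>3 V\<^sub>0 \<longleftrightarrow>
     V\<^sub>0 \<subseteq> V \<and> card V\<^sub>0 \<le> k\<^sub>1 \<and>
     (\<Sum>e \<in> covered_edges E V\<^sub>0. w e) \<ge> k\<^sub>2 \<and>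
     (\<exists>M \<subseteq> covered_edges E V\<^sub>0. matching M \<and> (\<Sum>e \<in> M. w e) \<ge> k\<^sub>3)"

text \<open>
  A weighted graph on the vertex set \<open>{0..<n}\<close> is encoded by its weight matrix; since weights are
  positive, \<open>0\<close> marks the absence of an edge.
\<close>

definition encode_weighted_graph :: "nat \<Rightarrow> nat set set \<Rightarrow> (nat set \<Rightarrow> nat) \<Rightarrow> nat list" where
  "encode_weighted_graph n E w =
     n # [if {u, v} \<in> E then w {u, v} else 0. u \<leftarrow> [0..<n], v \<leftarrow> [0..<n]]"

text \<open>The parameter is \<open>k\<^sub>1\<close>.\<close>

definition M_EPVCB :: param_problem where
  "M_EPVCB = {(encode_weighted_graph n E w @ [k\<^sub>2, k\<^sub>3], k\<^sub>1) | n E w k\<^sub>1 k\<^sub>2 k\<^sub>3.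
     simple_graph {0..<n} E \<and> bipartite {0..<n} E \<and> (\<forall>e \<in> E. w e > 0) \<and>
     k\<^sub>1 > 0 \<and> k\<^sub>2 > 0 \<and> k\<^sub>3 > 0 \<and>
     (\<exists>V\<^sub>0. MEPVC_solution {0..<n} E w k\<^sub>1 k\<^sub>2 k\<^sub>3 V\<^sub>0)}"

end

theory Submission imports Defs begin

text \<open>
  A circuit of weft \<open>1\<close> and depth \<open>d\<close> is a combination, by small gates, of at most \<open>2 ^ d\<close> large gates
  whose in-neighbours depend on at most \<open>2 ^ d\<close> inputs each. A weight-\<open>k\<close> assignment is given by the
  sorted list of its true inputs; whether an input is true or false can be read off one pair of
  consecutive entries. For every large gate one guesses an in-neighbour that forces its value, or
  that there is none. Then the circuit is satisfied iff for every choice of \<open>2 ^ d\<close> consecutive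
  pairs the evaluation based on these pairs and on the guesses meets no contradiction. This is a
  constraint satisfaction problem with \<open>O(k)\<close> variables and constraints of bounded arity.

  Choosing one tuple of values per constraint scope such that the tuples agree on common variables
  is a system of linear equations in numbers of bounded size, hence, written in a large base, a
  subset sum problem with a prescribed number of summands. A selected number \<open>a\<close> becomes a star of
  total weight \<open>D + a\<close> whose heaviest edge weighs \<open>D - a\<close>: the covering bound forces the sum of the
  selected numbers to be at least the target, the matching bound forces it to be at most the target.
\<close>

section \<open>Composition of programs\<close>

text \<open>The obstacle is the unbounded fan-in of large gates: a constraint of bounded arity
  cannot check that no in-neighbour forces such a gate. The check is therefore distributed. All
  constraints share the claims, each sees only its own pairs, and inputs it does not see are
  unknown; since an in-neighbour of a large gate depends on at most \<open>2 ^ d\<close> inputs,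
  some constraint determines its value and exposes a wrong claim. Weft \<open>1\<close> guarantees
  that below a claimed gate no further claim is consulted.

  Arity and number of claims depend on the fixed \<open>d\<close> only, so the number of scopes is
  polynomial in \<open>k\<close>, whereas the domain size \<open>b\<close> may grow with the input.
  The base \<open>N\<close> of the numbers is a fixed power of \<open>b\<close>, and they arise by
  additions alone.

  The reduction must also answer for words that encode no circuit, or one that is too deep or of too
  large weft. These tests are part of every constraint, so such words yield an ordinary instance
  without a solution.

  Programs are not written by hand: functions built from sums over one common range are compiled,
  and their time is polynomial in that range.\<close>

primrec rename_exp :: "(nat \<Rightarrow> nat) \<Rightarrow> exp \<Rightarrow> exp" where
  "rename_exp h (Const n) = Const n"
| "rename_exp h (Get a e) = Get (h a) (rename_exp h e)"
| "rename_exp h (Add e e') = Add (rename_exp h e) (rename_exp h e')"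
| "rename_exp h (Sub e e') = Sub (rename_exp h e) (rename_exp h e')"

text \<open>\<open>em\<close> decides what becomes of an output instruction: \<open>Emit\<close>
  keeps it, \<open>store\<close> redirects the tape into an array. An injective \<open>h\<close>
  lets two programs share one memory without interference.\<close>

primrec translate :: "(nat \<Rightarrow> nat) \<Rightarrow> (exp \<Rightarrow> com) \<Rightarrow> com \<Rightarrow> com" where
  "translate h em Skip = Skip"
| "translate h em (Put a i e) = Put (h a) (rename_exp h i) (rename_exp h e)"
| "translate h em (Emit e) = em (rename_exp h e)"
| "translate h em (Seq c c') = Seq (translate h em c) (translate h em c')"
| "translate h em (Cond b c c') = Cond (rename_exp h b) (translate h em c) (translate h em c')"
| "translate h em (While b c) = While (rename_exp h b) (translate h em c)"

lemma exp_val_rename: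
  "(\<And>a. M (h a) = m a) \<Longrightarrow> exp_val M (rename_exp h e) = exp_val m e"
  by (induction e) auto

text \<open>A simulation argument. \<open>R\<close> relates the actual memory and tape to the tape
  of the original program; it may look only at arrays outside the range of \<open>h\<close>, which
  translated assignments leave alone. The factor 2 pays for \<open>store\<close>, which takes two
  steps.\<close>

lemma exec_translate:
  assumes "exec c s t s'" and h: "inj h"
    and R_upd: "\<And>M M' o' o''. R M o' o'' \<Longrightarrow> (\<And>b. b \<notin> range h \<Longrightarrow> M' b = M b) \<Longrightarrow> R M' o' o''"
    and em: "\<And>M o' o'' e. R M o' o'' \<Longrightarrow> \<exists>M' ot t'. exec (em e) (M, o') t' (M', ot) \<and> t' \<le> 2 \<and>
        (\<forall>a. M' (h a) = M (h a)) \<and> R M' ot (o'' @ [exp_val M e])"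
    and "\<And>a. M (h a) = fst s a" and "R M ot (snd s)"
  shows "\<exists>t' M' ot'. exec (translate h em c) (M, ot) t' (M', ot') \<and> t' \<le> 2 * t \<and>
    (\<forall>a. M' (h a) = fst s' a) \<and> R M' ot' (snd s')"
  using assms(1,5,6)
proof (induction arbitrary: M ot rule: exec.induct)
  case (Skip s)
  then show ?case by (auto intro!: exI exec.Skip)
next
  case (Put a i e m out)
  let ?M = "M(h a := (M (h a))(exp_val M (rename_exp h i) := exp_val M (rename_exp h e)))"
  have "exec (translate h em (com.Put a i e)) (M, ot) 1 (?M, ot)"
    using exec.Put by simp
  moreover have "\<forall>b. ?M (h b) = (m(a := (m a)(exp_val m i := exp_val m e))) b"
    using Put(1) h by (auto simp: exp_val_rename[of M h m] inj_eq)
  moreover have "R ?M ot out"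
    by (rule R_upd[OF Put(2)[simplified]]) auto
  ultimately show ?case
    by (intro exI[of _ 1] exI[of _ ?M] exI[of _ ot]) (simp del: fun_upd_apply One_nat_def)
next
  case (Emit e m out)
  obtain M' ot' t' where *: "exec (em (rename_exp h e)) (M, ot) t' (M', ot')" "t' \<le> 2"
    "\<And>a. M' (h a) = M (h a)" "R M' ot' (out @ [exp_val M (rename_exp h e)])"
    using em[OF Emit(2), of "rename_exp h e"] by auto
  then show ?case
    using Emit(1) by (intro exI[of _ t'] exI[of _ M'] exI[of _ ot']) (simp add: exp_val_rename[of M h m])
next
  case (Seq c s t s' c' t' s'')
  from Seq.IH(1)[OF Seq.prems] obtain t1 M1 o1 where 1:
    "exec (translate h em c) (M, ot) t1 (M1, o1)" "t1 \<le> 2 * t" "\<And>a. M1 (h a) = fst s' a" "R M1 o1 (snd s')"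
    by auto
  from Seq.IH(2)[OF 1(3,4)] obtain t2 M2 o2 where 2:
    "exec (translate h em c') (M1, o1) t2 (M2, o2)" "t2 \<le> 2 * t'" "\<And>a. M2 (h a) = fst s'' a" "R M2 o2 (snd s'')"
    by auto
  show ?case
    using exec.Seq[OF 1(1) 2(1)] 1 2 by (intro exI[of _ "t1 + t2"] exI[of _ M2] exI[of _ o2]) auto
next
  case (Cond_true s b c t s' c')
  from Cond_true.IH[OF Cond_true.prems] obtain t1 M1 o1 where 1:
    "exec (translate h em c) (M, ot) t1 (M1, o1)" "t1 \<le> 2 * t" "\<And>a. M1 (h a) = fst s' a" "R M1 o1 (snd s')"
    by auto
  have "exp_val (fst (M, ot)) (rename_exp h b) \<noteq> 0"
    using Cond_true by (simp add: exp_val_rename[of M h "fst s"])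
  from exec.Cond_true[OF this 1(1), of "translate h em c'"] show ?case
    using 1 by (intro exI[of _ "t1 + 1"] exI[of _ M1] exI[of _ o1]) auto
next
  case (Cond_false s b c' t s' c)
  from Cond_false.IH[OF Cond_false.prems] obtain t1 M1 o1 where 1:
    "exec (translate h em c') (M, ot) t1 (M1, o1)" "t1 \<le> 2 * t" "\<And>a. M1 (h a) = fst s' a" "R M1 o1 (snd s')"
    by auto
  have "exp_val (fst (M, ot)) (rename_exp h b) = 0"
    using Cond_false by (simp add: exp_val_rename[of M h "fst s"])
  from exec.Cond_false[OF this 1(1), of "translate h em c"] show ?case
    using 1 by (intro exI[of _ "t1 + 1"] exI[of _ M1] exI[of _ o1]) auto
next
  case (While_false s b c)
  have "exp_val (fst (M, ot)) (rename_exp h b) = 0"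
    using While_false by (simp add: exp_val_rename[of M h "fst s"])
  from exec.While_false[OF this] show ?case
    using While_false by (intro exI[of _ 1] exI[of _ M] exI[of _ ot]) auto
next
  case (While_true s b c t s' t' s'')
  from While_true.IH(1)[OF While_true.prems] obtain t1 M1 o1 where 1:
    "exec (translate h em c) (M, ot) t1 (M1, o1)" "t1 \<le> 2 * t" "\<And>a. M1 (h a) = fst s' a" "R M1 o1 (snd s')"
    by auto
  from While_true.IH(2)[OF 1(3,4)] obtain t2 M2 o2 where 2:
    "exec (translate h em (While b c)) (M1, o1) t2 (M2, o2)" "t2 \<le> 2 * t'" "\<And>a. M2 (h a) = fst s'' a" "R M2 o2 (snd s'')"
    by auto
  have "exp_val (fst (M, ot)) (rename_exp h b) \<noteq> 0"
    using While_true by (simp add: exp_val_rename[of M h "fst s"])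
  from exec.While_true[OF this 1(1)] 2(1)
  have "exec (translate h em (While b c)) (M, ot) (t1 + t2 + 1) (M2, o2)" by simp
  then show ?case
    using 1 2 by (intro exI[of _ "t1 + t2 + 1"] exI[of _ M2] exI[of _ o2]) auto
qed

lemma exec_rename:
  assumes "exec c (m, []) t (m', ys)" and "inj h" and "\<And>a. M (h a) = m a"
  shows "\<exists>t' M'. exec (translate h Emit c) (M, os) t' (M', os @ ys) \<and> t' \<le> 2 * t \<and>
    (\<forall>b. b \<notin> range h \<longrightarrow> M' b = M b)"
proof -
  let ?R = "\<lambda>M' o' o''. o' = os @ o'' \<and> (\<forall>b. b \<notin> range h \<longrightarrow> M' b = M b)"
  have "\<exists>t' M' ot'. exec (translate h Emit c) (M, os) t' (M', ot') \<and> t' \<le> 2 * t \<and>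
      (\<forall>a. M' (h a) = fst (m', ys) a) \<and> ?R M' ot' (snd (m', ys))"
  proof (rule exec_translate[where R = ?R, OF assms(1,2)])
    fix M1 o' o'' e
    assume "?R M1 o' o''"
    moreover have "exec (Emit e) (M1, o') 1 (M1, o' @ [exp_val M1 e])" by (rule exec.Emit)
    ultimately show "\<exists>M' ot t'. exec (Emit e) (M1, o') t' (M', ot) \<and> t' \<le> 2 \<and>
        (\<forall>a. M' (h a) = M1 (h a)) \<and> ?R M' ot (o'' @ [exp_val M1 e])"
      by (intro exI[of _ M1] exI[of _ "o' @ [exp_val M1 e]"] exI[of _ 1]) auto
  qed (use assms(3) in auto)
  then show ?thesis by auto
qed

section \<open>Feeding the output of one program into another\<close>

definition store :: "exp \<Rightarrow> com" where
  "store e = Seq (Put 0 (Get 2 (Const 0)) e) (Put 2 (Const 0) (Add (Get 2 (Const 0)) (Const 1)))"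

text \<open>The counter sits in array \<open>5\<close>, the renamed array \<open>1\<close> of the
  first program, so on exit it is the input length that this program expects there. Moved cells of
  array \<open>0\<close> are cleared because the second program starts with an empty word that is
  still to be filled.\<close>

definition copy_input :: com where
  "copy_input = While (Sub (Get 1 (Const 0)) (Get 5 (Const 0)))
     (Seq (Put 3 (Get 5 (Const 0)) (Get 0 (Get 5 (Const 0))))
       (Seq (Put 0 (Get 5 (Const 0)) (Const 0))
         (Put 5 (Const 0) (Add (Get 5 (Const 0)) (Const 1)))))"

text \<open>The first program lives in the arrays \<open>2 * a + 3\<close>, the second in the arrays
  \<open>2 * a\<close>. Hence arrays \<open>0\<close> and \<open>2\<close> are the input word and
  input length of the second program, and \<open>store\<close> appends to that word. Array
  \<open>1\<close> belongs to neither: it keeps the bound of the copying loop.\<close>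

definition pipe :: "com \<Rightarrow> com \<Rightarrow> com" where
  "pipe p p' = Seq copy_input
     (Seq (translate (\<lambda>a. 2 * a + 3) store p) (translate (\<lambda>a. 2 * a) Emit p'))"

lemma exec_copy_input:
  "\<exists>t M. exec copy_input (init xs, []) t (M, []) \<and> t \<le> 4 * length xs + 1 \<and>
     (\<forall>a. M (2 * a + 3) = init xs a) \<and> (\<forall>a. M (2 * a) = init [] a)"
proof -
  \<comment> \<open>The memory after \<open>j\<close> rounds of the copying loop.\<close>
  define S where "S j = (\<lambda>(a::nat) i. if a = 0 then if j \<le> i \<and> i < length xs then xs ! i else 0
      else if a = 1 then if i = 0 then length xs else 0
      else if a = 3 then if i < j then xs ! i else 0
      else if a = 5 then if i = 0 then j else 0 else (0::nat))" for j :: nat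
  have "j \<le> length xs \<Longrightarrow> exec copy_input (S j, []) (4 * (length xs - j) + 1) (S (length xs), [])" for j
  proof (induction j rule: inc_induct)
    case base
    show ?case unfolding copy_input_def using exec.While_false[of "(S (length xs), [])"] by (simp add: S_def)
  next
    case (step j)
    have upd: "(S j)(3 := (S j 3)(j := xs ! j), 0 := (S j 0)(j := 0), 5 := (S j 5)(0 := Suc j)) = S (Suc j)"
      using step by (auto simp: S_def fun_eq_iff less_Suc_eq)
    let ?M1 = "(S j)(3 := (S j 3)(j := xs ! j))"
    let ?M2 = "?M1(0 := (S j 0)(j := 0))"
    have "exec (Put 3 (Get 5 (Const 0)) (Get 0 (Get 5 (Const 0)))) (S j, []) 1 (?M1, [])"
      using exec.Put[of 3 "Get 5 (Const 0)" "Get 0 (Get 5 (Const 0))" "S j" "[]"] step by (simp add: S_def)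
    moreover have "exec (Put 0 (Get 5 (Const 0)) (Const 0)) (?M1, []) 1 (?M2, [])"
      using exec.Put[of 0 "Get 5 (Const 0)" "Const 0" ?M1 "[]"] step by (simp add: S_def)
    moreover have "exec (Put 5 (Const 0) (Add (Get 5 (Const 0)) (Const 1))) (?M2, []) 1
        (?M2(5 := (S j 5)(0 := Suc j)), [])"
      using exec.Put[of 5 "Const 0" "Add (Get 5 (Const 0)) (Const 1)" ?M2 "[]"] step by (simp add: S_def)
    ultimately have this: "exec (Seq (Put 3 (Get 5 (Const 0)) (Get 0 (Get 5 (Const 0))))
       (Seq (Put 0 (Get 5 (Const 0)) (Const 0))
         (Put 5 (Const 0) (Add (Get 5 (Const 0)) (Const 1))))) (S j, []) (1 + (1 + 1))
       (?M2(5 := (S j 5)(0 := Suc j)), [])"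
      by (intro exec.Seq)
    from exec.While_true[OF _ this[unfolded upd] step.IH[unfolded copy_input_def]] step
    have "exec copy_input (S j, []) (1 + (1 + 1) + (4 * (length xs - Suc j) + 1) + 1) (S (length xs), [])"
      unfolding copy_input_def by (simp add: S_def)
    moreover have "1 + (1 + 1) + (4 * (length xs - Suc j) + 1) + 1 = 4 * (length xs - j) + 1"
      using step by simp
    ultimately show ?case by simp
  qed
  from this[of 0] have "exec copy_input (S 0, []) (4 * length xs + 1) (S (length xs), [])" by simp
  moreover have "S 0 = init xs" by (auto simp: S_def init_def fun_eq_iff)
  moreover have "S (length xs) (2 * a + 3) = init xs a" for a
    by (auto simp: S_def init_def fun_eq_iff)
  moreover have "2 * a \<noteq> 3" "2 * a \<noteq> 5" for a :: nat
    by presburger+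
  then have "S (length xs) (2 * a) = init [] a" for a
    by (auto simp: S_def init_def fun_eq_iff)
  ultimately show ?thesis by (metis order_refl)
qed

lemma computes_in_pipe:
  assumes "computes_in p xs ys t" and "computes_in p' ys zs t'"
  shows "\<exists>t''. computes_in (pipe p p') xs zs t'' \<and> t'' \<le> 4 * length xs + 1 + 2 * t + 2 * t'"
proof -
  obtain m m' where m: "exec p (init xs, []) t (m, ys)" and m': "exec p' (init ys, []) t' (m', zs)"
    using assms by (auto simp: computes_in_def)
  obtain t0 M0 where 0: "exec copy_input (init xs, []) t0 (M0, [])" "t0 \<le> 4 * length xs + 1"
    "\<And>a. M0 (2 * a + 3) = init xs a" "\<And>a. M0 (2 * a) = init [] a"
    using exec_copy_input by metis
  let ?h = "\<lambda>a. 2 * a + 3 :: nat"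
  \<comment> \<open>What the first program has emitted so far is already in place as the input of
    the second, and the real tape is still empty.\<close>
  let ?R = "\<lambda>M' o' o''. o' = [] \<and> (\<forall>a. M' (2 * a) = init o'' a)"
  have par: "2 * a \<notin> range ?h" for a
    by (auto) presburger
  have "\<exists>t' M' ot'. exec (translate ?h store p) (M0, []) t' (M', ot') \<and> t' \<le> 2 * t \<and>
      (\<forall>a. M' (?h a) = fst (m, ys) a) \<and> ?R M' ot' (snd (m, ys))"
  proof (rule exec_translate[where R = ?R, OF m])
    fix M1 :: memory and o' :: "nat list" and o'' e
    assume R: "?R M1 o' o''"
    let ?M = "M1(0 := (M1 0)(length o'' := exp_val M1 e))"
    let ?M2 = "?M(2 := (?M 2)(0 := Suc (length o'')))"
    have R0: "M1 0 = init o'' 0" "M1 2 = init o'' 1"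
      using R[THEN conjunct2, THEN spec, of 0] R[THEN conjunct2, THEN spec, of 1] by simp_all
    then have len: "M1 2 0 = length o''"
      by (simp add: init_def)
    have "exec (Put 0 (Get 2 (Const 0)) e) (M1, o') 1 (?M, o')"
      using exec.Put[of 0 "Get 2 (Const 0)" e M1 o'] by (simp add: len)
    moreover have "exec (Put 2 (Const 0) (Add (Get 2 (Const 0)) (Const 1))) (?M, o') 1 (?M2, o')"
      using exec.Put[of 2 "Const 0" "Add (Get 2 (Const 0)) (Const 1)" ?M o'] by (simp add: len)
    ultimately have "exec (store e) (M1, o') (1 + 1) (?M2, o')"
      unfolding store_def by (rule exec.Seq)
    moreover have "?M2 (2 * a) = init (o'' @ [exp_val M1 e]) a" for a
      using R R0 by (cases "a = 0"; cases "a = 1") (auto simp: init_def fun_eq_iff nth_append)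
    moreover have "?M2 (?h a) = M1 (?h a)" for a by simp
    ultimately show "\<exists>M' ot t'. exec (store e) (M1, o') t' (M', ot) \<and> t' \<le> 2 \<and>
        (\<forall>a. M' (?h a) = M1 (?h a)) \<and> ?R M' ot (o'' @ [exp_val M1 e])"
      using R by (intro exI[of _ ?M2] exI[of _ o'] exI[of _ "1 + 1"]) auto
  qed (use 0 par in \<open>auto simp: inj_on_def\<close>)
  then obtain t1 M1 where 1: "exec (translate ?h store p) (M0, []) t1 (M1, [])" "t1 \<le> 2 * t"
    "\<And>a. M1 (2 * a) = init ys a"
    by auto
  obtain t2 M2 where 2: "exec (translate (\<lambda>a. 2 * a) Emit p') (M1, []) t2 (M2, zs)" "t2 \<le> 2 * t'"
    using exec_rename[OF m', of "\<lambda>a. 2 * a" M1 "[]"] 1(3) by (auto simp: inj_on_def)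
  have "exec (pipe p p') (init xs, []) (t0 + (t1 + t2)) (M2, zs)"
    unfolding pipe_def by (intro exec.Seq) (fact 0 1 2)+
  then show ?thesis
    using 0(2) 1(2) 2(2) by (intro exI[of _ "t0 + (t1 + t2)"]) (auto simp: computes_in_def)
qed

text \<open>Hands both bounds of a given reduction to one program that combines them into a single
  computable bound.\<close>

lemma computes_pair:
  assumes "computable f" and "computable g"
  shows "\<exists>p. \<forall>n. \<exists>t. computes_in p [n] [f n, g n] t"
proof -
  obtain p p' where p: "\<And>n. \<exists>t. computes_in p [n] [f n] t" and p': "\<And>n. \<exists>t. computes_in p' [n] [g n] t"
    using assms by (auto simp: computable_def)
  \<comment> \<open>Arrays \<open>3\<close> and \<open>5\<close> receive the word and its length for
    \<open>p\<close>; array \<open>0\<close> already holds the word for \<open>p'\<close>, so only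
    its length cell in array \<open>2\<close> is missing.\<close>
  define q where "q = Seq (Put 3 (Const 0) (Get 0 (Const 0))) (Seq (Put 5 (Const 0) (Const 1))
    (Seq (Put 2 (Const 0) (Const 1)) (Seq (translate (\<lambda>a. 2 * a + 3) Emit p) (translate (\<lambda>a. 2 * a) Emit p'))))"
  have "\<exists>t. computes_in q [n] [f n, g n] t" for n
  proof -
    obtain t t' m m' where m: "exec p (init [n], []) t (m, [f n])" and m': "exec p' (init [n], []) t' (m', [g n])"
      using p[of n] p'[of n] by (auto simp: computes_in_def)
    let ?M1 = "(init [n])(3 := (init [n] 3)(0 := n))"
    let ?M2 = "?M1(5 := (?M1 5)(0 := 1))"
    let ?M3 = "?M2(2 := (?M2 2)(0 := 1))"
    have e1: "exec (Put 3 (Const 0) (Get 0 (Const 0))) (init [n], []) 1 (?M1, [])"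
      using exec.Put[of 3 "Const 0" "Get 0 (Const 0)" "init [n]" "[]"] by (simp add: init_def)
    have e2: "exec (Put 5 (Const 0) (Const 1)) (?M1, []) 1 (?M2, [])"
      using exec.Put[of 5 "Const 0" "Const 1" ?M1 "[]"] by simp
    have e3: "exec (Put 2 (Const 0) (Const 1)) (?M2, []) 1 (?M3, [])"
      using exec.Put[of 2 "Const 0" "Const 1" ?M2 "[]"] by simp
    have odds: "?M3 (2 * a + 3) = init [n] a" for a
      by (cases "a = 0"; cases "a = 1") (auto simp: init_def fun_eq_iff)
    have "2 * a \<noteq> 3" "2 * a \<noteq> 5" for a :: nat
      by presburger+
    then have evens: "?M3 (2 * a) = init [n] a" for a
      by (cases "a = 0"; cases "a = 1") (auto simp: init_def fun_eq_iff)
    obtain t1 M4 where e4: "exec (translate (\<lambda>a. 2 * a + 3) Emit p) (?M3, []) t1 (M4, [] @ [f n])"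
        and "\<forall>b. b \<notin> range (\<lambda>a. 2 * a + 3) \<longrightarrow> M4 b = ?M3 b"
      using exec_rename[OF m, of "\<lambda>a. 2 * a + 3" ?M3 "[]"] odds by (auto simp: inj_on_def)
    then have "M4 (2 * a) = ?M3 (2 * a)" for a
      by (metis (no_types, lifting) even_add even_mult_iff even_numeral odd_numeral rangeE)
    then have "M4 (2 * a) = init [n] a" for a
      using evens by metis
    then obtain t2 M5 where e5: "exec (translate (\<lambda>a. 2 * a) Emit p') (M4, [] @ [f n]) t2 (M5, ([] @ [f n]) @ [g n])"
      using exec_rename[OF m', of "\<lambda>a. 2 * a" M4 "[] @ [f n]"] by (auto simp: inj_on_def)
    have "exec q (init [n], []) (1 + (1 + (1 + (t1 + t2)))) (M5, ([] @ [f n]) @ [g n])"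
      unfolding q_def by (intro exec.Seq) (fact e1 e2 e3 e4 e5)+
    then show ?thesis by (auto simp: computes_in_def)
  qed
  then show ?thesis by blast
qed

section \<open>Programs with bounded loops\<close>

text \<open>All loops run up to the same number, cell \<open>0\<close> of array \<open>1\<close>, so
  the time of nested loops is polynomial in that one number. By truncation the difference is nonzero
  exactly while the counter is below the bound.\<close>

definition loop :: "nat \<Rightarrow> com \<Rightarrow> com" where
  "loop r c = While (Sub (Get 1 (Const 0)) (Get r (Const 0)))
     (Seq c (Put r (Const 0) (Add (Get r (Const 0)) (Const 1))))"

lemma exec_Put': "m' = m(a := (m a)(exp_val m i := exp_val m e)) \<Longrightarrow> exec (Put a i e) (m, ot) 1 (m', ot)"
  using exec.Put by simp

lemma exec_loop:
  assumes r: "r \<noteq> 1"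
    and body: "\<And>j m ot. j < n \<Longrightarrow> I j m ot \<Longrightarrow> m 1 0 = n \<Longrightarrow> m r 0 = j \<Longrightarrow>
      \<exists>t m' ot'. exec c (m, ot) t (m', ot') \<and> t \<le> T \<and> m' 1 0 = n \<and> m' r 0 = j \<and>
        I (Suc j) (m'(r := (m' r)(0 := Suc j))) ot'"
    and "I 0 m ot" "m 1 0 = n" "m r 0 = 0"
  shows "\<exists>t m' ot'. exec (loop r c) (m, ot) t (m', ot') \<and> t \<le> n * (T + 2) + 1 \<and> I n m' ot'"
proof -
  have "j \<le> n \<Longrightarrow> I j m ot \<Longrightarrow> m 1 0 = n \<Longrightarrow> m r 0 = j \<Longrightarrow>
    \<exists>t m' ot'. exec (loop r c) (m, ot) t (m', ot') \<and> t \<le> (n - j) * (T + 2) + 1 \<and> I n m' ot'" for j m ot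
  proof (induction "n - j" arbitrary: j m ot)
    case 0
    then have "exec (loop r c) (m, ot) 1 (m, ot)"
      unfolding loop_def by (intro exec.While_false) simp
    with 0 show ?case by (intro exI[of _ 1] exI[of _ m] exI[of _ ot]) auto
  next
    case (Suc x)
    then have "j < n" by simp
    with body[OF this] Suc obtain t1 m1 o1 where 1: "exec c (m, ot) t1 (m1, o1)" "t1 \<le> T" "m1 1 0 = n" "m1 r 0 = j"
      "I (Suc j) (m1(r := (m1 r)(0 := Suc j))) o1" by blast
    let ?m = "m1(r := (m1 r)(0 := Suc j))"
    have "exec (Put r (Const 0) (Add (Get r (Const 0)) (Const 1))) (m1, o1) 1 (?m, o1)"
      by (rule exec_Put') (simp add: 1)
    with 1(1) have 2: "exec (Seq c (Put r (Const 0) (Add (Get r (Const 0)) (Const 1)))) (m, ot) (t1 + 1) (?m, o1)"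
      by (rule exec.Seq)
    have "\<exists>t m' ot'. exec (loop r c) (?m, o1) t (m', ot') \<and> t \<le> (n - Suc j) * (T + 2) + 1 \<and> I n m' ot'"
      using Suc.hyps(2) \<open>j < n\<close> 1 r by (intro Suc.hyps(1)) auto
    then obtain t2 m2 o2 where
      3: "exec (loop r c) (?m, o1) t2 (m2, o2)" "t2 \<le> (n - Suc j) * (T + 2) + 1" "I n m2 o2"
      by blast
    have "exec (loop r c) (m, ot) (t1 + 1 + t2 + 1) (m2, o2)"
      using exec.While_true[OF _ 2 3(1)[unfolded loop_def]] Suc.prems \<open>j < n\<close> unfolding loop_def by simp
    moreover have "t1 + 1 + t2 + 1 \<le> (n - j) * (T + 2) + 1"
    proof -
      have "n - j = Suc (n - Suc j)" using \<open>j < n\<close> by simp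
      then show ?thesis using 1(2) 3(2) by simp
    qed
    ultimately show ?case using 3(3) by blast
  qed
  from this[of 0 m ot] assms show ?thesis by simp
qed

text \<open>Times are recorded as exponents of a base \<open>B \<ge> 2\<close>: sequencing adds
  exponents, the extra \<open>1\<close> absorbing the factor 2, and by the next lemma a loop adds
  \<open>4\<close>.\<close>

lemma add_le_power: "x \<le> B ^ a \<Longrightarrow> y \<le> B ^ b \<Longrightarrow> 2 \<le> B \<Longrightarrow> x + y \<le> (B::nat) ^ (a + b + 1)"
proof -
  assume *: "x \<le> B ^ a" "y \<le> B ^ b" "2 \<le> B"
  have "B ^ a \<le> B ^ (a + b)" "B ^ b \<le> B ^ (a + b)"
    using *(3) by (auto intro: power_increasing)
  with * have "x + y \<le> 2 * B ^ (a + b)" by linarith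
  also have "\<dots> \<le> B * B ^ (a + b)" using *(3) by (rule mult_right_mono) simp
  finally show ?thesis by simp
qed

lemma loop_time_le_power:
  assumes "n + 2 \<le> B" and "T \<le> (B::nat) ^ c"
  shows "n * (T + 2) + 1 \<le> B ^ (c + 4)"
proof -
  have "1 \<le> B ^ c" using assms(1) by simp
  then have "n * (T + 2) + 1 \<le> B * (3 * B ^ c) + B ^ c"
    using assms by (intro add_mono mult_mono) linarith+
  also have "\<dots> \<le> 4 * (B * B ^ c)" using assms(1) by auto
  also have "\<dots> \<le> (B * B) * (B * B ^ c)"
    using assms(1) by (intro mult_right_mono mult_mono[of 2 B 2 B, simplified]) auto
  also have "\<dots> \<le> B * ((B * B) * (B * B ^ c))" using assms(1) by simp
  also have "\<dots> = B ^ (c + 4)" by (simp add: power_add power4_eq_xxxx)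
  finally show ?thesis .
qed

subsection \<open>Expressions with bounded sums\<close>

text \<open>The summation variable of every \<open>FSum\<close> runs below the contents of cell \<open>0\<close> of array \<open>1\<close>;
  variables are de Bruijn indices.\<close>

datatype fexp = FConst nat | FVar nat | FGet nat fexp | FAdd fexp fexp | FSub fexp fexp
  | FIf fexp fexp fexp | FSum fexp

primrec fval :: "memory \<Rightarrow> (nat \<Rightarrow> nat) \<Rightarrow> fexp \<Rightarrow> nat" where
  "fval m \<rho> (FConst n) = n"
| "fval m \<rho> (FVar i) = \<rho> i"
| "fval m \<rho> (FGet a e) = m a (fval m \<rho> e)"
| "fval m \<rho> (FAdd e e') = fval m \<rho> e + fval m \<rho> e'"
| "fval m \<rho> (FSub e e') = fval m \<rho> e - fval m \<rho> e'"
| "fval m \<rho> (FIf b e e') = (if fval m \<rho> b \<noteq> 0 then fval m \<rho> e else fval m \<rho> e')"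
| "fval m \<rho> (FSum e) = (\<Sum>v<m 1 0. fval m (case_nat v \<rho>) e)"

text \<open>From this index on arrays are free to serve as registers. It is at least
  \<open>2\<close> because sums read the loop bound in array \<open>1\<close>.\<close>

primrec arrays_below :: "fexp \<Rightarrow> nat" where
  "arrays_below (FConst n) = 2"
| "arrays_below (FVar i) = 2"
| "arrays_below (FGet a e) = max (Suc a) (arrays_below e)"
| "arrays_below (FAdd e e') = max (arrays_below e) (arrays_below e')"
| "arrays_below (FSub e e') = max (arrays_below e) (arrays_below e')"
| "arrays_below (FIf b e e') = max (arrays_below b) (max (arrays_below e) (arrays_below e'))"
| "arrays_below (FSum e) = arrays_below e"

lemma arrays_below_ge: "2 \<le> arrays_below e"
  by (induction e) auto

lemma fval_cong: "(\<And>a. a < arrays_below e \<Longrightarrow> m a = m' a) \<Longrightarrow> fval m \<rho> e = fval m' \<rho> e"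
proof (induction e arbitrary: \<rho>)
  case (FSum e)
  have "m 1 = m' 1" using FSum.prems arrays_below_ge[of e] by simp
  with FSum show ?case by simp
qed auto

lemma fval_agree:
  assumes "arrays_below e \<le> r" and "\<And>i. s i < r" and "\<forall>a<r. m' a = m a"
  shows "fval m' (\<lambda>i. m' (s i) 0) e = fval m (\<lambda>i. m (s i) 0) e"
proof -
  have "(\<lambda>i. m' (s i) 0) = (\<lambda>i. m (s i) 0)" using assms by auto
  then show ?thesis using assms by (auto intro: fval_cong)
qed

text \<open>The result goes to register \<open>r\<close>, everything above is scratch, and
  \<open>s\<close> maps de Bruijn indices to the registers of the variables. A second operand is
  evaluated from \<open>r + 1\<close> on; a sum keeps its total in \<open>r\<close> and its counter,
  the new variable \<open>0\<close>, in \<open>r + 1\<close>.\<close>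

primrec fcompile :: "nat \<Rightarrow> (nat \<Rightarrow> nat) \<Rightarrow> fexp \<Rightarrow> com" where
  "fcompile r s (FConst n) = Put r (Const 0) (Const n)"
| "fcompile r s (FVar i) = Put r (Const 0) (Get (s i) (Const 0))"
| "fcompile r s (FGet a e) = Seq (fcompile r s e) (Put r (Const 0) (Get a (Get r (Const 0))))"
| "fcompile r s (FAdd e e') = Seq (fcompile r s e) (Seq (fcompile (r + 1) s e')
     (Put r (Const 0) (Add (Get r (Const 0)) (Get (r + 1) (Const 0)))))"
| "fcompile r s (FSub e e') = Seq (fcompile r s e) (Seq (fcompile (r + 1) s e')
     (Put r (Const 0) (Sub (Get r (Const 0)) (Get (r + 1) (Const 0)))))"
| "fcompile r s (FIf b e e') = Seq (fcompile r s b) (Cond (Get r (Const 0)) (fcompile r s e) (fcompile r s e'))"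
| "fcompile r s (FSum e) = Seq (Put r (Const 0) (Const 0)) (Seq (Put (r + 1) (Const 0) (Const 0))
     (loop (r + 1) (Seq (fcompile (r + 2) (case_nat (r + 1) s) e)
        (Put r (Const 0) (Add (Get r (Const 0)) (Get (r + 2) (Const 0)))))))"

text \<open>An exponent, not a number of steps: the time is at most \<open>B ^ fcost e\<close> for
  every \<open>B\<close> that exceeds the loop bound by at least two.\<close>

primrec fcost :: "fexp \<Rightarrow> nat" where
  "fcost (FConst n) = 0"
| "fcost (FVar i) = 0"
| "fcost (FGet a e) = fcost e + 1"
| "fcost (FAdd e e') = fcost e + fcost e' + 2"
| "fcost (FSub e e') = fcost e + fcost e' + 2"
| "fcost (FIf b e e') = fcost b + fcost e + fcost e' + 2"
| "fcost (FSum e) = fcost e + 8"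

lemma exec_fcompile:
  assumes "arrays_below e \<le> r" and "\<And>i. s i < r" and "m 1 0 + 2 \<le> B"
  shows "\<exists>t m'. exec (fcompile r s e) (m, ot) t (m', ot) \<and> m' r 0 = fval m (\<lambda>i. m (s i) 0) e \<and>
    (\<forall>a<r. m' a = m a) \<and> t \<le> B ^ fcost e"
  using assms
proof (induction e arbitrary: r s m)
  case (FConst n)
  have "exec (fcompile r s (FConst n)) (m, ot) 1 (m(r := (m r)(0 := n)), ot)"
    by (simp del: One_nat_def, rule exec_Put') simp
  moreover have "(m(r := (m r)(0 := n))) r 0 = fval m (\<lambda>i. m (s i) 0) (FConst n)" "\<forall>a<r. (m(r := (m r)(0 := n))) a = m a"
    by auto
  moreover have "1 \<le> B ^ fcost (FConst n)" by simp
  ultimately show ?case by blast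
next
  case (FVar i)
  let ?m = "m(r := (m r)(0 := m (s i) 0))"
  have "exec (fcompile r s (FVar i)) (m, ot) 1 (?m, ot)"
    by (simp del: One_nat_def, rule exec_Put') simp
  moreover have "?m r 0 = fval m (\<lambda>i. m (s i) 0) (FVar i)" "\<forall>a<r. ?m a = m a"
    by auto
  moreover have "1 \<le> B ^ fcost (FVar i)" by simp
  ultimately show ?case by blast
next
  case (FGet a e)
  from FGet.IH[of r s m] FGet.prems obtain t1 m1 where 1: "exec (fcompile r s e) (m, ot) t1 (m1, ot)" "m1 r 0 = fval m (\<lambda>i. m (s i) 0) e"
    "\<forall>a<r. m1 a = m a" "t1 \<le> B ^ fcost e" by auto
  let ?m = "m1(r := (m1 r)(0 := m a (m1 r 0)))"
  have "exec (Put r (Const 0) (Get a (Get r (Const 0)))) (m1, ot) 1 (?m, ot)"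
    using 1(3) FGet.prems by (intro exec_Put') simp
  with 1(1) have "exec (fcompile r s (FGet a e)) (m, ot) (t1 + 1) (?m, ot)"
    by (simp del: One_nat_def add: exec.Seq)
  moreover have "t1 + 1 \<le> B ^ fcost (FGet a e)"
    using add_le_power[OF 1(4), of 1 0] FGet.prems by simp
  moreover have "?m r 0 = fval m (\<lambda>i. m (s i) 0) (FGet a e)" "\<forall>a<r. ?m a = m a"
    using 1 by auto
  ultimately show ?case by blast
next
  case (FAdd e e')
  from FAdd.IH(1)[of r s m] FAdd.prems obtain t1 m1 where 1: "exec (fcompile r s e) (m, ot) t1 (m1, ot)" "m1 r 0 = fval m (\<lambda>i. m (s i) 0) e"
    "\<forall>a<r. m1 a = m a" "t1 \<le> B ^ fcost e" by auto
  have "m1 1 = m 1" using 1(3) FAdd.prems arrays_below_ge[of e] by simp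
  with FAdd.IH(2)[of "r + 1" s m1] FAdd.prems obtain t2 m2 where
    2: "exec (fcompile (r + 1) s e') (m1, ot) t2 (m2, ot)" "m2 (r + 1) 0 = fval m1 (\<lambda>i. m1 (s i) 0) e'"
    "\<forall>a<r + 1. m2 a = m1 a" "t2 \<le> B ^ fcost e'" by (auto simp: less_Suc_eq)
  have v: "fval m1 (\<lambda>i. m1 (s i) 0) e' = fval m (\<lambda>i. m (s i) 0) e'"
    using 1(3) FAdd.prems by (intro fval_agree) auto
  let ?m = "m2(r := (m2 r)(0 := m2 r 0 + m2 (r + 1) 0))"
  have "exec (Put r (Const 0) (Add (Get r (Const 0)) (Get (r + 1) (Const 0)))) (m2, ot) 1 (?m, ot)"
    by (intro exec_Put') simp
  with 1(1) 2(1) have "exec (fcompile r s (FAdd e e')) (m, ot) (t1 + (t2 + 1)) (?m, ot)"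
    by (simp del: One_nat_def add: exec.Seq)
  moreover have "t1 + (t2 + 1) \<le> B ^ fcost (FAdd e e')"
    using add_le_power[OF add_le_power[OF 1(4) 2(4)], of 1 0] FAdd.prems by simp
  moreover have "?m r 0 = fval m (\<lambda>i. m (s i) 0) (FAdd e e')" "\<forall>a<r. ?m a = m a"
    using 1 2 v by auto
  ultimately show ?case by blast
next
  case (FSub e e')
  from FSub.IH(1)[of r s m] FSub.prems obtain t1 m1 where 1: "exec (fcompile r s e) (m, ot) t1 (m1, ot)" "m1 r 0 = fval m (\<lambda>i. m (s i) 0) e"
    "\<forall>a<r. m1 a = m a" "t1 \<le> B ^ fcost e" by auto
  have "m1 1 = m 1" using 1(3) FSub.prems arrays_below_ge[of e] by simp
  with FSub.IH(2)[of "r + 1" s m1] FSub.prems obtain t2 m2 where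
    2: "exec (fcompile (r + 1) s e') (m1, ot) t2 (m2, ot)" "m2 (r + 1) 0 = fval m1 (\<lambda>i. m1 (s i) 0) e'"
    "\<forall>a<r + 1. m2 a = m1 a" "t2 \<le> B ^ fcost e'" by (auto simp: less_Suc_eq)
  have v: "fval m1 (\<lambda>i. m1 (s i) 0) e' = fval m (\<lambda>i. m (s i) 0) e'"
    using 1(3) FSub.prems by (intro fval_agree) auto
  let ?m = "m2(r := (m2 r)(0 := m2 r 0 - m2 (r + 1) 0))"
  have "exec (Put r (Const 0) (Sub (Get r (Const 0)) (Get (r + 1) (Const 0)))) (m2, ot) 1 (?m, ot)"
    by (intro exec_Put') simp
  with 1(1) 2(1) have "exec (fcompile r s (FSub e e')) (m, ot) (t1 + (t2 + 1)) (?m, ot)"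
    by (simp del: One_nat_def add: exec.Seq)
  moreover have "t1 + (t2 + 1) \<le> B ^ fcost (FSub e e')"
    using add_le_power[OF add_le_power[OF 1(4) 2(4)], of 1 0] FSub.prems by simp
  moreover have "?m r 0 = fval m (\<lambda>i. m (s i) 0) (FSub e e')" "\<forall>a<r. ?m a = m a"
    using 1 2 v by auto
  ultimately show ?case by blast
next
  case (FIf b e e')
  from FIf.IH(1)[of r s m] FIf.prems obtain t1 m1 where 1: "exec (fcompile r s b) (m, ot) t1 (m1, ot)" "m1 r 0 = fval m (\<lambda>i. m (s i) 0) b"
    "\<forall>a<r. m1 a = m a" "t1 \<le> B ^ fcost b" by auto
  define d where "d = (if m1 r 0 \<noteq> 0 then e else e')"
  have "m1 1 = m 1" using 1(3) FIf.prems arrays_below_ge[of e] by simp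
  then obtain t2 m2 where
    2: "exec (fcompile r s d) (m1, ot) t2 (m2, ot)" "m2 r 0 = fval m1 (\<lambda>i. m1 (s i) 0) d"
    "\<forall>a<r. m2 a = m1 a" "t2 \<le> B ^ fcost d"
    using FIf.IH(2)[of r s m1] FIf.IH(3)[of r s m1] FIf.prems
    by (cases "m1 r 0 = 0") (auto simp: d_def)
  have "arrays_below d \<le> r" using FIf.prems by (simp add: d_def)
  then have v: "fval m1 (\<lambda>i. m1 (s i) 0) d = fval m (\<lambda>i. m (s i) 0) d"
    using 1(3) FIf.prems by (intro fval_agree) auto
  have "exec (Cond (Get r (Const 0)) (fcompile r s e) (fcompile r s e')) (m1, ot) (t2 + 1) (m2, ot)"
  proof (cases "m1 r 0 = 0")
    case True
    with 2(1) show ?thesis by (intro exec.Cond_false) (auto simp: d_def)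
  next
    case False
    with 2(1) show ?thesis by (intro exec.Cond_true) (auto simp: d_def)
  qed
  with 1(1) have "exec (fcompile r s (FIf b e e')) (m, ot) (t1 + (t2 + 1)) (m2, ot)"
    by (simp del: One_nat_def add: exec.Seq)
  moreover have "t1 + (t2 + 1) \<le> B ^ fcost (FIf b e e')"
  proof -
    have "B ^ fcost d \<le> B ^ (fcost e + fcost e')"
      using FIf.prems by (intro power_increasing) (auto simp: d_def)
    with 2(4) have "t2 \<le> B ^ (fcost e + fcost e')" by simp
    from add_le_power[OF add_le_power[OF 1(4) this], of 1 0] FIf.prems show ?thesis by (simp add: add.assoc)
  qed
  moreover have "fval m (\<lambda>i. m (s i) 0) d = fval m (\<lambda>i. m (s i) 0) (FIf b e e')"
    using 1(2) by (simp add: d_def)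
  moreover have "m2 r 0 = fval m (\<lambda>i. m (s i) 0) (FIf b e e')" "\<forall>a<r. m2 a = m a"
    using 1 2 v by (auto simp: d_def)
  ultimately show ?case by blast
next
  case (FSum e)
  define n where "n = m 1 0"
  let ?\<rho> = "\<lambda>i. m (s i) 0"
  let ?c = "Seq (fcompile (r + 2) (case_nat (r + 1) s) e)
        (Put r (Const 0) (Add (Get r (Const 0)) (Get (r + 2) (Const 0))))"
  let ?m0 = "m(r := (m r)(0 := 0))"
  let ?m1 = "?m0(r + 1 := (?m0 (r + 1))(0 := 0))"
  have r: "2 \<le> r" using FSum.prems arrays_below_ge[of e] by simp
  define I where "I j m' ot' \<longleftrightarrow> ot' = ot \<and> m' r 0 = (\<Sum>v<j. fval m (case_nat v ?\<rho>) e) \<and> (\<forall>a<r. m' a = m a)"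
    for j m' ot'
  have "\<exists>t m' ot'. exec (loop (r + 1) ?c) (?m1, ot) t (m', ot') \<and> t \<le> n * ((B ^ fcost e + 1) + 2) + 1 \<and> I n m' ot'"
  proof (rule exec_loop)
    fix j m' ot' assume *: "j < n" "I j m' ot'" "m' 1 0 = n" "m' (r + 1) 0 = j"
    have env: "(\<lambda>i. m' (case_nat (r + 1) s i) 0) = case_nat j ?\<rho>"
      using * FSum.prems by (auto simp: fun_eq_iff I_def split: nat.split)
    have lt: "case_nat (r + 1) s i < r + 2" for i
      using FSum.prems(2) by (auto split: nat.split intro: less_SucI)
    have "fval m' (case_nat j ?\<rho>) e = fval m (case_nat j ?\<rho>) e"
      using * FSum.prems by (intro fval_cong) (auto simp: I_def)
    with FSum.IH[of "r + 2" "case_nat (r + 1) s" m'] FSum.prems * lt obtain t2 m2 where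
      2: "exec (fcompile (r + 2) (case_nat (r + 1) s) e) (m', ot) t2 (m2, ot)"
        "m2 (r + 2) 0 = fval m (case_nat j ?\<rho>) e" "\<forall>a<r + 2. m2 a = m' a" "t2 \<le> B ^ fcost e"
      unfolding env by (auto simp: n_def)
    let ?m = "m2(r := (m2 r)(0 := m2 r 0 + m2 (r + 2) 0))"
    have "exec (Put r (Const 0) (Add (Get r (Const 0)) (Get (r + 2) (Const 0)))) (m2, ot) 1 (?m, ot)"
      by (intro exec_Put') simp
    with 2(1) have "exec ?c (m', ot) (t2 + 1) (?m, ot)" by (rule exec.Seq)
    moreover have "I (Suc j) (?m(r + 1 := (?m (r + 1))(0 := Suc j))) ot"
      using 2 * by (auto simp: I_def)
    ultimately show "\<exists>t m'' ot''. exec ?c (m', ot') t (m'', ot'') \<and> t \<le> B ^ fcost e + 1 \<and> m'' 1 0 = n \<and>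
        m'' (r + 1) 0 = j \<and> I (Suc j) (m''(r + 1 := (m'' (r + 1))(0 := Suc j))) ot''"
      using 2 * r by (intro exI[of _ "t2 + 1"] exI[of _ ?m] exI[of _ ot]) (auto simp: I_def)
  qed (use r in \<open>auto simp: I_def n_def\<close>)
  then obtain t3 m3 where 3: "exec (loop (r + 1) ?c) (?m1, ot) t3 (m3, ot)"
    "t3 \<le> n * ((B ^ fcost e + 1) + 2) + 1" "I n m3 ot" by (auto simp: I_def)
  have p1: "exec (Put r (Const 0) (Const 0)) (m, ot) 1 (?m0, ot)"
    by (intro exec_Put') simp
  have p2: "exec (Put (r + 1) (Const 0) (Const 0)) (?m0, ot) 1 (?m1, ot)"
    by (intro exec_Put') simp
  have "exec (fcompile r s (FSum e)) (m, ot) (1 + (1 + t3)) (m3, ot)"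
    unfolding fcompile.simps by (intro exec.Seq) (fact p1 p2 3)+
  moreover have "1 + (1 + t3) \<le> B ^ fcost (FSum e)"
  proof -
    have B: "2 \<le> B" using FSum.prems by simp
    have "B ^ fcost e + 1 \<le> B ^ (fcost e + 1)"
      using add_le_power[of "B ^ fcost e" B "fcost e" 1 0] B by simp
    from loop_time_le_power[OF FSum.prems(3) this] 3(2) have "t3 \<le> B ^ (fcost e + 5)"
      by (simp add: n_def algebra_simps)
    from add_le_power[OF add_le_power[OF this, of 1 0], of 1 0] B show ?thesis
      by (simp add: order_trans[OF _ power_increasing[of "fcost e + 7" "fcost e + 8" B]] add.commute)
  qed
  ultimately show ?case using 3(3)
    by (intro exI[of _ "1 + (1 + t3)"] exI[of _ m3]) (auto simp: I_def n_def)
qed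

section \<open>Output with bounded loops\<close>

datatype emitter = ENil | EVal fexp | EApp emitter emitter | EIf fexp emitter emitter | EFor emitter

primrec emitted :: "memory \<Rightarrow> (nat \<Rightarrow> nat) \<Rightarrow> emitter \<Rightarrow> nat list" where
  "emitted m \<rho> ENil = []"
| "emitted m \<rho> (EVal e) = [fval m \<rho> e]"
| "emitted m \<rho> (EApp p p') = emitted m \<rho> p @ emitted m \<rho> p'"
| "emitted m \<rho> (EIf b p p') = (if fval m \<rho> b \<noteq> 0 then emitted m \<rho> p else emitted m \<rho> p')"
| "emitted m \<rho> (EFor p) = concat (map (\<lambda>v. emitted m (case_nat v \<rho>) p) [0..<m 1 0])"

primrec earrays_below :: "emitter \<Rightarrow> nat" where
  "earrays_below ENil = 2"
| "earrays_below (EVal e) = arrays_below e"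
| "earrays_below (EApp p p') = max (earrays_below p) (earrays_below p')"
| "earrays_below (EIf b p p') = max (arrays_below b) (max (earrays_below p) (earrays_below p'))"
| "earrays_below (EFor p) = earrays_below p"

lemma earrays_below_ge: "2 \<le> earrays_below e"
  by (induction e) (auto simp: arrays_below_ge)

lemma emitted_cong: "(\<And>a. a < earrays_below e \<Longrightarrow> m a = m' a) \<Longrightarrow> emitted m \<rho> e = emitted m' \<rho> e"
proof (induction e arbitrary: \<rho>)
  case (EFor e)
  have "m 1 = m' 1" using EFor.prems earrays_below_ge[of e] by simp
  with EFor show ?case by simp
next
  case (EIf b p p')
  then have "fval m \<rho> b = fval m' \<rho> b" by (intro fval_cong) simp
  with EIf show ?case by simp
qed (auto intro: fval_cong)

lemma emitted_agree:
  assumes "earrays_below e \<le> r" and "\<And>i. s i < r" and "\<forall>a<r. m' a = m a"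
  shows "emitted m' (\<lambda>i. m' (s i) 0) e = emitted m (\<lambda>i. m (s i) 0) e"
proof -
  have "(\<lambda>i. m' (s i) 0) = (\<lambda>i. m (s i) 0)" using assms by auto
  then show ?thesis using assms by (auto intro: emitted_cong)
qed

primrec ecompile :: "nat \<Rightarrow> (nat \<Rightarrow> nat) \<Rightarrow> emitter \<Rightarrow> com" where
  "ecompile r s ENil = Skip"
| "ecompile r s (EVal e) = Seq (fcompile r s e) (Emit (Get r (Const 0)))"
| "ecompile r s (EApp p p') = Seq (ecompile r s p) (ecompile r s p')"
| "ecompile r s (EIf b p p') = Seq (fcompile r s b) (Cond (Get r (Const 0)) (ecompile r s p) (ecompile r s p'))"
| "ecompile r s (EFor p) = Seq (Put r (Const 0) (Const 0)) (loop r (ecompile (r + 1) (case_nat r s) p))"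

primrec ecost :: "emitter \<Rightarrow> nat" where
  "ecost ENil = 0"
| "ecost (EVal e) = fcost e + 1"
| "ecost (EApp p p') = ecost p + ecost p' + 1"
| "ecost (EIf b p p') = fcost b + ecost p + ecost p' + 2"
| "ecost (EFor p) = ecost p + 5"

lemma exec_ecompile:
  assumes "earrays_below e \<le> r" and "\<And>i. s i < r" and "m 1 0 + 2 \<le> B"
  shows "\<exists>t m'. exec (ecompile r s e) (m, ot) t (m', ot @ emitted m (\<lambda>i. m (s i) 0) e) \<and>
    (\<forall>a<r. m' a = m a) \<and> t \<le> B ^ ecost e"
  using assms
proof (induction e arbitrary: r s m ot)
  case ENil
  show ?case by (auto intro!: exI exec.Skip)
next
  case (EVal e)
  from exec_fcompile[of e r s m B ot] EVal
  obtain t1 m1 where 1: "exec (fcompile r s e) (m, ot) t1 (m1, ot)" "m1 r 0 = fval m (\<lambda>i. m (s i) 0) e"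
    "\<forall>a<r. m1 a = m a" "t1 \<le> B ^ fcost e" by auto
  have "exec (Emit (Get r (Const 0))) (m1, ot) 1 (m1, ot @ [m1 r 0])"
    using exec.Emit[of "Get r (Const 0)" m1 ot] by simp
  from exec.Seq[OF 1(1) this]
  have "exec (ecompile r s (EVal e)) (m, ot) (t1 + 1) (m1, ot @ [m1 r 0])" by simp
  moreover have "t1 + 1 \<le> B ^ ecost (EVal e)"
    using add_le_power[OF 1(4), of 1 0] EVal.prems by simp
  ultimately show ?case using 1 by (intro exI[of _ "t1 + 1"] exI[of _ m1]) auto
next
  case (EApp p p')
  from EApp.IH(1)[of r s m ot] EApp.prems obtain t1 m1 where
    1: "exec (ecompile r s p) (m, ot) t1 (m1, ot @ emitted m (\<lambda>i. m (s i) 0) p)"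
    "\<forall>a<r. m1 a = m a" "t1 \<le> B ^ ecost p" by auto
  have "m1 1 = m 1" using 1(2) EApp.prems earrays_below_ge[of p] by simp
  with EApp.IH(2)[of r s m1 "ot @ emitted m (\<lambda>i. m (s i) 0) p"] EApp.prems obtain t2 m2 where
    2: "exec (ecompile r s p') (m1, ot @ emitted m (\<lambda>i. m (s i) 0) p) t2
      (m2, (ot @ emitted m (\<lambda>i. m (s i) 0) p) @ emitted m1 (\<lambda>i. m1 (s i) 0) p')"
    "\<forall>a<r. m2 a = m1 a" "t2 \<le> B ^ ecost p'" by auto
  have v: "emitted m1 (\<lambda>i. m1 (s i) 0) p' = emitted m (\<lambda>i. m (s i) 0) p'"
    using 1(2) EApp.prems by (intro emitted_agree) auto
  have "t1 + t2 \<le> B ^ ecost (EApp p p')"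
    using add_le_power[OF 1(3) 2(3)] EApp.prems by simp
  with exec.Seq[OF 1(1) 2(1)] 1 2 v show ?case
    by (intro exI[of _ "t1 + t2"] exI[of _ m2]) auto
next
  case (EIf b e e')
  from exec_fcompile[of b r s m B ot] EIf
  obtain t1 m1 where 1: "exec (fcompile r s b) (m, ot) t1 (m1, ot)" "m1 r 0 = fval m (\<lambda>i. m (s i) 0) b"
    "\<forall>a<r. m1 a = m a" "t1 \<le> B ^ fcost b" by auto
  define d where "d = (if m1 r 0 \<noteq> 0 then e else e')"
  have "m1 1 = m 1" using 1(3) EIf.prems earrays_below_ge[of e] by simp
  then obtain t2 m2 where
    2: "exec (ecompile r s d) (m1, ot) t2 (m2, ot @ emitted m1 (\<lambda>i. m1 (s i) 0) d)"
    "\<forall>a<r. m2 a = m1 a" "t2 \<le> B ^ ecost d"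
    using EIf.IH(1)[of r s m1 ot] EIf.IH(2)[of r s m1 ot] EIf.prems
    by (cases "m1 r 0 = 0") (auto simp: d_def)
  have "earrays_below d \<le> r" using EIf.prems by (simp add: d_def)
  then have v: "emitted m1 (\<lambda>i. m1 (s i) 0) d = emitted m (\<lambda>i. m (s i) 0) d"
    using 1(3) EIf.prems by (intro emitted_agree) auto
  let ?o = "ot @ emitted m1 (\<lambda>i. m1 (s i) 0) d"
  have "exec (Cond (Get r (Const 0)) (ecompile r s e) (ecompile r s e')) (m1, ot) (t2 + 1) (m2, ?o)"
  proof (cases "m1 r 0 = 0")
    case True
    with 2(1) show ?thesis by (intro exec.Cond_false) (auto simp: d_def)
  next
    case False
    with 2(1) show ?thesis by (intro exec.Cond_true) (auto simp: d_def)
  qed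
  with 1(1) have "exec (ecompile r s (EIf b e e')) (m, ot) (t1 + (t2 + 1)) (m2, ?o)"
    by (simp del: One_nat_def add: exec.Seq)
  moreover have "t1 + (t2 + 1) \<le> B ^ ecost (EIf b e e')"
  proof -
    have "B ^ ecost d \<le> B ^ (ecost e + ecost e')"
      using EIf.prems by (intro power_increasing) (auto simp: d_def)
    with 2(3) have "t2 \<le> B ^ (ecost e + ecost e')" by simp
    from add_le_power[OF add_le_power[OF 1(4) this], of 1 0] EIf.prems show ?thesis by (simp add: add.assoc)
  qed
  moreover have "emitted m (\<lambda>i. m (s i) 0) d = emitted m (\<lambda>i. m (s i) 0) (EIf b e e')"
    using 1(2) by (simp add: d_def)
  ultimately show ?case using 1 2 v by (intro exI[of _ "t1 + (t2 + 1)"] exI[of _ m2]) auto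
next
  case (EFor e)
  define n where "n = m 1 0"
  let ?\<rho> = "\<lambda>i. m (s i) 0"
  let ?c = "ecompile (r + 1) (case_nat r s) e"
  let ?m0 = "m(r := (m r)(0 := 0))"
  have r: "2 \<le> r" using EFor.prems earrays_below_ge[of e] by simp
  define I where "I j m' ot' \<longleftrightarrow> ot' = ot @ concat (map (\<lambda>v. emitted m (case_nat v ?\<rho>) e) [0..<j]) \<and>
    (\<forall>a<r. m' a = m a)" for j m' ot'
  have "\<exists>t m' ot'. exec (loop r ?c) (?m0, ot) t (m', ot') \<and> t \<le> n * (B ^ ecost e + 2) + 1 \<and> I n m' ot'"
  proof (rule exec_loop)
    fix j m' ot' assume *: "j < n" "I j m' ot'" "m' 1 0 = n" "m' r 0 = j"
    have env: "(\<lambda>i. m' (case_nat r s i) 0) = case_nat j ?\<rho>"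
      using * EFor.prems by (auto simp: fun_eq_iff I_def split: nat.split)
    have lt: "case_nat r s i < r + 1" for i
      using EFor.prems(2) by (auto split: nat.split intro: less_SucI)
    have "emitted m' (case_nat j ?\<rho>) e = emitted m (case_nat j ?\<rho>) e"
      using * EFor.prems by (intro emitted_cong) (auto simp: I_def)
    with EFor.IH[of "r + 1" "case_nat r s" m' ot'] EFor.prems * lt obtain t2 m2 where
      2: "exec ?c (m', ot') t2 (m2, ot' @ emitted m (case_nat j ?\<rho>) e)"
        "\<forall>a<r + 1. m2 a = m' a" "t2 \<le> B ^ ecost e"
      unfolding env by (auto simp: n_def)
    moreover have "I (Suc j) (m2(r := (m2 r)(0 := Suc j))) (ot' @ emitted m (case_nat j ?\<rho>) e)"
      using 2 * by (auto simp: I_def)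
    ultimately show "\<exists>t m'' ot''. exec ?c (m', ot') t (m'', ot'') \<and> t \<le> B ^ ecost e \<and> m'' 1 0 = n \<and>
        m'' r 0 = j \<and> I (Suc j) (m''(r := (m'' r)(0 := Suc j))) ot''"
      using * r by (intro exI[of _ t2] exI[of _ m2] exI[of _ "ot' @ emitted m (case_nat j ?\<rho>) e"]) auto
  qed (use r in \<open>auto simp: I_def n_def\<close>)
  then obtain t3 m3 o3 where 3: "exec (loop r ?c) (?m0, ot) t3 (m3, o3)"
    "t3 \<le> n * (B ^ ecost e + 2) + 1" "I n m3 o3" by auto
  have p1: "exec (Put r (Const 0) (Const 0)) (m, ot) 1 (?m0, ot)"
    by (intro exec_Put') simp
  have "exec (ecompile r s (EFor e)) (m, ot) (1 + t3) (m3, o3)"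
    unfolding ecompile.simps by (intro exec.Seq) (fact p1 3)+
  moreover have "1 + t3 \<le> B ^ ecost (EFor e)"
  proof -
    have B: "2 \<le> B" using EFor.prems by simp
    from loop_time_le_power[OF EFor.prems(3) order_refl, of "ecost e"] 3(2) have "t3 \<le> B ^ (ecost e + 4)"
      by (simp add: n_def)
    from add_le_power[OF this, of 1 0] B show ?thesis by (simp add: add.commute)
  qed
  ultimately show ?case using 3(3)
    by (intro exI[of _ "1 + t3"] exI[of _ m3]) (auto simp: I_def n_def)
qed

subsection \<open>Definable functions\<close>

text \<open>The environment \<open>\<lambda>_. m 1 0\<close> is what compiled code sees outside all
  binders, where every variable is mapped to array \<open>1\<close>.\<close>

definition set_cell :: "nat \<Rightarrow> (memory \<Rightarrow> (nat \<Rightarrow> nat) \<Rightarrow> nat) \<Rightarrow> memory \<Rightarrow> memory" where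
  "set_cell a f m = m(a := (m a)(0 := f m (\<lambda>_. m 1 0)))"

definition fill_cell :: "nat \<Rightarrow> (memory \<Rightarrow> (nat \<Rightarrow> nat) \<Rightarrow> nat) \<Rightarrow> nat \<Rightarrow> memory \<Rightarrow> memory" where
  "fill_cell a f i m = m(a := (m a)(i := f m (case_nat i (\<lambda>_. m 1 0))))"

text \<open>Entries are filled in increasing order and in place, so entry \<open>i\<close> may refer
  to earlier entries of the same array. This gives recursion, as for gate offsets and
  powers.\<close>

definition fill_array :: "nat \<Rightarrow> (memory \<Rightarrow> (nat \<Rightarrow> nat) \<Rightarrow> nat) \<Rightarrow> memory \<Rightarrow> memory" where
  "fill_array a f m = fold (fill_cell a f) [0..<m 1 0] m"

definition definable :: "(memory \<Rightarrow> (nat \<Rightarrow> nat) \<Rightarrow> nat) \<Rightarrow> bool" where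
  "definable f \<longleftrightarrow> (\<exists>e. \<forall>m \<rho>. fval m \<rho> e = f m \<rho>)"

definition emittable :: "(memory \<Rightarrow> (nat \<Rightarrow> nat) \<Rightarrow> nat list) \<Rightarrow> bool" where
  "emittable f \<longleftrightarrow> (\<exists>e. \<forall>m \<rho>. emitted m \<rho> e = f m \<rho>)"

text \<open>Filling array \<open>1\<close> is excluded because the loop bound has to stay fixed
  while the loop runs; a single assignment may change it.\<close>

inductive is_step :: "(memory \<Rightarrow> memory) \<Rightarrow> bool" where
  set_cell: "definable f \<Longrightarrow> is_step (set_cell a f)"
| fill_array: "definable f \<Longrightarrow> a \<noteq> 1 \<Longrightarrow> is_step (fill_array a f)"

definition agree_below :: "nat \<Rightarrow> memory \<Rightarrow> memory \<Rightarrow> bool" where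
  "agree_below r m m' \<longleftrightarrow> (\<forall>a<r. m a = m' a)"

text \<open>A program is provided for every sufficiently large \<open>r\<close>, so that successive
  steps can use one scratch area above all arrays that any of them mentions. Only arrays below
  \<open>r\<close> are compared with the intended memory.\<close>

lemma is_step_exec:
  assumes "is_step F"
  shows "\<exists>r0 c. \<forall>r\<ge>r0. \<exists>p. \<forall>m \<alpha> ot B. agree_below r m \<alpha> \<and> \<alpha> 1 0 + 2 \<le> B \<longrightarrow>
    (\<exists>t m'. exec p (m, ot) t (m', ot) \<and> agree_below r m' (F \<alpha>) \<and> t \<le> B ^ c)"
  using assms
proof cases
  case (set_cell f a)
  then obtain e where e: "\<And>m \<rho>. fval m \<rho> e = f m \<rho>" by (auto simp: definable_def)
  show ?thesis
  proof (rule exI[of _ "max (Suc a) (arrays_below e)"], rule exI[of _ "fcost e + 1"], intro allI impI)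
    fix r assume r: "max (Suc a) (arrays_below e) \<le> r"
    then have r2: "2 \<le> r" using arrays_below_ge[of e] by simp
    let ?p = "Seq (fcompile r (\<lambda>_. 1) e) (Put a (Const 0) (Get r (Const 0)))"
    show "\<exists>p. \<forall>m \<alpha> ot B. agree_below r m \<alpha> \<and> \<alpha> 1 0 + 2 \<le> B \<longrightarrow>
      (\<exists>t m'. exec p (m, ot) t (m', ot) \<and> agree_below r m' (F \<alpha>) \<and> t \<le> B ^ (fcost e + 1))"
    proof (intro exI[of _ ?p] allI impI)
      fix m \<alpha> :: memory and ot :: "nat list" and B assume *: "agree_below r m \<alpha> \<and> \<alpha> 1 0 + 2 \<le> B"
      then have m1: "m 1 = \<alpha> 1" using r2 by (simp add: agree_below_def)
      with exec_fcompile[of e r "\<lambda>_. 1" m B ot] r r2 * obtain t1 m1 where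
        1: "exec (fcompile r (\<lambda>_. 1) e) (m, ot) t1 (m1, ot)" "m1 r 0 = fval m (\<lambda>_. m 1 0) e"
          "\<forall>a<r. m1 a = m a" "t1 \<le> B ^ fcost e" by auto
      have v: "fval m (\<lambda>_. m 1 0) e = f \<alpha> (\<lambda>_. \<alpha> 1 0)"
        using fval_agree[of e r "\<lambda>_. 1" m \<alpha>] r r2 * by (auto simp: e agree_below_def)
      let ?m = "m1(a := (m1 a)(0 := m1 r 0))"
      have "exec (Put a (Const 0) (Get r (Const 0))) (m1, ot) 1 (?m, ot)"
        by (intro exec_Put') simp
      with 1(1) have ex: "exec ?p (m, ot) (t1 + 1) (?m, ot)" by (rule exec.Seq)
      have ag: "agree_below r ?m (F \<alpha>)"
        using 1 * v r by (auto simp: agree_below_def set_cell set_cell_def)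
      have "t1 + 1 \<le> B ^ (fcost e + 1)"
        using add_le_power[OF 1(4), of 1 0] * by simp
      with ex ag show "\<exists>t m'. exec ?p (m, ot) t (m', ot) \<and> agree_below r m' (F \<alpha>) \<and> t \<le> B ^ (fcost e + 1)"
        by blast
    qed
  qed
next
  case (fill_array f a)
  then obtain e where e: "\<And>m \<rho>. fval m \<rho> e = f m \<rho>" by (auto simp: definable_def)
  show ?thesis
  proof (rule exI[of _ "max (Suc a) (arrays_below e)"], rule exI[of _ "fcost e + 6"], intro allI impI)
    fix r assume r: "max (Suc a) (arrays_below e) \<le> r"
    then have r2: "2 \<le> r" using arrays_below_ge[of e] by simp
    let ?s = "case_nat r (\<lambda>_. 1)"
    let ?c = "Seq (fcompile (r + 1) ?s e) (Put a (Get r (Const 0)) (Get (r + 1) (Const 0)))"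
    let ?p = "Seq (Put r (Const 0) (Const 0)) (loop r ?c)"
    show "\<exists>p. \<forall>m \<alpha> ot B. agree_below r m \<alpha> \<and> \<alpha> 1 0 + 2 \<le> B \<longrightarrow>
      (\<exists>t m'. exec p (m, ot) t (m', ot) \<and> agree_below r m' (F \<alpha>) \<and> t \<le> B ^ (fcost e + 6))"
    proof (intro exI[of _ ?p] allI impI)
      fix m \<alpha> :: memory and ot :: "nat list" and B assume *: "agree_below r m \<alpha> \<and> \<alpha> 1 0 + 2 \<le> B"
      define n where "n = \<alpha> 1 0"
      define \<beta> where "\<beta> j = fold (fill_cell a f) [0..<j] \<alpha>" for j
      have \<beta>1: "\<beta> j 1 = \<alpha> 1" for j
        using fill_array(3) by (induction j) (auto simp: \<beta>_def fill_cell_def)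
      let ?m0 = "m(r := (m r)(0 := 0))"
      define I where "I j m' ot' \<longleftrightarrow> ot' = ot \<and> agree_below r m' (\<beta> j)" for j m' ot'
      have "\<exists>t m' ot'. exec (loop r ?c) (?m0, ot) t (m', ot') \<and> t \<le> n * ((B ^ fcost e + 1) + 2) + 1 \<and> I n m' ot'"
      proof (rule exec_loop)
        fix j m' ot' assume **: "j < n" "I j m' ot'" "m' 1 0 = n" "m' r 0 = j"
        have lt: "?s i < r + 1" for i
          using r2 by (auto split: nat.split)
        have env: "(\<lambda>i. m' (?s i) 0) = case_nat j (\<lambda>_. \<beta> j 1 0)"
          using ** by (auto simp: fun_eq_iff \<beta>1[simplified] n_def split: nat.split)
        have "fval m' (case_nat j (\<lambda>_. \<beta> j 1 0)) e = fval (\<beta> j) (case_nat j (\<lambda>_. \<beta> j 1 0)) e"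
          using ** r by (intro fval_cong) (auto simp: I_def agree_below_def)
        then have v: "fval m' (\<lambda>i. m' (?s i) 0) e = f (\<beta> j) (case_nat j (\<lambda>_. \<beta> j 1 0))"
          unfolding env e .
        from exec_fcompile[of e "r + 1" ?s m' B ot] r ** * lt obtain t2 m2 where
          2: "exec (fcompile (r + 1) ?s e) (m', ot) t2 (m2, ot)"
            "m2 (r + 1) 0 = f (\<beta> j) (case_nat j (\<lambda>_. \<beta> j 1 0))" "\<forall>a<r + 1. m2 a = m' a" "t2 \<le> B ^ fcost e"
          unfolding v by (auto simp: n_def)
        let ?m = "m2(a := (m2 a)(j := m2 (r + 1) 0))"
        have "exec (Put a (Get r (Const 0)) (Get (r + 1) (Const 0))) (m2, ot) 1 (?m, ot)"
          using 2 ** by (intro exec_Put') simp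
        with 2(1) have ex: "exec ?c (m', ot) (t2 + 1) (?m, ot)" by (rule exec.Seq)
        have "I (Suc j) (?m(r := (?m r)(0 := Suc j))) ot"
          using 2 ** r by (auto simp: I_def agree_below_def \<beta>_def fill_cell_def)
        with ex show "\<exists>t m'' ot''. exec ?c (m', ot') t (m'', ot'') \<and> t \<le> B ^ fcost e + 1 \<and> m'' 1 0 = n \<and>
            m'' r 0 = j \<and> I (Suc j) (m''(r := (m'' r)(0 := Suc j))) ot''"
          using 2 ** r r2 fill_array(3)
          by (intro exI[of _ "t2 + 1"] exI[of _ ?m] exI[of _ ot] conjI; (assumption | auto simp: I_def))
      qed (use r2 * in \<open>auto simp: I_def n_def \<beta>_def agree_below_def\<close>)
      then obtain t3 m3 where 3: "exec (loop r ?c) (?m0, ot) t3 (m3, ot)"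
        "t3 \<le> n * ((B ^ fcost e + 1) + 2) + 1" "I n m3 ot" by (auto simp: I_def)
      have p1: "exec (Put r (Const 0) (Const 0)) (m, ot) 1 (?m0, ot)"
        by (intro exec_Put') simp
      have ex: "exec ?p (m, ot) (1 + t3) (m3, ot)"
        by (intro exec.Seq) (fact p1 3)+
      have B: "2 \<le> B" using * by simp
      have "B ^ fcost e + 1 \<le> B ^ (fcost e + 1)"
        using add_le_power[of "B ^ fcost e" B "fcost e" 1 0] B by simp
      from loop_time_le_power[OF _ this, of n] 3(2) * have "t3 \<le> B ^ (fcost e + 5)"
        by (simp add: n_def algebra_simps)
      from add_le_power[OF this, of 1 0] B have tm: "1 + t3 \<le> B ^ (fcost e + 6)" by (simp add: add.commute)
      have "agree_below r m3 (F \<alpha>)"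
        using 3(3) by (simp add: I_def \<beta>_def n_def fill_array fill_array_def)
      with ex tm show "\<exists>t m'. exec ?p (m, ot) t (m', ot) \<and> agree_below r m' (F \<alpha>) \<and> t \<le> B ^ (fcost e + 6)"
        by blast
    qed
  qed
qed

text \<open>Steps may change the loop bound, so the running time is governed by its largest value
  along the run.\<close>

primrec loops_bounded :: "nat \<Rightarrow> (memory \<Rightarrow> memory) list \<Rightarrow> memory \<Rightarrow> bool" where
  "loops_bounded B [] m \<longleftrightarrow> m 1 0 \<le> B"
| "loops_bounded B (F # Fs) m \<longleftrightarrow> m 1 0 \<le> B \<and> loops_bounded B Fs (F m)"

lemma steps_exec:
  assumes "\<forall>F \<in> set Fs. is_step F"
  shows "\<exists>r0 c. \<forall>r\<ge>r0. \<exists>p. \<forall>m \<alpha> ot B. agree_below r m \<alpha> \<and> loops_bounded B Fs \<alpha> \<longrightarrow>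
    (\<exists>t m'. exec p (m, ot) t (m', ot) \<and> agree_below r m' (fold id Fs \<alpha>) \<and> t \<le> (B + 2) ^ c)"
  using assms
proof (induction Fs)
  case Nil
  show ?case
    by (rule exI[of _ 0], rule exI[of _ 0], intro allI impI, rule exI[of _ Skip]) (auto intro!: exI exec.Skip)
next
  case (Cons F Fs)
  from is_step_exec[of F] Cons.prems obtain r1 c1 where 1: "\<And>r. r \<ge> r1 \<Longrightarrow> \<exists>p. \<forall>m \<alpha> ot B.
    agree_below r m \<alpha> \<and> \<alpha> 1 0 + 2 \<le> B \<longrightarrow>
    (\<exists>t m'. exec p (m, ot) t (m', ot) \<and> agree_below r m' (F \<alpha>) \<and> t \<le> B ^ c1)" by auto
  from Cons.IH Cons.prems obtain r2 c2 where 2: "\<And>r. r \<ge> r2 \<Longrightarrow> \<exists>p. \<forall>m \<alpha> ot B.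
    agree_below r m \<alpha> \<and> loops_bounded B Fs \<alpha> \<longrightarrow>
    (\<exists>t m'. exec p (m, ot) t (m', ot) \<and> agree_below r m' (fold id Fs \<alpha>) \<and> t \<le> (B + 2) ^ c2)"
    unfolding list.set(2) by blast
  show ?case
  proof (rule exI[of _ "max r1 r2"], rule exI[of _ "c1 + c2 + 1"], intro allI impI)
    fix r assume "max r1 r2 \<le> r"
    with 1[of r] 2[of r] obtain p1 p2 where
      p1: "\<And>m \<alpha> ot B. agree_below r m \<alpha> \<and> \<alpha> 1 0 + 2 \<le> B \<Longrightarrow>
        (\<exists>t m'. exec p1 (m, ot) t (m', ot) \<and> agree_below r m' (F \<alpha>) \<and> t \<le> B ^ c1)" and
      p2: "\<And>m \<alpha> ot B. agree_below r m \<alpha> \<and> loops_bounded B Fs \<alpha> \<Longrightarrow>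
        (\<exists>t m'. exec p2 (m, ot) t (m', ot) \<and> agree_below r m' (fold id Fs \<alpha>) \<and> t \<le> (B + 2) ^ c2)"
      by auto
    show "\<exists>p. \<forall>m \<alpha> ot B. agree_below r m \<alpha> \<and> loops_bounded B (F # Fs) \<alpha> \<longrightarrow>
      (\<exists>t m'. exec p (m, ot) t (m', ot) \<and> agree_below r m' (fold id (F # Fs) \<alpha>) \<and> t \<le> (B + 2) ^ (c1 + c2 + 1))"
    proof (intro exI[of _ "Seq p1 p2"] allI impI)
      fix m \<alpha> :: memory and ot :: "nat list" and B assume *: "agree_below r m \<alpha> \<and> loops_bounded B (F # Fs) \<alpha>"
      with p1[of m \<alpha> "B + 2" ot] obtain t1 m1 where
        3: "exec p1 (m, ot) t1 (m1, ot)" "agree_below r m1 (F \<alpha>)" "t1 \<le> (B + 2) ^ c1" by auto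
      with p2[of m1 "F \<alpha>" B ot] * obtain t2 m2 where
        4: "exec p2 (m1, ot) t2 (m2, ot)" "agree_below r m2 (fold id Fs (F \<alpha>))" "t2 \<le> (B + 2) ^ c2" by auto
      from exec.Seq[OF 3(1) 4(1)] add_le_power[OF 3(3) 4(3)] 4(2)
      show "\<exists>t m'. exec (Seq p1 p2) (m, ot) t (m', ot) \<and> agree_below r m' (fold id (F # Fs) \<alpha>) \<and>
          t \<le> (B + 2) ^ (c1 + c2 + 1)" by auto
    qed
  qed
qed

text \<open>The interface to the machine: the reduction is programmed by giving functions on
  memories and proving them definable, and its time follows from bounds on cell \<open>0\<close> of
  array \<open>1\<close> alone.\<close>

theorem steps_computes_in:
  assumes "\<forall>F \<in> set Fs. is_step F" and "emittable g"
  shows "\<exists>p c. \<forall>xs B m. m = fold id Fs (init xs) \<and> loops_bounded B Fs (init xs) \<and> m 1 0 \<le> B \<longrightarrow>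
    (\<exists>t. computes_in p xs (g m (\<lambda>_. m 1 0)) t \<and> t \<le> (B + 2) ^ c)"
proof -
  obtain e where e: "\<And>m \<rho>. emitted m \<rho> e = g m \<rho>" using assms(2) by (auto simp: emittable_def)
  obtain r0 c where steps: "\<And>r. r \<ge> r0 \<Longrightarrow> \<exists>p. \<forall>m \<alpha> ot B. agree_below r m \<alpha> \<and> loops_bounded B Fs \<alpha> \<longrightarrow>
    (\<exists>t m'. exec p (m, ot) t (m', ot) \<and> agree_below r m' (fold id Fs \<alpha>) \<and> t \<le> (B + 2) ^ c)"
    using steps_exec[OF assms(1)] by auto
  define r where "r = max r0 (earrays_below e)"
  have r2: "2 \<le> r" using earrays_below_ge[of e] by (simp add: r_def)
  obtain p where p: "\<And>m \<alpha> ot B. agree_below r m \<alpha> \<and> loops_bounded B Fs \<alpha> \<Longrightarrow>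
    (\<exists>t m'. exec p (m, ot) t (m', ot) \<and> agree_below r m' (fold id Fs \<alpha>) \<and> t \<le> (B + 2) ^ c)"
    using steps[of r] by (auto simp: r_def)
  show ?thesis
  proof (rule exI[of _ "Seq p (ecompile r (\<lambda>_. 1) e)"], rule exI[of _ "c + ecost e + 1"], intro allI impI)
    fix xs B m assume *: "m = fold id Fs (init xs) \<and> loops_bounded B Fs (init xs) \<and> m 1 0 \<le> B"
    with p[of "init xs" "init xs" B "[]"] obtain t1 m1 where
      1: "exec p (init xs, []) t1 (m1, [])" "agree_below r m1 m" "t1 \<le> (B + 2) ^ c"
      by (auto simp: agree_below_def)
    from 1(2) * r2 have m1: "m1 1 0 + 2 \<le> B + 2" by (auto simp: agree_below_def)
    from exec_ecompile[of e r "\<lambda>_. 1" m1 "B + 2" "[]"] m1 r2 obtain t2 m2 where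
      2: "exec (ecompile r (\<lambda>_. 1) e) (m1, []) t2 (m2, emitted m1 (\<lambda>_. m1 1 0) e)" "t2 \<le> (B + 2) ^ ecost e"
      by (auto simp: r_def)
    have "emitted m1 (\<lambda>_. m1 1 0) e = emitted m (\<lambda>_. m 1 0) e"
      using emitted_agree[of e r "\<lambda>_. 1" m1 m] r2 1(2) by (auto simp: r_def agree_below_def)
    with exec.Seq[OF 1(1) 2(1)] add_le_power[OF 1(3) 2(2)]
    show "\<exists>t. computes_in (Seq p (ecompile r (\<lambda>_. 1) e)) xs (g m (\<lambda>_. m 1 0)) t \<and> t \<le> (B + 2) ^ (c + ecost e + 1)"
      by (auto simp: computes_in_def e)
  qed
qed

section \<open>Closure properties of definable functions\<close>

primrec frename :: "(nat \<Rightarrow> nat) \<Rightarrow> fexp \<Rightarrow> fexp" where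
  "frename h (FConst n) = FConst n"
| "frename h (FVar i) = FVar (h i)"
| "frename h (FGet a e) = FGet a (frename h e)"
| "frename h (FAdd e e') = FAdd (frename h e) (frename h e')"
| "frename h (FSub e e') = FSub (frename h e) (frename h e')"
| "frename h (FIf b e e') = FIf (frename h b) (frename h e) (frename h e')"
| "frename h (FSum e) = FSum (frename (case_nat 0 (\<lambda>i. Suc (h i))) e)"

lemma fval_frename: "fval m \<rho> (frename h e) = fval m (\<lambda>i. \<rho> (h i)) e"
proof (induction e arbitrary: \<rho> h)
  case (FSum e)
  have "(\<lambda>i. case_nat v \<rho> (case_nat 0 (\<lambda>i. Suc (h i)) i)) = case_nat v (\<lambda>i. \<rho> (h i))" for v
    by (auto simp: fun_eq_iff split: nat.split)
  then show ?case by (simp add: FSum)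
qed auto

text \<open>Under a binder the old environment is \<open>tail \<rho>\<close> and the bound variable
  is \<open>\<rho> 0\<close>. Stated in this way, the binder rules have higher-order patterns as
  conclusions and can be applied by plain resolution.\<close>

definition tail :: "(nat \<Rightarrow> nat) \<Rightarrow> nat \<Rightarrow> nat" where
  "tail \<rho> = (\<lambda>i. \<rho> (Suc i))"

lemma tail_case_nat [simp]: "tail (case_nat v \<rho>) = \<rho>"
  by (simp add: tail_def)

definition definable_bool :: "(memory \<Rightarrow> (nat \<Rightarrow> nat) \<Rightarrow> bool) \<Rightarrow> bool" where
  "definable_bool P \<longleftrightarrow> definable (\<lambda>m \<rho>. if P m \<rho> then 1 else 0)"

lemma definable_tail: "definable X \<Longrightarrow> definable (\<lambda>m \<rho>. X m (tail \<rho>))"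
  unfolding definable_def tail_def by (elim exE, rule_tac x = "frename Suc e" in exI) (simp add: fval_frename)

lemma definable_const: "definable (\<lambda>m \<rho>. c)"
  unfolding definable_def by (intro exI[of _ "FConst c"]) simp

lemma definable_var: "definable (\<lambda>m \<rho>. \<rho> i)"
  unfolding definable_def by (intro exI[of _ "FVar i"]) simp

lemma definable_get: "definable X \<Longrightarrow> definable (\<lambda>m \<rho>. m a (X m \<rho>))"
  unfolding definable_def by (elim exE, rule_tac x = "FGet a e" in exI) simp

lemma definable_add: "definable X \<Longrightarrow> definable Y \<Longrightarrow> definable (\<lambda>m \<rho>. X m \<rho> + Y m \<rho>)"
  unfolding definable_def by (elim exE, rule_tac x = "FAdd e ea" in exI) simp

lemma definable_sub: "definable X \<Longrightarrow> definable Y \<Longrightarrow> definable (\<lambda>m \<rho>. X m \<rho> - Y m \<rho>)"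
  unfolding definable_def by (elim exE, rule_tac x = "FSub e ea" in exI) simp

lemma definable_Suc: "definable X \<Longrightarrow> definable (\<lambda>m \<rho>. Suc (X m \<rho>))"
  using definable_add[OF _ definable_const[of 1]] by simp

lemma definable_if_nonzero:
  "definable P \<Longrightarrow> definable X \<Longrightarrow> definable Y \<Longrightarrow> definable (\<lambda>m \<rho>. if P m \<rho> \<noteq> 0 then X m \<rho> else Y m \<rho>)"
  unfolding definable_def
proof (elim exE)
  fix b e e' assume "\<forall>m \<rho>. fval m \<rho> b = P m \<rho>" "\<forall>m \<rho>. fval m \<rho> e = X m \<rho>" "\<forall>m \<rho>. fval m \<rho> e' = Y m \<rho>"
  then show "\<exists>e. \<forall>m \<rho>. fval m \<rho> e = (if P m \<rho> \<noteq> 0 then X m \<rho> else Y m \<rho>)"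
    by (intro exI[of _ "FIf b e e'"]) simp
qed

lemma definable_if:
  assumes "definable_bool P" "definable X" "definable Y"
  shows "definable (\<lambda>m \<rho>. if P m \<rho> then X m \<rho> else Y m \<rho>)"
proof -
  have "(\<lambda>m \<rho>. if P m \<rho> then X m \<rho> else Y m \<rho>) =
      (\<lambda>m \<rho>. if (if P m \<rho> then 1 else 0) \<noteq> (0::nat) then X m \<rho> else Y m \<rho>)"
    by (simp add: fun_eq_iff)
  then show ?thesis
    using definable_if_nonzero[OF assms[unfolded definable_bool_def]] by simp
qed

lemma definable_sum:
  assumes "definable (\<lambda>m \<rho>. F m (tail \<rho>) (\<rho> 0))"
  shows "definable (\<lambda>m \<rho>. \<Sum>v<m 1 0. F m \<rho> v)"
proof -
  obtain e where "\<And>m \<rho>. fval m \<rho> e = F m (tail \<rho>) (\<rho> 0)"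
    using assms by (auto simp: definable_def)
  then show ?thesis unfolding definable_def by (intro exI[of _ "FSum e"]) simp
qed

lemma definable_eqI: "definable f \<Longrightarrow> (\<And>m \<rho>. f m \<rho> = g m \<rho>) \<Longrightarrow> definable g"
  by (simp add: definable_def)

lemma definable_bool_less: "definable X \<Longrightarrow> definable Y \<Longrightarrow> definable_bool (\<lambda>m \<rho>. X m \<rho> < Y m \<rho>)"
  unfolding definable_bool_def
  by (rule definable_eqI[OF definable_if_nonzero[OF definable_sub[of Y X] definable_const[of 1] definable_const[of 0]]]) auto

lemma definable_bool_not: "definable_bool P \<Longrightarrow> definable_bool (\<lambda>m \<rho>. \<not> P m \<rho>)"
  unfolding definable_bool_def[of "\<lambda>m \<rho>. \<not> P m \<rho>"]
  by (rule definable_eqI[OF definable_if[OF _ definable_const[of 0] definable_const[of 1]]]) auto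

lemma definable_bool_conj: "definable_bool P \<Longrightarrow> definable_bool Q \<Longrightarrow> definable_bool (\<lambda>m \<rho>. P m \<rho> \<and> Q m \<rho>)"
  unfolding definable_bool_def[of "\<lambda>m \<rho>. P m \<rho> \<and> Q m \<rho>"] definable_bool_def[of Q]
  by (rule definable_eqI[OF definable_if[of P, OF _ _ definable_const[of 0]]]) auto

lemma definable_bool_eqI: "definable_bool P \<Longrightarrow> (\<And>m \<rho>. P m \<rho> = Q m \<rho>) \<Longrightarrow> definable_bool Q"
  by (simp add: definable_bool_def)

lemma definable_bool_disj: "definable_bool P \<Longrightarrow> definable_bool Q \<Longrightarrow> definable_bool (\<lambda>m \<rho>. P m \<rho> \<or> Q m \<rho>)"
  by (rule definable_bool_eqI[OF definable_bool_not[OF definable_bool_conj[OF definable_bool_not definable_bool_not]]]) auto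

lemma definable_bool_imp: "definable_bool P \<Longrightarrow> definable_bool Q \<Longrightarrow> definable_bool (\<lambda>m \<rho>. P m \<rho> \<longrightarrow> Q m \<rho>)"
  by (rule definable_bool_eqI[OF definable_bool_disj[OF definable_bool_not]]) auto

lemma definable_bool_le: "definable X \<Longrightarrow> definable Y \<Longrightarrow> definable_bool (\<lambda>m \<rho>. X m \<rho> \<le> Y m \<rho>)"
  by (rule definable_bool_eqI[OF definable_bool_not[OF definable_bool_less[of Y X]]]) auto

lemma definable_bool_eq: "definable X \<Longrightarrow> definable Y \<Longrightarrow> definable_bool (\<lambda>m \<rho>. X m \<rho> = Y m \<rho>)"
  by (rule definable_bool_eqI[OF definable_bool_conj[OF definable_bool_le[of X Y] definable_bool_le[of Y X]]]) auto

lemma definable_bool_True: "definable_bool (\<lambda>m \<rho>. True)"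
  unfolding definable_bool_def by (simp add: definable_const)

lemma definable_bool_ex:
  assumes "definable_bool (\<lambda>m \<rho>. P m (tail \<rho>) (\<rho> 0))"
  shows "definable_bool (\<lambda>m \<rho>. \<exists>v<m 1 0. P m \<rho> v)"
proof -
  have "definable_bool (\<lambda>m \<rho>. 0 < (\<Sum>v<m 1 0. if P m \<rho> v then 1 else (0::nat)))"
    using assms unfolding definable_bool_def[of "\<lambda>m \<rho>. P m (tail \<rho>) (\<rho> 0)"]
    by (intro definable_bool_less definable_const definable_sum)
  then show ?thesis
    by (rule definable_bool_eqI) (simp only: neq0_conv[symmetric] sum_eq_0_iff finite_lessThan, auto)
qed

lemma definable_bool_all:
  "definable_bool (\<lambda>m \<rho>. P m (tail \<rho>) (\<rho> 0)) \<Longrightarrow> definable_bool (\<lambda>m \<rho>. \<forall>v<m 1 0. P m \<rho> v)"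
  by (rule definable_bool_eqI[OF definable_bool_not[OF definable_bool_ex[OF definable_bool_not]]]) auto

lemma sum_if_less: "(\<Sum>v<n. if v < k then c else 0) = min n k * (c::nat)"
proof -
  have "(\<Sum>v<n. if v < k then c else 0) = (\<Sum>v\<in>{..<n} \<inter> {v. v < k}. c)"
    by (simp add: sum.If_cases)
  also have "{..<n} \<inter> {v. v < k} = {..<min n k}" by auto
  finally show ?thesis by simp
qed

text \<open>Products and quotients are sums; the factor and the quotient are truncated at the loop bound.\<close>

lemma definable_mult: "definable X \<Longrightarrow> definable Y \<Longrightarrow> definable (\<lambda>m \<rho>. min (m 1 0) (X m \<rho>) * Y m \<rho>)"
  unfolding sum_if_less[symmetric]
  by (rule definable_sum definable_if definable_bool_less definable_var definable_const | assumption
      | rule definable_tail)+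

lemma definable_div:
  assumes "definable X" "definable Y"
  shows "definable (\<lambda>m \<rho>. min (m 1 0) (X m \<rho> div Y m \<rho>))"
proof -
  \<comment> \<open>The quotient is the number of \<open>v\<close> with
    \<open>Suc v * y \<le> x\<close>; the test \<open>0 < Y m \<rho>\<close> reproduces the value
    \<open>0\<close> for division by zero.\<close>
  have "definable (\<lambda>m \<rho>. \<Sum>v<m 1 0. if 0 < Y m \<rho> \<and> min (m 1 0) (Suc v) * Y m \<rho> \<le> X m \<rho> then 1 else 0)"
    by (rule definable_sum definable_if definable_bool_conj definable_bool_less definable_bool_le
        definable_mult definable_Suc definable_var definable_const assms | rule definable_tail)+
  moreover have "(\<Sum>v<n. if 0 < y \<and> min n (Suc v) * y \<le> x then 1 else 0) = min n (x div y)" for n x y :: nat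
  proof (cases "y = 0")
    case False
    have "(\<Sum>v<n. if 0 < y \<and> min n (Suc v) * y \<le> x then 1 else 0) = (\<Sum>v<n. if v < x div y then 1 else (0::nat))"
    proof (rule sum.cong)
      fix v assume "v \<in> {..<n}"
      then have "min n (Suc v) = Suc v" by simp
      moreover have "Suc v * y \<le> x \<longleftrightarrow> v < x div y"
        using False by (metis less_eq_div_iff_mult_less_eq Suc_le_eq neq0_conv)
      ultimately show "(if 0 < y \<and> min n (Suc v) * y \<le> x then 1 else 0) = (if v < x div y then 1 else 0)"
        using False by simp
    qed simp
    then show ?thesis by (simp only: sum_if_less mult_1_right)
  qed simp
  ultimately show ?thesis by simp
qed

lemmas definable_intros = definable_const definable_var definable_get definable_add definable_sub
  definable_Suc definable_if definable_sum definable_mult definable_div definable_bool_less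
  definable_bool_le definable_bool_eq definable_bool_not definable_bool_conj definable_bool_disj
  definable_bool_imp definable_bool_True definable_bool_ex definable_bool_all

lemma emittable_Nil: "emittable (\<lambda>m \<rho>. [])"
  unfolding emittable_def by (intro exI[of _ ENil]) simp

lemma emittable_single: "definable X \<Longrightarrow> emittable (\<lambda>m \<rho>. [X m \<rho>])"
  unfolding emittable_def definable_def by (elim exE, rule_tac x = "EVal e" in exI) simp

lemma emittable_append: "emittable X \<Longrightarrow> emittable Y \<Longrightarrow> emittable (\<lambda>m \<rho>. X m \<rho> @ Y m \<rho>)"
  unfolding emittable_def by (elim exE, rule_tac x = "EApp e ea" in exI) simp

lemma emittable_if:
  assumes "definable_bool P" "emittable X" "emittable Y"
  shows "emittable (\<lambda>m \<rho>. if P m \<rho> then X m \<rho> else Y m \<rho>)"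
proof -
  obtain b e e' where "\<And>m \<rho>. fval m \<rho> b = (if P m \<rho> then 1 else 0)" "\<And>m \<rho>. emitted m \<rho> e = X m \<rho>"
    "\<And>m \<rho>. emitted m \<rho> e' = Y m \<rho>"
    using assms unfolding emittable_def definable_bool_def definable_def by auto
  then show ?thesis unfolding emittable_def by (intro exI[of _ "EIf b e e'"]) simp
qed

lemma emittable_for:
  assumes "emittable (\<lambda>m \<rho>. F m (tail \<rho>) (\<rho> 0))"
  shows "emittable (\<lambda>m \<rho>. concat (map (F m \<rho>) [0..<m 1 0]))"
proof -
  obtain e where "\<And>m \<rho>. emitted m \<rho> e = F m (tail \<rho>) (\<rho> 0)"
    using assms by (auto simp: emittable_def)
  then show ?thesis unfolding emittable_def by (intro exI[of _ "EFor e"]) simp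
qed

section \<open>Subset sum with prescribed cardinality\<close>

text \<open>A word determines only the matrix, not \<open>E\<close> and \<open>w\<close> separately:
  weights outside the edge set are arbitrary. The matrix rows have equal lengths, so the flattened
  list splits uniquely.\<close>

lemma encode_weighted_graph_inject:
  assumes "encode_weighted_graph n E w @ [k2, k3] = encode_weighted_graph n' E' w' @ [k2', k3']"
  shows "n' = n \<and> k2' = k2 \<and> k3' = k3 \<and>
    (\<forall>u<n. \<forall>v<n. (if {u, v} \<in> E then w {u, v} else 0) = (if {u, v} \<in> E' then w' {u, v} else 0))"
proof -
  define f where "f E w n = map (\<lambda>u. map (\<lambda>v. if {u, v} \<in> E then w {u, v} else 0) [0..<n]) [0..<n]"
    for E and w :: "nat set \<Rightarrow> nat" and n :: nat
  have enc: "encode_weighted_graph n E w = n # concat (f E w n)" for E w n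
    by (simp add: encode_weighted_graph_def f_def)
  have n: "n' = n" using assms by (simp add: enc)
  have eq: "concat (f E w n) @ [k2, k3] = concat (f E' w' n) @ [k2', k3']"
    using assms by (simp add: enc n)
  have len: "length (concat (f E w n)) = length (concat (f E' w' n))" for E w E' w'
    by (simp add: f_def length_concat comp_def)
  from eq have c: "concat (f E w n) = concat (f E' w' n)" and k: "k2' = k2" "k3' = k3"
    using append_eq_append_conv[of "concat (f E w n)" "concat (f E' w' n)" "[k2, k3]" "[k2', k3']"] by auto
  have "f E w n = f E' w' n"
    by (rule concat_injective[OF c]) (auto simp: f_def set_zip)
  then have "map (\<lambda>v. if {u, v} \<in> E then w {u, v} else 0) [0..<n] = map (\<lambda>v. if {u, v} \<in> E' then w' {u, v} else 0) [0..<n]"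
    if "u < n" for u
    using that unfolding f_def map_eq_conv by auto
  then have "\<forall>u<n. \<forall>v<n. (if {u, v} \<in> E then w {u, v} else 0) = (if {u, v} \<in> E' then w' {u, v} else 0)"
    unfolding map_eq_conv by auto
  with n k show ?thesis by blast
qed

text \<open>Membership quantifies over all presentations of a word. As weights are positive, an
  entry is nonzero exactly at an edge, so two presentations have the same edges and the same weights
  on them.\<close>

lemma M_EPVCB_iff:
  assumes G: "simple_graph {0..<n} E" "bipartite {0..<n} E" "\<forall>e \<in> E. w e > 0"
  shows "(encode_weighted_graph n E w @ [k2, k3], k1) \<in> M_EPVCB \<longleftrightarrow>
    k1 > 0 \<and> k2 > 0 \<and> k3 > 0 \<and> (\<exists>V0. MEPVC_solution {0..<n} E w k1 k2 k3 V0)"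
proof
  assume "(encode_weighted_graph n E w @ [k2, k3], k1) \<in> M_EPVCB"
  then obtain n' E' w' k2' k3' where eq: "encode_weighted_graph n E w @ [k2, k3] = encode_weighted_graph n' E' w' @ [k2', k3']"
    and *: "simple_graph {0..<n'} E'" "\<forall>e \<in> E'. w' e > 0" "k1 > 0" "k2' > 0" "k3' > 0"
      "\<exists>V0. MEPVC_solution {0..<n'} E' w' k1 k2' k3' V0"
    unfolding M_EPVCB_def by blast
  from encode_weighted_graph_inject[OF eq] have n: "n' = n" "k2' = k2" "k3' = k3" and
    ent: "\<And>u v. u < n \<Longrightarrow> v < n \<Longrightarrow> (if {u, v} \<in> E then w {u, v} else 0) = (if {u, v} \<in> E' then w' {u, v} else 0)"
    by blast+
  have two: "\<exists>u v. e = {u, v} \<and> u < n \<and> v < n" if "e \<in> E \<or> e \<in> E'" for e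
  proof -
    have "card e = 2" "e \<subseteq> {0..<n}"
      using that G(1) *(1) by (auto simp: simple_graph_def n)
    then show ?thesis by (metis atLeastLessThan_iff card_2_iff insert_subset)
  qed
  have "e \<in> E \<longleftrightarrow> e \<in> E'" for e
  proof
    assume e: "e \<in> E"
    with two obtain u v where "e = {u, v}" "u < n" "v < n" by blast
    with ent[of u v] G(3) e show "e \<in> E'" by (auto split: if_splits)
  next
    assume e: "e \<in> E'"
    with two obtain u v where "e = {u, v}" "u < n" "v < n" by blast
    with ent[of u v] *(2) e show "e \<in> E" by (auto split: if_splits)
  qed
  then have E: "E' = E" by blast
  have "w' e = w e" if "e \<in> E" for e
  proof -
    from two that obtain u v where "e = {u, v}" "u < n" "v < n" by blast
    with ent[of u v] that show ?thesis by (simp add: E)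
  qed
  then have "MEPVC_solution {0..<n} E w' k1 k2 k3 V0 \<longleftrightarrow> MEPVC_solution {0..<n} E w k1 k2 k3 V0" for V0
  proof -
    assume w: "\<And>e. e \<in> E \<Longrightarrow> w' e = w e"
    have "sum w' M = sum w M" if "M \<subseteq> covered_edges E V0" for M
      using that by (intro sum.cong) (auto simp: covered_edges_def w)
    then show ?thesis by (auto simp: MEPVC_solution_def)
  qed
  with * show "k1 > 0 \<and> k2 > 0 \<and> k3 > 0 \<and> (\<exists>V0. MEPVC_solution {0..<n} E w k1 k2 k3 V0)"
    by (simp add: n E)
next
  assume "k1 > 0 \<and> k2 > 0 \<and> k3 > 0 \<and> (\<exists>V0. MEPVC_solution {0..<n} E w k1 k2 k3 V0)"
  with G show "(encode_weighted_graph n E w @ [k2, k3], k1) \<in> M_EPVCB"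
    unfolding M_EPVCB_def by blast
qed

text \<open>Item \<open>i < n\<close> becomes a star with centre \<open>i\<close> and leaves \<open>n + i\<close>, \<open>2n + i\<close>. The star has total
  weight \<open>D + a i\<close> and heaviest edge \<open>D - a i\<close>, so the two lower bounds of the problem bound the sum
  of the selected numbers from both sides.\<close>

definition star_weight :: "nat \<Rightarrow> nat \<Rightarrow> (nat \<Rightarrow> nat) \<Rightarrow> nat \<Rightarrow> nat \<Rightarrow> nat" where
  "star_weight n D a u v =
    (if u < n \<and> v = n + u then D - a u else if u < n \<and> v = n + n + u then a u + a u
     else if v < n \<and> u = n + v then D - a v else if v < n \<and> u = n + n + v then a v + a v else 0)"

text \<open>\<open>D\<close> exceeds every sum of selected numbers, so the leading term
  \<open>K * D\<close> fixes the number of stars. The factor 3 gives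
  \<open>2 * a i < D - a i\<close>: the inner edge is the heaviest of its star.\<close>

locale star_forest =
  fixes n :: nat and a :: "nat \<Rightarrow> nat" and D :: nat
  assumes a_pos: "\<And>i. i < n \<Longrightarrow> 0 < a i" and D_def: "D = 3 * (\<Sum>i<n. a i) + 1"
begin

abbreviation "inner_edge i \<equiv> {i, n + i}"
abbreviation "outer_edge i \<equiv> {i, n + n + i}"

definition "edges = inner_edge ` {..<n} \<union> outer_edge ` {..<n}"

text \<open>Leaves have larger numbers than all centres, so \<open>Min e\<close> is the centre of
  the star, and the leaves below \<open>n + n\<close> are those of the inner edges.\<close>

definition "weight e = (if Max e < n + n then D - a (Min e) else a (Min e) + a (Min e))"

lemma weight_simps:
  "i < n \<Longrightarrow> weight (inner_edge i) = D - a i" "i < n \<Longrightarrow> weight (outer_edge i) = a i + a i"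
  by (auto simp: weight_def max_def min_def)

lemma a_less: "i < n \<Longrightarrow> 3 * a i < D"
  using member_le_sum[of i "{..<n}" a] by (simp add: D_def)

lemma sum_a_less: "T \<subseteq> {..<n} \<Longrightarrow> sum a T < D"
  using sum_mono2[of "{..<n}" T a] by (simp add: D_def)

lemma edge_cases: "e \<in> edges \<Longrightarrow> (\<And>i. i < n \<Longrightarrow> e = inner_edge i \<Longrightarrow> P) \<Longrightarrow> (\<And>i. i < n \<Longrightarrow> e = outer_edge i \<Longrightarrow> P) \<Longrightarrow> P"
  by (auto simp: edges_def)

lemma weight_pos: "\<forall>e \<in> edges. weight e > 0"
  using a_less a_pos by (fastforce elim: edge_cases simp: weight_simps)

lemma simple: "simple_graph {0..<3 * n} edges"
  by (auto simp: simple_graph_def elim!: edge_cases)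

lemma bip: "bipartite {0..<3 * n} edges"
  unfolding bipartite_def
  by (rule exI[of _ "{0..<n}"], rule exI[of _ "{n..<3 * n}"]) (fastforce elim!: edge_cases)

lemma encode_eq: "encode_weighted_graph (3 * n) edges weight =
  3 * n # concat (map (\<lambda>u. map (star_weight n D a u) [0..<3 * n]) [0..<3 * n])"
proof -
  have in_edges: "{u, v} \<in> edges \<longleftrightarrow> (u < n \<and> (v = n + u \<or> v = n + n + u)) \<or> (v < n \<and> (u = n + v \<or> u = n + n + v))" for u v
    by (auto simp: edges_def doubleton_eq_iff image_iff)
  have "(if {u, v} \<in> edges then weight {u, v} else 0) = star_weight n D a u v" for u v
    unfolding in_edges star_weight_def
    by (auto simp: weight_simps insert_commute[of _ u] simp del: insert_commute)
       (auto simp: weight_simps insert_commute)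
  then show ?thesis by (simp add: encode_weighted_graph_def)
qed

lemma inj_edges: "inj_on inner_edge {..<n}" "inj_on outer_edge {..<n}" "inner_edge ` {..<n} \<inter> outer_edge ` {..<n} = {}"
  by (auto simp: inj_on_def doubleton_eq_iff)

lemma sum_star: assumes "T \<subseteq> {..<n}"
  shows "sum weight (inner_edge ` T \<union> outer_edge ` T) = card T * D + sum a T"
    and "sum weight (inner_edge ` T) = card T * D - sum a T"
    and "(\<Sum>i\<in>T. D - a i) = card T * D - sum a T"
proof -
  have fin: "finite T" using assms finite_subset by blast
  have lt: "i \<in> T \<Longrightarrow> i < n" for i using assms by auto
  have inj: "inj_on inner_edge T" "inj_on outer_edge T"
    using inj_edges assms by (auto intro: inj_on_subset)
  have disj: "inner_edge ` T \<inter> outer_edge ` T = {}"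
    using inj_edges(3) assms by blast
  have 1: "sum weight (inner_edge ` T) = (\<Sum>i\<in>T. D - a i)"
    by (simp add: sum.reindex[OF inj(1)] weight_simps lt cong: sum.cong_simp)
  have 2: "sum weight (outer_edge ` T) = (\<Sum>i\<in>T. a i + a i)"
    by (simp add: sum.reindex[OF inj(2)] weight_simps lt cong: sum.cong_simp)
  have le: "a i \<le> D" if "i \<in> T" for i using a_less[OF lt[OF that]] by simp
  show 3: "(\<Sum>i\<in>T. D - a i) = card T * D - sum a T"
    using le by (simp add: sum_subtractf_nat)
  then show "sum weight (inner_edge ` T) = card T * D - sum a T" using 1 by simp
  have "sum weight (inner_edge ` T \<union> outer_edge ` T) = (\<Sum>i\<in>T. D - a i) + (\<Sum>i\<in>T. a i + a i)"
    using fin disj by (simp add: sum.union_disjoint 1 2)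
  also have "\<dots> = (\<Sum>i\<in>T. D + a i)"
    unfolding sum.distrib[symmetric] by (intro sum.cong) (auto dest: le)
  finally show "sum weight (inner_edge ` T \<union> outer_edge ` T) = card T * D + sum a T"
    by (simp add: sum.distrib)
qed

text \<open>If \<open>T\<close> is the set of stars met by \<open>V0\<close>, the covered weight is
  at most \<open>card T * D + sum a T\<close>. As \<open>sum a T < D\<close> and
  \<open>card T \<le> K\<close>, the covering bound forces \<open>card T = K\<close> and
  \<open>sum a T \<ge> t\<close>. A matching takes at most one edge from each star, of weight at
  most \<open>D - a i\<close>, which forces \<open>sum a T \<le> t\<close>.\<close>

lemma solution_iff:
  assumes "K > 0"
  shows "(K * D + t > 0 \<and> K * D - t > 0 \<and> (\<exists>V0. MEPVC_solution {0..<3 * n} edges weight K (K * D + t) (K * D - t) V0))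
    \<longleftrightarrow> (\<exists>I \<subseteq> {..<n}. card I = K \<and> sum a I = t)"
proof
  assume "K * D + t > 0 \<and> K * D - t > 0 \<and> (\<exists>V0. MEPVC_solution {0..<3 * n} edges weight K (K * D + t) (K * D - t) V0)"
  then obtain V0 M where V0: "V0 \<subseteq> {0..<3 * n}" "card V0 \<le> K"
    "sum weight (covered_edges edges V0) \<ge> K * D + t"
    and M: "M \<subseteq> covered_edges edges V0" "matching M" "sum weight M \<ge> K * D - t" and pos: "K * D - t > 0"
    by (auto simp: MEPVC_solution_def)
  define T where "T = {i. i < n \<and> V0 \<inter> {i, n + i, n + n + i} \<noteq> {}}"
  have T: "T \<subseteq> {..<n}" by (auto simp: T_def)
  then have finT: "finite T" using finite_subset by blast
  have finV: "finite V0" using V0(1) finite_subset by blast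
  \<comment> \<open>The three vertices of a star are congruent modulo \<open>n\<close>, so a vertex
    of \<open>V0\<close> accounts for only one star.\<close>
  have "T \<subseteq> (\<lambda>v. v mod n) ` V0"
  proof
    fix i assume "i \<in> T"
    then have i: "i < n" and "i \<in> V0 \<or> n + i \<in> V0 \<or> n + n + i \<in> V0" by (auto simp: T_def)
    moreover have "i = i mod n" "i = (n + i) mod n" "i = (n + n + i) mod n"
      using i by (simp_all add: add.assoc)
    ultimately show "i \<in> (\<lambda>v. v mod n) ` V0" by blast
  qed
  then have cT: "card T \<le> K"
    using V0(2) finV by (meson card_image_le card_mono finite_imageI le_trans)
  have cov: "covered_edges edges V0 \<subseteq> inner_edge ` T \<union> outer_edge ` T"
    unfolding covered_edges_def by (fastforce simp: T_def edges_def)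
  have "sum weight (covered_edges edges V0) \<le> sum weight (inner_edge ` T \<union> outer_edge ` T)"
    using finT cov by (intro sum_mono2) auto
  then have 1: "K * D + t \<le> card T * D + sum a T"
    using V0(3) sum_star(1)[OF T] by simp
  have "card T = K"
  proof (rule ccontr)
    assume "card T \<noteq> K"
    with cT have "Suc (card T) \<le> K" by simp
    then have "Suc (card T) * D \<le> K * D" by (rule mult_le_mono1)
    with 1 sum_a_less[OF T] show False by simp
  qed
  have lt: "T \<subseteq> {..<n}" "i \<in> T \<Longrightarrow> i < n" for i using T by auto
  have M_cases: "\<exists>i \<in> T. e = inner_edge i \<or> e = outer_edge i" if "e \<in> M" for e
    using that M(1) cov by blast
  have Min: "Min (inner_edge i) = i" "Min (outer_edge i) = i" for i
    by simp_all
  \<comment> \<open>Two edges of one star share the centre, so a matching contains at most one of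
    them.\<close>
  have "inj_on Min M"
  proof (rule inj_onI)
    fix e e' assume *: "e \<in> M" "e' \<in> M" "Min e = Min e'"
    with M_cases obtain i j where "e = inner_edge i \<or> e = outer_edge i" "e' = inner_edge j \<or> e' = outer_edge j" by meson
    with *(3) have "i = j" using Min by metis
    then have "e \<inter> e' \<noteq> {}" using \<open>e = _ \<or> _\<close> \<open>e' = _ \<or> _\<close> by auto
    with M(2) * show "e = e'" by (auto simp: matching_def)
  qed
  have "sum weight M \<le> (\<Sum>e\<in>M. D - a (Min e))"
  proof (rule sum_mono)
    fix e assume "e \<in> M"
    with M_cases obtain i where i: "i \<in> T" "e = inner_edge i \<or> e = outer_edge i" by blast
    then have "weight e \<le> D - a i" using a_less[of i] lt by (auto simp: weight_simps)
    with i Min show "weight e \<le> D - a (Min e)" by metis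
  qed
  also have "\<dots> = (\<Sum>i\<in>Min ` M. D - a i)"
    using \<open>inj_on Min M\<close> by (simp add: sum.reindex)
  also have "\<dots> \<le> (\<Sum>i\<in>T. D - a i)"
    using finT by (intro sum_mono2) (auto dest!: M_cases simp: Min)
  finally have "K * D - t \<le> K * D - sum a T"
    using M(3) sum_star(3)[OF T] \<open>card T = K\<close> by simp
  \<comment> \<open>Neither subtraction truncates: \<open>t < K * D\<close> by \<open>pos\<close>,
    and \<open>sum a T < D \<le> K * D\<close>.\<close>
  moreover have "D \<le> K * D" using \<open>K > 0\<close> by simp
  ultimately have "sum a T \<le> t" using sum_a_less[OF T] pos by linarith
  with 1 \<open>card T = K\<close> T show "\<exists>I \<subseteq> {..<n}. card I = K \<and> sum a I = t" by auto
next
  assume "\<exists>I \<subseteq> {..<n}. card I = K \<and> sum a I = t"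
  then obtain I where I: "I \<subseteq> {..<n}" "card I = K" "sum a I = t" by blast
  have fin: "finite I" using I finite_subset by blast
  have D: "t < D" "D \<le> K * D" using sum_a_less[OF I(1)] I(3) \<open>K > 0\<close> by auto
  have cov: "covered_edges edges I = inner_edge ` I \<union> outer_edge ` I"
    using I(1) by (fastforce simp: covered_edges_def edges_def)
  have "matching (inner_edge ` I)"
    using I(1) by (auto simp: matching_def)
  moreover have "I \<subseteq> {0..<3 * n}" using I(1) by auto
  ultimately have "MEPVC_solution {0..<3 * n} edges weight K (K * D + t) (K * D - t) I"
    unfolding MEPVC_solution_def cov using I sum_star[OF I(1)] by (auto intro!: exI[of _ "inner_edge ` I"])
  moreover have "t < K * D" using D by (rule less_le_trans)
  ultimately show "K * D + t > 0 \<and> K * D - t > 0 \<and> (\<exists>V0. MEPVC_solution {0..<3 * n} edges weight K (K * D + t) (K * D - t) V0)"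
    by auto
qed

end

theorem subset_sum_iff_M_EPVCB:
  assumes "\<And>i. i < n \<Longrightarrow> 0 < a i" and "D = 3 * (\<Sum>i<n. a i) + 1" and "K > 0"
  shows "(3 * n # concat (map (\<lambda>u. map (star_weight n D a u) [0..<3 * n]) [0..<3 * n]) @ [K * D + t, K * D - t], K) \<in> M_EPVCB
    \<longleftrightarrow> (\<exists>I \<subseteq> {..<n}. card I = K \<and> sum a I = t)"
proof -
  interpret star_forest n a D by unfold_locales (use assms in auto)
  show ?thesis
    using M_EPVCB_iff[OF simple bip weight_pos, of "K * D + t" "K * D - t" K] solution_iff[OF assms(3), of t] assms(3)
    unfolding encode_eq by auto
qed

section \<open>Constraint satisfaction as a subset sum\<close>

definition digit :: "nat \<Rightarrow> nat \<Rightarrow> nat \<Rightarrow> nat" where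
  "digit b j e = e div b ^ j mod b"

lemma digit_less: "0 < b \<Longrightarrow> digit b j e < b"
  by (simp add: digit_def)

lemma digit_0: "digit b 0 e = e mod b"
  by (simp add: digit_def)

lemma digit_Suc: "digit b (Suc j) e = digit b j (e div b)"
  by (simp add: digit_def div_mult2_eq)

lemma sum_powers_Suc: "(\<Sum>j<Suc q. f j * b ^ j) = f 0 + b * (\<Sum>j<q. f (Suc j) * b ^ j :: nat)"
  unfolding sum.lessThan_Suc_shift by (simp add: sum_distrib_left mult.left_commute)

lemma digit_sum:
  assumes "\<And>j. j < q \<Longrightarrow> f j < b" and "i < q"
  shows "digit b i (\<Sum>j<q. f j * b ^ j) = f i"
  using assms
proof (induction i arbitrary: f q)
  case 0
  then obtain q' where "q = Suc q'" by (cases q) auto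
  with 0 show ?case by (simp add: sum_powers_Suc digit_0 del: sum.lessThan_Suc)
next
  case (Suc i)
  then obtain q' where q: "q = Suc q'" by (cases q) auto
  have "digit b i (\<Sum>j<q'. f (Suc j) * b ^ j) = f (Suc i)"
    using Suc.prems by (intro Suc.IH[of q' "\<lambda>j. f (Suc j)"]) (auto simp: q)
  then show ?case
    using Suc.prems(1)[of 0] by (simp add: q sum_powers_Suc digit_Suc del: sum.lessThan_Suc)
qed

lemma sum_powers_less:
  "(\<And>j. j < q \<Longrightarrow> f j < b) \<Longrightarrow> (\<Sum>j<q. f j * b ^ j) < (b::nat) ^ q"
proof (induction q)
  case (Suc q)
  then have "(\<Sum>j<q. f j * b ^ j) < b ^ q" by simp
  moreover have "Suc (f q) * b ^ q \<le> b * b ^ q" using Suc.prems[of q] by (intro mult_le_mono1) simp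
  ultimately show ?case by simp
qed simp

lemma sum_digits: "e < b ^ q \<Longrightarrow> (\<Sum>j<q. digit b j e * b ^ j) = e"
proof (induction q arbitrary: e)
  case (Suc q)
  have "e div b < b ^ q" using Suc.prems by (simp add: less_mult_imp_div_less mult.commute)
  from Suc.IH[OF this] show ?case
    by (simp add: sum_powers_Suc digit_0 digit_Suc del: sum.lessThan_Suc)
qed simp

lemma digits_inject: "e < b ^ q \<Longrightarrow> e' < b ^ q \<Longrightarrow> (\<And>j. j < q \<Longrightarrow> digit b j e = digit b j e') \<Longrightarrow> e = e'"
  by (metis (no_types, lifting) lessThan_iff sum.cong sum_digits)

text \<open>Without carries the single equation of a subset sum splits into one equation per entry
  of the vectors.\<close>

lemma sum_powers_eqD:
  assumes "(\<Sum>j<q. f j * b ^ j) = (\<Sum>j<q. g j * b ^ j)" "\<And>j. j < q \<Longrightarrow> f j < b" "\<And>j. j < q \<Longrightarrow> g j < b" "i < q"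
  shows "f i = (g i :: nat)"
  using digit_sum[of q f b i] digit_sum[of q g b i] assms by simp

text \<open>An item \<open>e = p + b ^ q * z\<close> proposes the values \<open>z\<close> for the variables occurring in the scope \<open>p\<close>;
  \<open>p\<close> and \<open>z\<close> are given by their base-\<open>b\<close> digits. The first \<open>b ^ q\<close> entries of its vector count how
  often each scope is selected; entry \<open>(p', j)\<close> compares the value proposed at place \<open>j\<close> of scope \<open>p'\<close>
  with the value proposed for the same variable \<open>c\<close> in the constant scope \<open>(c, \<dots>, c)\<close>.\<close>

definition is_scope :: "nat \<Rightarrow> nat \<Rightarrow> nat \<Rightarrow> nat \<Rightarrow> bool" where
  "is_scope b q V p \<longleftrightarrow> (\<forall>j<q. digit b j p < V)"

definition item_entry :: "nat \<Rightarrow> nat \<Rightarrow> nat \<Rightarrow> nat \<Rightarrow> nat \<Rightarrow> nat" where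
  "item_entry b q V e i =
    (if i < b ^ q then (if i = e mod b ^ q then 1 else 0)
     else (\<Sum>j<q. if i div b ^ q = Suc j \<and> is_scope b q V (i mod b ^ q)
       then (if i mod b ^ q = e mod b ^ q then digit b j (e div b ^ q) else 0) +
         (if \<forall>l<q. digit b l (e mod b ^ q) = digit b j (i mod b ^ q) then b - digit b 0 (e div b ^ q) else 0)
       else 0))"

text \<open>The target \<open>b\<close> encodes equality: \<open>v + (b - w) = b\<close> iff
  \<open>v = w\<close> when \<open>w \<le> b\<close>. The proposal for the scope contributes
  \<open>v\<close>, the one for the constant scope contributes the complement \<open>b - w\<close>,
  so no negative coefficient occurs.\<close>

definition target_entry :: "nat \<Rightarrow> nat \<Rightarrow> nat \<Rightarrow> nat \<Rightarrow> nat" where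
  "target_entry b q V i =
    (if i < b ^ q then (if is_scope b q V i then 1 else 0)
     else (\<Sum>j<q. if i div b ^ q = Suc j \<and> is_scope b q V (i mod b ^ q) then b else 0))"

text \<open>\<open>N\<close> is both the base and the number of digits. The first bound excludes
  carries: at most \<open>b ^ q\<close> items are selected, with entries at most
  \<open>2 * b < b ^ 2\<close>. The second makes room for one counting block and \<open>q\<close>
  comparison blocks of \<open>b ^ q\<close> entries each.\<close>

locale csp_sum =
  fixes N b q V :: nat and allowed :: "nat \<Rightarrow> nat \<Rightarrow> bool"
  assumes b: "3 \<le> b" and q: "0 < q" and V: "V \<le> b" and N: "b ^ (q + 2) \<le> N"
    and Nq: "(q + 1) * b ^ q \<le> N"
begin

definition "scopes = {p. p < b ^ q \<and> is_scope b q V p}"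

definition "const_scope c = (\<Sum>j<q. c * b ^ j)"

definition "target = (\<Sum>i<N. target_entry b q V i * N ^ i)"

text \<open>An inadmissible item gets a number above the target: it can never be selected, and it is
  still positive, as the star construction demands.\<close>

definition "item_number e =
  (if is_scope b q V (e mod b ^ q) \<and> allowed (e mod b ^ q) (e div b ^ q)
   then \<Sum>i<N. item_entry b q V e i * N ^ i else Suc target)"

lemma finite_scopes: "finite scopes"
  by (simp add: scopes_def)

lemma card_scopes: "card scopes \<le> b ^ q"
  using card_mono[of "{..<b ^ q}" scopes] by (auto simp: scopes_def)

lemma const_scope: "c < b \<Longrightarrow> const_scope c < b ^ q" "c < b \<Longrightarrow> j < q \<Longrightarrow> digit b j (const_scope c) = c"
  using sum_powers_less[of q "\<lambda>_. c" b] digit_sum[of q "\<lambda>_. c" b j] by (auto simp: const_scope_def)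

lemma const_scope_in: "c < V \<Longrightarrow> const_scope c \<in> scopes"
  using const_scope[of c] V by (auto simp: scopes_def is_scope_def)

lemma eq_const_scope_iff: "p < b ^ q \<Longrightarrow> c < b \<Longrightarrow> (\<forall>l<q. digit b l p = c) \<longleftrightarrow> p = const_scope c"
  using digits_inject[of p b q "const_scope c"] const_scope[of c] by auto

text \<open>With one item per scope, only two contributions reach a comparison entry: that of the
  scope itself and that of the constant scope of its \<open>j\<close>-th variable. So the sums over
  \<open>scopes\<close> collapse.\<close>

lemma sum_item_entries:
  assumes Z: "\<And>p. p \<in> scopes \<Longrightarrow> Z p < b ^ q" and I: "I = (\<lambda>p. p + b ^ q * Z p) ` scopes"
  shows "(\<Sum>e\<in>I. item_entry b q V e i) =
    (if i < b ^ q then (if is_scope b q V i then 1 else 0)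
     else (\<Sum>j<q. if i div b ^ q = Suc j \<and> is_scope b q V (i mod b ^ q)
       then digit b j (Z (i mod b ^ q)) + (b - digit b 0 (Z (const_scope (digit b j (i mod b ^ q))))) else 0))"
proof -
  let ?B = "b ^ q"
  have B: "0 < ?B" using b by simp
  have mod: "(p + ?B * z) mod ?B = p" and div: "(p + ?B * z) div ?B = z" if "p \<in> scopes" for p z
    using that B by (auto simp: scopes_def)
  have less: "p \<in> scopes \<Longrightarrow> p < b ^ q" for p
    by (simp add: scopes_def)
  have inj: "inj_on (\<lambda>p. p + ?B * Z p) scopes"
    by (rule inj_onI) (metis mod)
  have *: "(\<Sum>e\<in>I. item_entry b q V e i) = (\<Sum>p\<in>scopes. item_entry b q V (p + ?B * Z p) i)"
    unfolding I by (simp add: sum.reindex[OF inj])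
  show ?thesis
  proof (cases "i < ?B")
    case True
    have "(\<Sum>p\<in>scopes. item_entry b q V (p + ?B * Z p) i) = (\<Sum>p\<in>scopes. if i = p then 1 else 0)"
      using True by (intro sum.cong) (auto simp: item_entry_def less)
    then show ?thesis using True finite_scopes unfolding * by (simp add: scopes_def)
  next
    case False
    define p' where "p' = i mod ?B"
    have p': "p' < ?B" using B by (simp add: p'_def)
    have "(\<Sum>p\<in>scopes. item_entry b q V (p + ?B * Z p) i) =
      (\<Sum>p\<in>scopes. \<Sum>j<q. if i div ?B = Suc j \<and> is_scope b q V p'
        then (if p' = p then digit b j (Z p) else 0) +
         (if \<forall>l<q. digit b l p = digit b j p' then b - digit b 0 (Z p) else 0) else 0)"
    proof (rule sum.cong)
      fix p assume p: "p \<in> scopes"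
      show "item_entry b q V (p + ?B * Z p) i = (\<Sum>j<q. if i div ?B = Suc j \<and> is_scope b q V p'
        then (if p' = p then digit b j (Z p) else 0) +
         (if \<forall>l<q. digit b l p = digit b j p' then b - digit b 0 (Z p) else 0) else 0)"
        unfolding item_entry_def mod[OF p] div[OF p] p'_def using False by simp
    qed simp
    also have "\<dots> = (\<Sum>j<q. \<Sum>p\<in>scopes. if i div ?B = Suc j \<and> is_scope b q V p'
        then (if p' = p then digit b j (Z p) else 0) +
         (if \<forall>l<q. digit b l p = digit b j p' then b - digit b 0 (Z p) else 0) else 0)"
      by (rule sum.swap)
    also have "\<dots> = (\<Sum>j<q. if i div ?B = Suc j \<and> is_scope b q V p'
       then digit b j (Z p') + (b - digit b 0 (Z (const_scope (digit b j p')))) else 0)"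
    proof (rule sum.cong)
      fix j assume j: "j \<in> {..<q}"
      show "(\<Sum>p\<in>scopes. if i div ?B = Suc j \<and> is_scope b q V p'
        then (if p' = p then digit b j (Z p) else 0) +
         (if \<forall>l<q. digit b l p = digit b j p' then b - digit b 0 (Z p) else 0) else 0) =
        (if i div ?B = Suc j \<and> is_scope b q V p'
         then digit b j (Z p') + (b - digit b 0 (Z (const_scope (digit b j p')))) else 0)"
      proof (cases "i div ?B = Suc j \<and> is_scope b q V p'")
        case True
        then have in1: "p' \<in> scopes" using p' by (simp add: scopes_def)
        have c: "digit b j p' < V" using True j by (simp add: is_scope_def)
        then have in2: "const_scope (digit b j p') \<in> scopes" by (rule const_scope_in)
        have "(\<Sum>p\<in>scopes. if \<forall>l<q. digit b l p = digit b j p' then b - digit b 0 (Z p) else 0) =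
          (\<Sum>p\<in>scopes. if const_scope (digit b j p') = p then b - digit b 0 (Z p) else 0)"
          using c V by (intro sum.cong refl if_cong) (auto simp: scopes_def eq_const_scope_iff)
        then show ?thesis using True in1 in2 finite_scopes by (simp add: sum.distrib)
      next
        case False
        then show ?thesis by auto
      qed
    qed simp
    finally show ?thesis using False unfolding * p'_def by simp
  qed
qed

text \<open>At most one \<open>j\<close> belongs to the block \<open>i div b ^ q\<close>, so the sum
  has at most one nonzero term.\<close>

lemma item_entry_le: "item_entry b q V e i \<le> 2 * b"
proof (cases "i < b ^ q")
  case False
  have "item_entry b q V e i \<le> (\<Sum>j<q. if i div b ^ q = Suc j then 2 * b else 0)"
  proof -
    have d: "digit b j x \<le> b" for j x
      using digit_less[of b j x] b by simp
    have "(if i mod b ^ q = e mod b ^ q then digit b j (e div b ^ q) else 0) +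
        (if \<forall>l<q. digit b l (e mod b ^ q) = digit b j (i mod b ^ q) then b - digit b 0 (e div b ^ q) else 0) \<le> b + b" for j
      by (intro add_mono) (simp_all add: d)
    then show ?thesis
      unfolding item_entry_def if_not_P[OF False] by (intro sum_mono) (simp add: mult_2)
  qed
  also have "\<dots> = (\<Sum>j<q. if i div b ^ q - 1 = j then if i div b ^ q = 0 then 0 else 2 * b else 0)"
    by (intro sum.cong) auto
  also have "\<dots> \<le> 2 * b" by simp
  finally show ?thesis .
qed (use b in \<open>simp add: item_entry_def\<close>)

lemma target_entry_le: "target_entry b q V i \<le> 2 * b"
proof (cases "i < b ^ q")
  case False
  have "target_entry b q V i \<le> (\<Sum>j<q. if i div b ^ q = Suc j then 2 * b else 0)"
    unfolding target_entry_def using False by (auto intro!: sum_mono)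
  also have "\<dots> = (\<Sum>j<q. if i div b ^ q - 1 = j then if i div b ^ q = 0 then 0 else 2 * b else 0)"
    by (intro sum.cong) auto
  also have "\<dots> \<le> 2 * b" by simp
  finally show ?thesis .
qed (use b in \<open>simp add: target_entry_def\<close>)

lemma two_b_less: "b ^ q * (2 * b) < N"
proof -
  have "b ^ q * (2 * b) < b ^ q * (b * b)" using b by simp
  also have "\<dots> = b ^ (q + 2)" by (simp add: power2_eq_square power_add)
  finally show ?thesis using N by (rule less_le_trans)
qed

text \<open>From left to right, the counting entries give one item per scope, and the comparison
  entries tie each proposal to the constant scopes. From right to left, the items are the
  restrictions of \<open>\<sigma>\<close> to all scopes.\<close>

theorem subset_sum_iff_csp:
  "(\<exists>I \<subseteq> {..<b ^ q * b ^ q}. card I = card scopes \<and> sum item_number I = target) \<longleftrightarrow>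
   (\<exists>\<sigma>. (\<forall>c<V. \<sigma> c < b) \<and> (\<forall>p\<in>scopes. \<exists>z<b ^ q. (\<forall>j<q. digit b j z = \<sigma> (digit b j p)) \<and> allowed p z))"
proof
  assume "\<exists>I \<subseteq> {..<b ^ q * b ^ q}. card I = card scopes \<and> sum item_number I = target"
  then obtain I where I: "I \<subseteq> {..<b ^ q * b ^ q}" "card I = card scopes" "sum item_number I = target" by blast
  have fin: "finite I" using I(1) finite_subset by blast
  have B: "0 < b ^ q" using b by simp
  have ok: "is_scope b q V (e mod b ^ q) \<and> allowed (e mod b ^ q) (e div b ^ q)" if "e \<in> I" for e
  proof (rule ccontr)
    assume "\<not> ?thesis"
    then have "item_number e = Suc target" by (auto simp: item_number_def)
    then show False using member_le_sum[of e I item_number] that fin I(3) by simp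
  qed
  have "target = (\<Sum>e\<in>I. \<Sum>i<N. item_entry b q V e i * N ^ i)"
    unfolding I(3)[symmetric] by (intro sum.cong) (auto simp: item_number_def ok)
  also have "\<dots> = (\<Sum>i<N. (\<Sum>e\<in>I. item_entry b q V e i) * N ^ i)"
    by (subst sum.swap) (simp add: sum_distrib_right)
  finally have eq: "(\<Sum>i<N. (\<Sum>e\<in>I. item_entry b q V e i) * N ^ i) = (\<Sum>i<N. target_entry b q V i * N ^ i)"
    by (simp add: target_def)
  \<comment> \<open>No carries: the prescribed cardinality bounds the number of summands in a column
    by \<open>b ^ q\<close> before anything else is known about \<open>I\<close>.\<close>
  have entries: "(\<Sum>e\<in>I. item_entry b q V e i) = target_entry b q V i" if "i < N" for i
  proof (rule sum_powers_eqD[OF eq _ _ that])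
    fix j
    have "(\<Sum>e\<in>I. item_entry b q V e j) \<le> (\<Sum>e\<in>I. 2 * b)" by (intro sum_mono item_entry_le)
    also have "\<dots> = card I * (2 * b)" by simp
    also have "\<dots> \<le> b ^ q * (2 * b)" unfolding I(2) by (intro mult_le_mono1 card_scopes)
    finally show "(\<Sum>e\<in>I. item_entry b q V e j) < N" using two_b_less by simp
    have "target_entry b q V j \<le> b ^ q * (2 * b)"
      using target_entry_le[of j] mult_le_mono1[of 1 "b ^ q" "2 * b"] B by linarith
    then show "target_entry b q V j < N" using two_b_less by simp
  qed
  have BN: "b ^ q \<le> N" by (rule order_trans[OF _ Nq]) simp
  have one: "card {e \<in> I. e mod b ^ q = p} = 1" if "p \<in> scopes" for p
  proof -
    have p: "p < b ^ q" "is_scope b q V p" using that by (auto simp: scopes_def)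
    have "card {e \<in> I. e mod b ^ q = p} = (\<Sum>e\<in>I. if p = e mod b ^ q then 1 else 0)"
    proof -
      have "{e \<in> I. e mod b ^ q = p} = I \<inter> {e. p = e mod b ^ q}" by auto
      then show ?thesis using fin by (simp add: sum.If_cases)
    qed
    also have "\<dots> = target_entry b q V p"
      using entries[of p] p BN by (simp add: item_entry_def)
    finally show ?thesis using p by (simp add: target_entry_def)
  qed
  define E where "E p = (THE e. e \<in> I \<and> e mod b ^ q = p)" for p
  define Z where "Z p = E p div b ^ q" for p
  have E: "E p \<in> I" "E p mod b ^ q = p" "\<And>e. e \<in> I \<Longrightarrow> e mod b ^ q = p \<Longrightarrow> e = E p" if "p \<in> scopes" for p
  proof -
    from one[OF that] obtain e where *: "{e \<in> I. e mod b ^ q = p} = {e}" by (rule card_1_singletonE)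
    have e: "e \<in> I" "e mod b ^ q = p"
      using * by blast+
    have uniq: "e' = e" if "e' \<in> I" "e' mod b ^ q = p" for e'
      using * that by blast
    have "E p = e" unfolding E_def by (rule the_equality) (use e uniq in blast)+
    with e uniq show "E p \<in> I" "E p mod b ^ q = p" "\<And>e. e \<in> I \<Longrightarrow> e mod b ^ q = p \<Longrightarrow> e = E p" by metis+
  qed
  have E_eq: "E p = p + b ^ q * Z p" if "p \<in> scopes" for p
    using E(2)[OF that] mult_div_mod_eq[of "b ^ q" "E p"] by (simp add: Z_def)
  have Zlt: "Z p < b ^ q" if "p \<in> scopes" for p
    using E(1)[OF that] I(1) by (auto simp: Z_def less_mult_imp_div_less)
  have "I = E ` scopes"
  proof
    show "I \<subseteq> E ` scopes"
    proof
      fix e assume e: "e \<in> I"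
      have "e mod b ^ q \<in> scopes" using ok[OF e] B by (simp add: scopes_def)
      with E(3)[OF this e refl] show "e \<in> E ` scopes" by auto
    qed
  qed (use E in auto)
  also have "\<dots> = (\<lambda>p. p + b ^ q * Z p) ` scopes" by (intro image_cong) (auto simp: E_eq)
  finally have I_eq: "I = (\<lambda>p. p + b ^ q * Z p) ` scopes" .
  \<comment> \<open>The constant scopes hold the authoritative value of each variable.\<close>
  define \<sigma> where "\<sigma> c = digit b 0 (Z (const_scope c))" for c
  have \<sigma>: "\<sigma> c < b" for c using b by (simp add: \<sigma>_def digit_less)
  have val: "digit b j (Z p) = \<sigma> (digit b j p)" if p: "p \<in> scopes" and j: "j < q" for p j
  proof -
    \<comment> \<open>The entry that compares place \<open>j\<close> of scope \<open>p\<close>;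
      \<open>Suc j\<close> skips the counting block.\<close>
    define i where "i = Suc j * b ^ q + p"
    have pB: "p < b ^ q" "is_scope b q V p" using p by (auto simp: scopes_def)
    have "i < (q + 1) * b ^ q"
    proof -
      have "i < Suc (Suc j) * b ^ q" using pB by (simp add: i_def)
      also have "\<dots> \<le> (q + 1) * b ^ q" using j by (intro mult_le_mono1) simp
      finally show ?thesis .
    qed
    then have iN: "i < N" using Nq by simp
    have i: "\<not> i < b ^ q" "i div b ^ q = Suc j" "i mod b ^ q = p"
      using pB div_mult_self3[of "b ^ q" "Suc j" p] mod_mult_self3[of "Suc j" "b ^ q" p] b
      by (simp_all add: i_def del: mult_Suc) simp
    have "(\<Sum>e\<in>I. item_entry b q V e i) = digit b j (Z p) + (b - \<sigma> (digit b j p))"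
      using sum_item_entries[of Z I i, OF Zlt I_eq] i pB(2) j unfolding \<sigma>_def by simp
    moreover have "target_entry b q V i = b"
      unfolding target_entry_def using i pB j by simp
    ultimately show ?thesis using entries[OF iN] \<sigma>[of "digit b j p"] by simp
  qed
  show "\<exists>\<sigma>. (\<forall>c<V. \<sigma> c < b) \<and> (\<forall>p\<in>scopes. \<exists>z<b ^ q. (\<forall>j<q. digit b j z = \<sigma> (digit b j p)) \<and> allowed p z)"
  proof (intro exI[of _ \<sigma>] conjI ballI)
    fix p assume p: "p \<in> scopes"
    have "allowed p (Z p)" using ok[OF E(1)[OF p]] E(2)[OF p] by (simp add: Z_def)
    with val[OF p] Zlt[OF p] show "\<exists>z<b ^ q. (\<forall>j<q. digit b j z = \<sigma> (digit b j p)) \<and> allowed p z" by blast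
  qed (use \<sigma> in auto)
next
  assume "\<exists>\<sigma>. (\<forall>c<V. \<sigma> c < b) \<and> (\<forall>p\<in>scopes. \<exists>z<b ^ q. (\<forall>j<q. digit b j z = \<sigma> (digit b j p)) \<and> allowed p z)"
  then obtain \<sigma> where \<sigma>: "\<And>c. c < V \<Longrightarrow> \<sigma> c < b" and
    "\<forall>p\<in>scopes. \<exists>z. z < b ^ q \<and> (\<forall>j<q. digit b j z = \<sigma> (digit b j p)) \<and> allowed p z" by blast
  from bchoice[OF this(2)] obtain Z where
    Z: "\<And>p. p \<in> scopes \<Longrightarrow> Z p < b ^ q" "\<And>p j. p \<in> scopes \<Longrightarrow> j < q \<Longrightarrow> digit b j (Z p) = \<sigma> (digit b j p)"
      "\<And>p. p \<in> scopes \<Longrightarrow> allowed p (Z p)"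
    by blast
  define I where "I = (\<lambda>p. p + b ^ q * Z p) ` scopes"
  have B: "0 < b ^ q" using b by simp
  have lt: "p + b ^ q * Z p < b ^ q * b ^ q" if "p \<in> scopes" for p
  proof -
    have "p + b ^ q * Z p < b ^ q + b ^ q * Z p" using that by (simp add: scopes_def)
    also have "\<dots> = b ^ q * Suc (Z p)" by simp
    also have "\<dots> \<le> b ^ q * b ^ q" using Z(1)[OF that] by (intro mult_le_mono2) simp
    finally show ?thesis .
  qed
  have mod: "(p + b ^ q * z) mod b ^ q = p" and div: "(p + b ^ q * z) div b ^ q = z" if "p \<in> scopes" for p z
    using that B by (auto simp: scopes_def)
  have less: "p \<in> scopes \<Longrightarrow> p < b ^ q" for p
    by (simp add: scopes_def)
  have inj: "inj_on (\<lambda>p. p + b ^ q * Z p) scopes"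
    by (rule inj_onI) (metis mod)
  have entries: "(\<Sum>e\<in>I. item_entry b q V e i) = target_entry b q V i" for i
  proof -
    have "digit b j (Z p) + (b - digit b 0 (Z (const_scope (digit b j p)))) = b"
      if "j < q" "is_scope b q V p" "p < b ^ q" for j p
    proof -
      have p: "p \<in> scopes" using that by (simp add: scopes_def)
      have c: "digit b j p < V" using that by (simp add: is_scope_def)
      have "digit b 0 (Z (const_scope (digit b j p))) = \<sigma> (digit b j p)"
        using Z(2)[OF const_scope_in[OF c] q] const_scope(2)[of "digit b j p" 0] c V q by simp
      then show ?thesis using Z(2)[OF p that(1)] \<sigma>[OF c] by simp
    qed
    moreover have "i mod b ^ q < b ^ q" using B by simp
    ultimately show ?thesis
      using sum_item_entries[of Z I i, OF Z(1) I_def] unfolding target_entry_def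
      by (auto intro!: sum.cong)
  qed
  have "sum item_number I = (\<Sum>e\<in>I. \<Sum>i<N. item_entry b q V e i * N ^ i)"
  proof (rule sum.cong)
    fix e assume "e \<in> I"
    then obtain p where p: "p \<in> scopes" "e = p + b ^ q * Z p" by (auto simp: I_def)
    then show "item_number e = (\<Sum>i<N. item_entry b q V e i * N ^ i)"
      unfolding item_number_def p(2) mod[OF p(1)] div[OF p(1)] using Z(3)[OF p(1)] by (simp add: scopes_def)
  qed simp
  also have "\<dots> = (\<Sum>i<N. (\<Sum>e\<in>I. item_entry b q V e i) * N ^ i)"
    by (subst sum.swap) (simp add: sum_distrib_right)
  also have "\<dots> = target" by (simp add: entries target_def)
  finally have "sum item_number I = target" .
  moreover have "card I = card scopes" by (simp add: I_def card_image inj)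
  moreover have "I \<subseteq> {..<b ^ q * b ^ q}" using lt by (auto simp: I_def)
  ultimately show "\<exists>I \<subseteq> {..<b ^ q * b ^ q}. card I = card scopes \<and> sum item_number I = target" by blast
qed

text \<open>The entry that counts its own scope is \<open>1\<close>, so the number of an admissible
  item is not zero.\<close>

lemma item_number_pos: "e < b ^ q * b ^ q \<Longrightarrow> 0 < item_number e"
proof (cases "is_scope b q V (e mod b ^ q) \<and> allowed (e mod b ^ q) (e div b ^ q)")
  case True
  have B: "0 < b ^ q" using b by simp
  have lt: "e mod b ^ q < N" by (rule less_le_trans[OF mod_less_divisor[OF B] order_trans[OF _ Nq]]) simp
  have "item_entry b q V e (e mod b ^ q) * N ^ (e mod b ^ q) \<le> (\<Sum>i<N. item_entry b q V e i * N ^ i)"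
    using lt by (intro member_le_sum) auto
  moreover have "item_entry b q V e (e mod b ^ q) = 1" using B by (simp add: item_entry_def)
  moreover have "0 < N ^ (e mod b ^ q)" using lt by simp
  ultimately have "0 < (\<Sum>i<N. item_entry b q V e i * N ^ i)" by (metis less_le_trans nat_mult_1)
  then show ?thesis using True by (simp add: item_number_def)
qed (auto simp: item_number_def)

text \<open>Keeps the new parameter independent of the input length: in the reduction
  \<open>V\<close> is linear in \<open>k\<close> and \<open>q\<close> is constant, while only
  \<open>b\<close> grows with the word.\<close>

lemma card_scopes_le: "card scopes \<le> V ^ q"
proof -
  let ?f = "\<lambda>p. map (\<lambda>j. digit b j p) [0..<q]"
  have "inj_on ?f scopes"
    by (rule inj_onI, rule digits_inject[of _ b q]) (simp_all add: scopes_def)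
  moreover have "?f ` scopes \<subseteq> {xs. set xs \<subseteq> {..<V} \<and> length xs = q}"
    by (auto simp: scopes_def is_scope_def)
  ultimately have "card scopes \<le> card {xs. set xs \<subseteq> {..<V} \<and> length xs = q}"
    by (intro card_inj_on_le) (auto intro: finite_lists_length_eq)
  then show ?thesis by (simp add: card_lists_length_eq)
qed

text \<open>Replaces base-\<open>b\<close> codes by functions. Functions also have values beyond
  place \<open>q\<close>, which no code records; \<open>cong\<close> says that \<open>ok\<close>
  ignores them.\<close>

lemma csp_iff:
  assumes allowed: "\<And>p z. p < b ^ q \<Longrightarrow> z < b ^ q \<Longrightarrow> allowed p z \<longleftrightarrow> ok (\<lambda>j. digit b j p) (\<lambda>j. digit b j z)"
    and cong: "\<And>P P' z z'. (\<And>j. j < q \<Longrightarrow> P j = P' j) \<Longrightarrow> (\<And>j. j < q \<Longrightarrow> z j = z' j) \<Longrightarrow> ok P z = ok P' z'"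
  shows "(\<exists>\<sigma>. (\<forall>c<V. \<sigma> c < b) \<and> (\<forall>p\<in>scopes. \<exists>z<b ^ q. (\<forall>j<q. digit b j z = \<sigma> (digit b j p)) \<and> allowed p z)) \<longleftrightarrow>
    (\<exists>\<sigma>. (\<forall>c<V. \<sigma> c < b) \<and> (\<forall>P. (\<forall>j<q. P j < V) \<longrightarrow> ok P (\<lambda>j. \<sigma> (P j))))"
proof (intro ex_cong1 conj_cong refl iffI allI impI ballI)
  fix \<sigma> P assume \<sigma>: "\<forall>c<V. \<sigma> c < b"
    and *: "\<forall>p\<in>scopes. \<exists>z<b ^ q. (\<forall>j<q. digit b j z = \<sigma> (digit b j p)) \<and> allowed p z" and P: "\<forall>j<q. P j < V"
  define p where "p = (\<Sum>j<q. P j * b ^ j)"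
  have Pb: "\<And>j. j < q \<Longrightarrow> P j < b" using P V by (meson less_le_trans)
  have p1: "p < b ^ q" unfolding p_def by (rule sum_powers_less) (rule Pb)
  have p2: "digit b j p = P j" if "j < q" for j
    unfolding p_def by (rule digit_sum) (use Pb that in auto)
  note p = p1 p2
  then have "p \<in> scopes" using P by (simp add: scopes_def is_scope_def)
  with * obtain z where z: "z < b ^ q" "\<And>j. j < q \<Longrightarrow> digit b j z = \<sigma> (digit b j p)" "allowed p z" by blast
  have "ok (\<lambda>j. digit b j p) (\<lambda>j. digit b j z) = ok P (\<lambda>j. \<sigma> (P j))"
    by (rule cong) (simp_all add: p(2) z(2))
  then show "ok P (\<lambda>j. \<sigma> (P j))"
    using allowed[OF p(1) z(1)] z(3) by blast
next
  fix \<sigma> p assume \<sigma>: "\<forall>c<V. \<sigma> c < b" and *: "\<forall>P. (\<forall>j<q. P j < V) \<longrightarrow> ok P (\<lambda>j. \<sigma> (P j))" and p: "p \<in> scopes"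
  define z where "z = (\<Sum>j<q. \<sigma> (digit b j p) * b ^ j)"
  have p': "p < b ^ q" "\<forall>j<q. digit b j p < V" using p by (auto simp: scopes_def is_scope_def)
  then have zb: "\<And>j. j < q \<Longrightarrow> \<sigma> (digit b j p) < b" using \<sigma> by simp
  have z1: "z < b ^ q" unfolding z_def by (rule sum_powers_less) (rule zb)
  have z2: "digit b j z = \<sigma> (digit b j p)" if "j < q" for j
    unfolding z_def using digit_sum[of q "\<lambda>j. \<sigma> (digit b j p)" b j] zb that by blast
  note z = z1 z2
  have "ok (\<lambda>j. digit b j p) (\<lambda>j. \<sigma> (digit b j p))" using *[THEN spec, of "\<lambda>j. digit b j p"] p'(2) by (rule mp)
  moreover have "ok (\<lambda>j. digit b j p) (\<lambda>j. digit b j z) = ok (\<lambda>j. digit b j p) (\<lambda>j. \<sigma> (digit b j p))"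
    by (rule cong) (simp_all add: z(2))
  ultimately have "allowed p z"
    using allowed[OF p'(1) z(1)] by blast
  with z show "\<exists>z<b ^ q. (\<forall>j<q. digit b j z = \<sigma> (digit b j p)) \<and> allowed p z" by blast
qed

end

section \<open>Circuits of bounded depth and weft\<close>

text \<open>A recursive form of \<open>depth_le\<close>, whose quantifier over paths is not a
  bounded loop. The recursion depth is a constant of the program, and \<open>j < N\<close> has the
  range of its loops. A node without in-neighbours is an input.\<close>

primrec depth_ok :: "nat \<Rightarrow> (nat \<Rightarrow> nat) \<Rightarrow> (nat \<Rightarrow> nat \<Rightarrow> nat) \<Rightarrow> nat \<Rightarrow> nat \<Rightarrow> bool" where
  "depth_ok N np pr 0 i \<longleftrightarrow> np i = 0"
| "depth_ok N np pr (Suc e) i \<longleftrightarrow> (\<forall>j<N. j < np i \<longrightarrow> depth_ok N np pr e (pr i j))"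

text \<open>\<open>t\<close> is the number of large gates still permitted. Level \<open>0\<close>
  demands nothing: together with \<open>depth_ok\<close> the node is then an input.\<close>

primrec weft_ok :: "nat \<Rightarrow> (nat \<Rightarrow> nat) \<Rightarrow> (nat \<Rightarrow> nat \<Rightarrow> nat) \<Rightarrow> nat \<Rightarrow> nat \<Rightarrow> nat \<Rightarrow> bool" where
  "weft_ok N np pr 0 t i \<longleftrightarrow> True"
| "weft_ok N np pr (Suc e) t i \<longleftrightarrow>
    (if 2 < np i then 0 < t \<and> (\<forall>j<N. j < np i \<longrightarrow> weft_ok N np pr e (t - 1) (pr i j))
     else (\<forall>j<N. j < np i \<longrightarrow> weft_ok N np pr e t (pr i j)))"

text \<open>Evaluation of node \<open>i\<close>, descending at most \<open>e\<close> levels, with the values false (\<open>0\<close>), true (\<open>1\<close>),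
  unknown (\<open>2\<close>) and refuted (\<open>3\<close>). A large gate is not evaluated but takes the value claimed by
  \<open>cl\<close>: either its in-neighbour number \<open>cl i\<close> forces its value, or (\<open>cl i \<ge> np i\<close>) none does.\<close>

primrec claim_eval :: "nat \<Rightarrow> (nat \<Rightarrow> nat) \<Rightarrow> (nat \<Rightarrow> nat) \<Rightarrow> (nat \<Rightarrow> nat \<Rightarrow> nat) \<Rightarrow> (nat \<Rightarrow> nat) \<Rightarrow> (nat \<Rightarrow> nat)
    \<Rightarrow> nat \<Rightarrow> nat \<Rightarrow> nat" where
  "claim_eval N tg np pr inp cl 0 i = (if tg i = 0 then inp i else 2)"
| "claim_eval N tg np pr inp cl (Suc e) i =
    (if tg i = 0 then inp i
     else if \<exists>j<N. j < np i \<and> claim_eval N tg np pr inp cl e (pr i j) = 3 then 3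
     else if tg i = 1 then
       (if claim_eval N tg np pr inp cl e (pr i 0) = 2 then 2 else 1 - claim_eval N tg np pr inp cl e (pr i 0))
     else if 2 < np i then
       (if cl i < np i then
          (if claim_eval N tg np pr inp cl e (pr i (cl i)) = (if tg i = 2 then 1 else 0) then 3 else (if tg i = 2 then 0 else 1))
        else
          (if \<exists>j<N. j < np i \<and> claim_eval N tg np pr inp cl e (pr i j) = (if tg i = 2 then 0 else 1) then 3
           else (if tg i = 2 then 1 else 0)))
     else if \<exists>j<N. j < np i \<and> claim_eval N tg np pr inp cl e (pr i j) = (if tg i = 2 then 0 else 1) then (if tg i = 2 then 0 else 1)
     else if \<forall>j<N. j < np i \<longrightarrow> claim_eval N tg np pr inp cl e (pr i j) = (if tg i = 2 then 1 else 0) then (if tg i = 2 then 1 else 0)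
     else 2)"

primrec tag :: "gate \<Rightarrow> nat" where
  "tag Input = 0"
| "tag (Neg j) = 1"
| "tag (And js) = 2"
| "tag (Or js) = 3"

text \<open>The nodes at which the descent from \<open>i\<close> through small gates stops. It
  serves twice: its inputs are those a view has to settle, and its large gates are those that need a
  claim. Fan-in two yields the bound \<open>2 ^ e\<close>.\<close>

primrec supp :: "(nat \<Rightarrow> nat) \<Rightarrow> (nat \<Rightarrow> nat) \<Rightarrow> (nat \<Rightarrow> nat \<Rightarrow> nat) \<Rightarrow> nat \<Rightarrow> nat \<Rightarrow> nat set" where
  "supp tg np pr 0 i = {i}"
| "supp tg np pr (Suc e) i = (if tg i = 0 \<or> 2 < np i then {i} else (\<Union>j<np i. supp tg np pr e (pr i j)))"

lemma card_supp: "finite (supp tg np pr e i) \<and> card (supp tg np pr e i) \<le> 2 ^ e"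
proof (induction e arbitrary: i)
  case (Suc e)
  have "card (\<Union>j<np i. supp tg np pr e (pr i j)) \<le> 2 ^ Suc e" if "np i \<le> 2"
  proof -
    have "card (\<Union>j<np i. supp tg np pr e (pr i j)) \<le> (\<Sum>j<np i. card (supp tg np pr e (pr i j)))"
      by (rule card_UN_le) simp
    also have "\<dots> \<le> (\<Sum>j<np i. 2 ^ e)" by (intro sum_mono) (simp add: Suc)
    also have "\<dots> \<le> 2 * 2 ^ e" using that by simp
    finally show ?thesis by simp
  qed
  with Suc show ?case by (auto simp: Suc_leI)
qed simp

text \<open>Tags, arities and in-neighbours are functions because the program reads them off the
  encoded word; their values outside the circuit are arbitrary.\<close>

locale circuit_view =
  fixes C :: circuit and tg np :: "nat \<Rightarrow> nat" and pr :: "nat \<Rightarrow> nat \<Rightarrow> nat" and N :: nat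
  assumes circuit: "is_circuit C"
    and tg: "\<And>i. i < length C \<Longrightarrow> tg i = tag (C ! i)"
    and np: "\<And>i. i < length C \<Longrightarrow> np i = length (preds (C ! i))"
    and np_le: "\<And>i. i < length C \<Longrightarrow> np i \<le> N"
    and pr: "\<And>i j. i < length C \<Longrightarrow> j < np i \<Longrightarrow> pr i j = preds (C ! i) ! j"
begin

abbreviation "n \<equiv> length C"

lemma n_pos: "0 < n"
  using circuit by (simp add: is_circuit_def)

lemma pr_less: "i < n \<Longrightarrow> j < np i \<Longrightarrow> pr i j < i"
  using circuit pr[of i j] np[of i] by (auto simp: is_circuit_def)

lemma pr_less_n: "i < n \<Longrightarrow> j < np i \<Longrightarrow> pr i j < n"
  using pr_less[of i j] by simp

lemma preds_iff: "i < n \<Longrightarrow> x \<in> set (preds (C ! i)) \<longleftrightarrow> (\<exists>j<np i. x = pr i j)"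
  by (auto simp: in_set_conv_nth np pr)

lemma all_N: "i < n \<Longrightarrow> (\<forall>j<N. j < np i \<longrightarrow> P j) \<longleftrightarrow> (\<forall>j<np i. P j)"
  and ex_N: "i < n \<Longrightarrow> (\<exists>j<N. j < np i \<and> P j) \<longleftrightarrow> (\<exists>j<np i. P j)"
  using np_le[of i] by (auto dest: less_le_trans)

lemma np_cases:
  assumes "i < n"
  obtains (input) "tg i = 0" "np i = 0" "C ! i = Input"
  | (neg) j where "tg i = 1" "np i = 1" "C ! i = Neg j"
  | (conj) js where "tg i = 2" "np i \<ge> 2" "C ! i = And js"
  | (disj) js where "tg i = 3" "np i \<ge> 2" "C ! i = Or js"
  using assms circuit by (cases "C ! i") (auto simp: tg np is_circuit_def)

lemma np_0_iff: "i < n \<Longrightarrow> np i = 0 \<longleftrightarrow> tg i = 0"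
  by (erule np_cases) auto

lemma input_nodes_iff: "i \<in> input_nodes C \<longleftrightarrow> i < n \<and> tg i = 0"
  by (auto simp: input_nodes_def tg elim!: np_cases)

definition bval :: "nat set \<Rightarrow> nat \<Rightarrow> nat" where
  "bval S i = (if node_val C S i then 1 else 0)"

text \<open>One in-neighbour with the forcing value decides the gate; otherwise the gate has the
  other, default value. This treats conjunctions and disjunctions alike.\<close>

definition "forcing i = (if tg i = 2 then 0 else 1 :: nat)"
definition "default_val i = (if tg i = 2 then 1 else 0 :: nat)"

lemma bval_input: "i < n \<Longrightarrow> tg i = 0 \<Longrightarrow> bval S i = (if i \<in> S then 1 else 0)"
  by (erule np_cases) (auto simp: bval_def node_val.simps[of C S i])

lemma bval_neg:
  assumes "i < n" "tg i = 1"
  shows "bval S i = 1 - bval S (pr i 0)"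
  using assms(1)
proof (cases rule: np_cases)
  case (neg j)
  then have "pr i 0 = j" using pr[of i 0] assms(1) by simp
  then show ?thesis using pr_less[of i 0] assms neg by (auto simp: bval_def node_val.simps[of C S i])
qed (use assms in auto)

lemma bval_gate:
  assumes "i < n" "2 \<le> tg i"
  shows "bval S i = (if \<exists>j<np i. bval S (pr i j) = forcing i then forcing i else default_val i)"
  using assms(1)
proof (cases rule: np_cases)
  case (conj js)
  have "j < i" if "j \<in> set js" for j using circuit assms(1) conj(3) that by (auto simp: is_circuit_def)
  moreover have "j \<in> set js \<longleftrightarrow> (\<exists>l<np i. j = pr i l)" for j using preds_iff[OF assms(1), of j] conj(3) by simp
  ultimately have "node_val C S i \<longleftrightarrow> (\<forall>l<np i. node_val C S (pr i l))"
    using conj(3) by (auto simp: node_val.simps[of C S i])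
  then show ?thesis using conj by (auto simp: bval_def forcing_def default_val_def)
next
  case (disj js)
  have "j < i" if "j \<in> set js" for j using circuit assms(1) disj(3) that by (auto simp: is_circuit_def)
  moreover have "j \<in> set js \<longleftrightarrow> (\<exists>l<np i. j = pr i l)" for j using preds_iff[OF assms(1), of j] disj(3) by simp
  ultimately have "node_val C S i \<longleftrightarrow> (\<exists>l<np i. node_val C S (pr i l))"
    using disj(3) by (auto simp: node_val.simps[of C S i])
  then show ?thesis using disj by (auto simp: bval_def forcing_def default_val_def)
qed (use assms in auto)

lemma bval_01: "bval S i = 0 \<or> bval S i = 1"
  by (simp add: bval_def)

lemma bval_cases: "bval S i = forcing l \<or> bval S i = default_val l"
  by (simp add: bval_def forcing_def default_val_def)

lemma forcing_default: "forcing i \<noteq> default_val i" "forcing i \<noteq> 2" "default_val i \<noteq> 2" "forcing i \<noteq> 3" "default_val i \<noteq> 3"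
  by (auto simp: forcing_def default_val_def)

section \<open>Depth and weft along paths\<close>

definition path_to :: "nat \<Rightarrow> nat list \<Rightarrow> bool" where
  "path_to i p \<longleftrightarrow> p \<noteq> [] \<and> hd p \<in> input_nodes C \<and> last p = i \<and> set p \<subseteq> {..<n} \<and>
    successively (\<lambda>i j. i \<in> set (preds (C ! j))) p"

lemma input_output_path_iff: "input_output_path C p \<longleftrightarrow> path_to (n - 1) p"
  by (simp add: input_output_path_def path_to_def)

lemma path_to_cases:
  assumes "path_to i p"
  obtains (single) "p = [i]" "i < n" "tg i = 0"
  | (step) p' j where "p = p' @ [i]" "i < n" "j < np i" "path_to (pr i j) p'"
proof (cases p rule: rev_cases)
  case (snoc p' x)
  with assms have x: "x = i" "i < n" by (auto simp: path_to_def)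
  show ?thesis
  proof (cases "p' = []")
    case True
    with snoc x assms single show ?thesis by (auto simp: path_to_def input_nodes_iff)
  next
    case False
    with assms snoc x have "last p' \<in> set (preds (C ! i))" "successively (\<lambda>i j. i \<in> set (preds (C ! j))) p'"
      by (auto simp: path_to_def successively_append_iff)
    moreover from this(1) x obtain j where "j < np i" "last p' = pr i j" by (auto simp: preds_iff)
    ultimately show ?thesis using step[of p' j] False assms snoc x by (auto simp: path_to_def)
  qed
qed (use assms in \<open>simp add: path_to_def\<close>)

lemma path_to_append:
  "path_to (pr i j) p \<Longrightarrow> i < n \<Longrightarrow> j < np i \<Longrightarrow> path_to i (p @ [i])"
  by (auto simp: path_to_def successively_append_iff preds_iff)

text \<open>Descending along in-neighbours ends at an input because they have smaller numbers. Hence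
  a violated bound, found by the recursion from above, extends to a path that starts at an
  input.\<close>

lemma path_exists: "i < n \<Longrightarrow> \<exists>p. path_to i p"
proof (induction i rule: less_induct)
  case (less i)
  show ?case
  proof (cases "np i = 0")
    case True
    with less.prems have "path_to i [i]" by (simp add: path_to_def input_nodes_iff np_0_iff)
    then show ?thesis ..
  next
    case False
    with less.IH[of "pr i 0"] pr_less[of i 0] less.prems obtain p where "path_to (pr i 0) p" by auto
    from path_to_append[OF this] False less.prems show ?thesis by blast
  qed
qed

lemma depth_okD: "depth_ok N np pr e i \<Longrightarrow> path_to i p \<Longrightarrow> length p - 1 \<le> e"
proof (induction e arbitrary: i p)
  case 0
  from 0(2) show ?case by (cases rule: path_to_cases) (use 0 in auto)
next
  case (Suc e)
  from Suc.prems(2) show ?case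
  proof (cases rule: path_to_cases)
    case (step p' j)
    with Suc.prems(1) have "depth_ok N np pr e (pr i j)" by (simp add: all_N)
    from Suc.IH[OF this step(4)] step show ?thesis by simp
  qed simp
qed

lemma depth_okI: "\<not> depth_ok N np pr e i \<Longrightarrow> i < n \<Longrightarrow> \<exists>p. path_to i p \<and> e < length p - 1"
proof (induction e arbitrary: i)
  case 0
  then have "0 < np i" by simp
  with path_exists[of "pr i 0"] pr_less_n[of i 0] 0 obtain p where p: "path_to (pr i 0) p" by auto
  then have "p \<noteq> []" by (simp add: path_to_def)
  with path_to_append[OF p] \<open>0 < np i\<close> 0 show ?case by (intro exI[of _ "p @ [i]"]) simp
next
  case (Suc e)
  then obtain j where j: "j < np i" "\<not> depth_ok N np pr e (pr i j)" by (auto simp: all_N)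
  with Suc.IH[OF this(2)] pr_less_n Suc.prems obtain p where "path_to (pr i j) p" "e < length p - 1" by blast
  with path_to_append[of i j p] j Suc.prems show ?case by (intro exI[of _ "p @ [i]"]) simp
qed

lemma depth_le_iff: "depth_le C d \<longleftrightarrow> depth_ok N np pr d (n - 1)"
  unfolding depth_le_def input_output_path_iff
  using depth_okD[of d "n - 1"] depth_okI[of d "n - 1"] n_pos by (meson diff_less leD zero_less_one)

lemma large_iff: "i < n \<Longrightarrow> large (C ! i) \<longleftrightarrow> 2 < np i"
  by (simp add: large_def np)

abbreviation "count_large p \<equiv> length (filter (\<lambda>i. large (C ! i)) p)"

lemma weft_okD: "depth_ok N np pr e i \<Longrightarrow> weft_ok N np pr e t i \<Longrightarrow> path_to i p \<Longrightarrow> count_large p \<le> t"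
proof (induction e arbitrary: i p t)
  case 0
  from 0(3) show ?case by (cases rule: path_to_cases) (use 0 in \<open>auto simp: large_iff\<close>)
next
  case (Suc e)
  from Suc.prems(3) show ?case
  proof (cases rule: path_to_cases)
    case single
    then have "np i = 0" by (simp add: np_0_iff)
    with single show ?thesis by (simp add: large_iff)
  next
    case (step p' j)
    with Suc.prems(1) have d: "depth_ok N np pr e (pr i j)" by (simp add: all_N)
    show ?thesis
    proof (cases "2 < np i")
      case True
      with Suc.prems(2) step have "weft_ok N np pr e (t - 1) (pr i j)" "0 < t" by (simp_all add: all_N)
      with Suc.IH[OF d this(1) step(4)] step True show ?thesis by (simp add: large_iff)
    next
      case False
      with Suc.prems(2) step have "weft_ok N np pr e t (pr i j)" by (simp add: all_N)
      with Suc.IH[OF d this(1) step(4)] step False show ?thesis by (simp add: large_iff)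
    qed
  qed
qed

lemma weft_okI: "\<not> weft_ok N np pr e t i \<Longrightarrow> i < n \<Longrightarrow> \<exists>p. path_to i p \<and> t < count_large p"
proof (induction e arbitrary: i t)
  case (Suc e)
  show ?case
  proof (cases "2 < np i")
    case True
    show ?thesis
    proof (cases "t = 0")
      case t: True
      from path_exists[of "pr i 0"] pr_less_n[of i 0] Suc.prems True obtain p where p: "path_to (pr i 0) p" by auto
      with path_to_append[OF p] True Suc.prems t show ?thesis
        by (intro exI[of _ "p @ [i]"]) (simp add: large_iff)
    next
      case False
      with True Suc.prems obtain j where j: "j < np i" "\<not> weft_ok N np pr e (t - 1) (pr i j)" by (auto simp: all_N)
      with Suc.IH[OF this(2)] pr_less_n Suc.prems obtain p where "path_to (pr i j) p" "t - 1 < count_large p" by blast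
      with path_to_append[of i j p] j Suc.prems True False show ?thesis
        by (intro exI[of _ "p @ [i]"]) (simp add: large_iff)
    qed
  next
    case False
    with Suc.prems obtain j where j: "j < np i" "\<not> weft_ok N np pr e t (pr i j)" by (auto simp: all_N)
    with Suc.IH[OF this(2)] pr_less_n Suc.prems obtain p where "path_to (pr i j) p" "t < count_large p" by blast
    with path_to_append[of i j p] j Suc.prems False show ?thesis
      by (intro exI[of _ "p @ [i]"]) (simp add: large_iff)
  qed
qed simp

lemma weft_le_iff: "depth_ok N np pr d (n - 1) \<Longrightarrow> weft_le C t \<longleftrightarrow> weft_ok N np pr d t (n - 1)"
  unfolding weft_le_def input_output_path_iff
  using weft_okD[of d "n - 1" t] weft_okI[of d t "n - 1"] n_pos by (meson diff_less leD zero_less_one)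

subsection \<open>Evaluation with claims\<close>

lemma eval_Suc:
  assumes "i < n"
  shows "claim_eval N tg np pr inp cl (Suc e) i =
    (if tg i = 0 then inp i
     else if \<exists>j<np i. claim_eval N tg np pr inp cl e (pr i j) = 3 then 3
     else if tg i = 1 then
       (if claim_eval N tg np pr inp cl e (pr i 0) = 2 then 2 else 1 - claim_eval N tg np pr inp cl e (pr i 0))
     else if 2 < np i then
       (if cl i < np i then
          (if claim_eval N tg np pr inp cl e (pr i (cl i)) = default_val i then 3 else forcing i)
        else (if \<exists>j<np i. claim_eval N tg np pr inp cl e (pr i j) = forcing i then 3 else default_val i))
     else if \<exists>j<np i. claim_eval N tg np pr inp cl e (pr i j) = forcing i then forcing i
     else if \<forall>j<np i. claim_eval N tg np pr inp cl e (pr i j) = default_val i then default_val i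
     else 2)"
  unfolding claim_eval.simps all_N[OF assms] ex_N[OF assms] forcing_def default_val_def by (rule refl)

declare claim_eval.simps(2) [simp del]

lemma eval_input: "i < n \<Longrightarrow> tg i = 0 \<Longrightarrow> claim_eval N tg np pr inp cl (Suc e) i = inp i"
  unfolding eval_Suc by simp

text \<open>The test for \<open>3\<close> precedes the evaluation of the gate, so a refutation is
  never hidden by a forcing in-neighbour.\<close>

lemma eval_refuted:
  assumes "i < n" "j < np i" "claim_eval N tg np pr inp cl e (pr i j) = 3"
  shows "claim_eval N tg np pr inp cl (Suc e) i = 3"
proof -
  have "tg i \<noteq> 0" using assms np_0_iff[of i] by auto
  moreover have "\<exists>j<np i. claim_eval N tg np pr inp cl e (pr i j) = 3" using assms by blast
  ultimately show ?thesis unfolding eval_Suc[OF assms(1)] by (simp only: if_True if_False)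
qed

context
  fixes i inp cl e
  assumes i: "i < n" and no3: "\<not> (\<exists>j<np i. claim_eval N tg np pr inp cl e (pr i j) = 3)"
begin

lemma eval_neg:
  "tg i = 1 \<Longrightarrow> claim_eval N tg np pr inp cl (Suc e) i =
     (if claim_eval N tg np pr inp cl e (pr i 0) = 2 then 2 else 1 - claim_eval N tg np pr inp cl e (pr i 0))"
  unfolding eval_Suc[OF i] if_not_P[OF no3] by simp

lemma eval_large:
  "2 \<le> tg i \<Longrightarrow> 2 < np i \<Longrightarrow> claim_eval N tg np pr inp cl (Suc e) i =
     (if cl i < np i then (if claim_eval N tg np pr inp cl e (pr i (cl i)) = default_val i then 3 else forcing i)
      else (if \<exists>j<np i. claim_eval N tg np pr inp cl e (pr i j) = forcing i then 3 else default_val i))"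
  unfolding eval_Suc[OF i] if_not_P[OF no3] by simp

lemma eval_small:
  assumes "2 \<le> tg i" "\<not> 2 < np i"
  shows "claim_eval N tg np pr inp cl (Suc e) i =
     (if \<exists>j<np i. claim_eval N tg np pr inp cl e (pr i j) = forcing i then forcing i
      else if \<forall>j<np i. claim_eval N tg np pr inp cl e (pr i j) = default_val i then default_val i else 2)"
proof -
  have "tg i \<noteq> 0" "tg i \<noteq> 1" using assms(1) by auto
  then show ?thesis
    unfolding eval_Suc[OF i] if_not_P[OF no3] if_not_P[OF assms(2)] by (simp only: if_False)
qed

end

section \<open>Soundness: under true claims every value is unknown or correct\<close>

definition claim_ok :: "nat set \<Rightarrow> (nat \<Rightarrow> nat) \<Rightarrow> nat \<Rightarrow> bool" where
  "claim_ok S cl i \<longleftrightarrow> (if cl i < np i then bval S (pr i (cl i)) = forcing i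
     else (\<forall>j<np i. bval S (pr i j) \<noteq> forcing i))"

lemma eval_sound_small:
  assumes i: "i < n" "\<not> 2 < np i" and inp: "tg i = 0 \<Longrightarrow> inp i \<in> {2, bval S i}"
    and IH: "\<And>j. j < np i \<Longrightarrow> claim_eval N tg np pr inp cl e (pr i j) \<in> {2, bval S (pr i j)}"
  shows "claim_eval N tg np pr inp cl (Suc e) i \<in> {2, bval S i}"
proof -
  let ?v = "\<lambda>j. claim_eval N tg np pr inp cl e (pr i j)"
  have no3: "\<not> (\<exists>j<np i. ?v j = 3)"
  proof
    assume "\<exists>j<np i. ?v j = 3"
    then obtain j where "j < np i" "?v j = 3" by blast
    with IH[of j] bval_01[of S "pr i j"] show False by auto
  qed
  consider "tg i = 0" | "tg i = 1" "np i = 1" | "2 \<le> tg i" "2 \<le> np i"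
    using i(1) by (cases rule: np_cases) auto
  then show ?thesis
  proof cases
    case 1
    with inp i show ?thesis by (simp add: eval_input)
  next
    case 2
    with IH[of 0] bval_neg[OF i(1), of S] eval_neg[OF i(1) no3 2(1)] show ?thesis by auto
  next
    case 3
    then have ev: "claim_eval N tg np pr inp cl (Suc e) i = (if \<exists>j<np i. ?v j = forcing i then forcing i
        else if \<forall>j<np i. ?v j = default_val i then default_val i else 2)"
      using eval_small[OF i(1) no3 3(1) i(2)] by blast
    show ?thesis
    proof (cases "\<exists>j<np i. ?v j = forcing i")
      case True
      then obtain j where "j < np i" "?v j = forcing i" by blast
      with IH[of j] forcing_default have "bval S (pr i j) = forcing i" by auto
      with \<open>j < np i\<close> have "bval S i = forcing i" using bval_gate[OF i(1) 3(1), of S] by auto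
      with ev True show ?thesis by simp
    next
      case False
      show ?thesis
      proof (cases "\<forall>j<np i. ?v j = default_val i")
        case True
        with IH forcing_default have "bval S (pr i j) = default_val i" if "j < np i" for j
          using that by (metis insert_iff singletonD)
        then have nf: "\<not> (\<exists>j<np i. bval S (pr i j) = forcing i)" using forcing_default(1)[of i] by metis
        have "bval S i = default_val i"
          using bval_gate[OF i(1) 3(1), of S] unfolding if_not_P[OF nf] .
        with ev False True show ?thesis by simp
      next
        case not_all: False
        show ?thesis unfolding ev if_not_P[OF False] if_not_P[OF not_all] by simp
      qed
    qed
  qed
qed

lemma eval_sound_weft_0:
  assumes "weft_ok N np pr e 0 i" "i < n" and inp: "\<And>x. x < n \<Longrightarrow> tg x = 0 \<Longrightarrow> inp x \<in> {2, bval S x}"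
  shows "claim_eval N tg np pr inp cl e i \<in> {2, bval S i}"
  using assms(1,2)
proof (induction e arbitrary: i)
  case (Suc e)
  then have "\<not> 2 < np i" by (auto split: if_splits)
  with Suc show ?case
    by (intro eval_sound_small inp) (auto simp: all_N pr_less_n simp del: insert_iff)
qed (use inp in simp)

text \<open>Below a large gate there is no further one, so its in-neighbours are evaluated without
  claims and are unknown or correct by \<open>eval_sound_weft_0\<close>. Such values cannot refute a
  true claim.\<close>

lemma eval_sound_weft_1:
  assumes "weft_ok N np pr e 1 i" "i < n" and inp: "\<And>x. x < n \<Longrightarrow> tg x = 0 \<Longrightarrow> inp x \<in> {2, bval S x}"
    and "\<And>g. g \<in> supp tg np pr e i \<Longrightarrow> 2 < np g \<Longrightarrow> claim_ok S cl g"
  shows "claim_eval N tg np pr inp cl e i \<in> {2, bval S i}"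
  using assms(1,2,4)
proof (induction e arbitrary: i)
  case (Suc e)
  show ?case
  proof (cases "2 < np i")
    case False
    show ?thesis
    proof (rule eval_sound_small[OF Suc.prems(2) False])
      fix j assume j: "j < np i"
      then have "tg i \<noteq> 0" using Suc.prems(2) np_0_iff[of i] by auto
      with j False have "supp tg np pr e (pr i j) \<subseteq> supp tg np pr (Suc e) i" by auto
      with Suc.prems j False show "claim_eval N tg np pr inp cl e (pr i j) \<in> {2, bval S (pr i j)}"
        by (intro Suc.IH) (auto simp: all_N pr_less_n)
    qed (use inp Suc.prems in auto)
  next
    case True
    let ?v = "\<lambda>j. claim_eval N tg np pr inp cl e (pr i j)"
    have tgi: "2 \<le> tg i" "tg i \<noteq> 0" "tg i \<noteq> 1" using Suc.prems(2) True by (auto elim: np_cases)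
    have "weft_ok N np pr e 0 (pr i j)" if "j < np i" for j
      using Suc.prems True that by (simp add: all_N)
    then have v: "?v j \<in> {2, bval S (pr i j)}" if "j < np i" for j
      using that Suc.prems(2) inp by (intro eval_sound_weft_0) (auto simp: pr_less_n)
    have no3: "\<not> (\<exists>j<np i. ?v j = 3)"
    proof
      assume "\<exists>j<np i. ?v j = 3"
      then obtain j where "j < np i" "?v j = 3" by blast
      with v[of j] bval_01[of S "pr i j"] show False by auto
    qed
    have claim: "claim_ok S cl i" using Suc.prems(3)[of i] True by simp
    show ?thesis
    proof (cases "cl i < np i")
      case cl: True
      with claim have b: "bval S (pr i (cl i)) = forcing i" by (simp add: claim_ok_def)
      with v[OF cl] forcing_default have "?v (cl i) \<noteq> default_val i" by auto
      moreover have "bval S i = forcing i" using bval_gate[OF Suc.prems(2) tgi(1), of S] b cl by auto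
      ultimately show ?thesis using cl eval_large[OF Suc.prems(2) no3 tgi(1) True] by simp
    next
      case cl: False
      with claim have b: "bval S (pr i j) \<noteq> forcing i" if "j < np i" for j using that by (simp add: claim_ok_def)
      then have nf: "\<not> (\<exists>j<np i. ?v j = forcing i)" using v forcing_default by (metis insert_iff singletonD)
      have "bval S i = default_val i" using bval_gate[OF Suc.prems(2) tgi(1), of S] b by auto
      then show ?thesis
        unfolding eval_large[OF Suc.prems(2) no3 tgi(1) True] if_not_P[OF cl] if_not_P[OF nf] by simp
    qed
  qed
qed (use inp in simp)

section \<open>Completeness: unrefuted claims are true\<close>

lemma supp_subset: "x < n \<Longrightarrow> supp tg np pr e x \<subseteq> {..<n}"
proof (induction e arbitrary: x)
  case (Suc e)
  have "supp tg np pr e (pr x j) \<subseteq> {..<n}" if "j < np x" for j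
    using Suc.IH[OF pr_less_n[OF Suc.prems that]] .
  then show ?case using Suc.prems by auto
qed simp

text \<open>The calls made when the output is evaluated from level \<open>d\<close>: node
  \<open>i\<close> with \<open>e\<close> levels left. A refutation in any of these calls reaches the
  output, so its absence at the output excludes it everywhere.\<close>

inductive relevant :: "nat \<Rightarrow> nat \<Rightarrow> nat \<Rightarrow> bool" for d where
  "relevant d d (n - 1)"
| "relevant d (Suc e) i \<Longrightarrow> j < np i \<Longrightarrow> relevant d e (pr i j)"

lemma relevant_less: "relevant d e i \<Longrightarrow> i < n"
  by (induction rule: relevant.induct) (use n_pos pr_less_n in auto)

lemma relevant_depth: "relevant d e i \<Longrightarrow> depth_ok N np pr d (n - 1) \<Longrightarrow> depth_ok N np pr e i"
  by (induction rule: relevant.induct) (auto dest: relevant_less simp: all_N)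

lemma relevant_le: "relevant d e i \<Longrightarrow> e \<le> d"
  by (induction rule: relevant.induct) auto

lemma relevant_refuted: "relevant d e i \<Longrightarrow> claim_eval N tg np pr inp cl e i = 3 \<Longrightarrow> claim_eval N tg np pr inp cl d (n - 1) = 3"
proof (induction rule: relevant.induct)
  case (2 e i j)
  from 2(1) have "i < n" by (rule relevant_less)
  with eval_refuted[OF this 2(2,4)] 2(3) show ?case by blast
qed

text \<open>The family \<open>G\<close> ranges over the partial views of the inputs that are given to the evaluation.\<close>

lemma eval_complete:
  assumes depth: "depth_ok N np pr d (n - 1)"
    and G: "\<And>A. finite A \<Longrightarrow> A \<subseteq> {..<n} \<Longrightarrow> card A \<le> 2 ^ d \<Longrightarrow>
      \<exists>inp\<in>G. \<forall>x\<in>A. tg x = 0 \<longrightarrow> inp x = bval S x"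
    and ok: "\<And>inp. inp \<in> G \<Longrightarrow> claim_eval N tg np pr inp cl d (n - 1) \<noteq> 3"
    and "relevant d e i" "inp \<in> G" "\<forall>x\<in>supp tg np pr e i. tg x = 0 \<longrightarrow> inp x = bval S x"
  shows "claim_eval N tg np pr inp cl e i = bval S i"
  using assms(4-6)
proof (induction e arbitrary: i inp)
  case 0
  from relevant_depth[OF 0(1) depth] relevant_less[OF 0(1)] have "tg i = 0" by (simp add: np_0_iff)
  with 0 show ?case by simp
next
  case (Suc e)
  have i: "i < n" using Suc.prems(1) by (rule relevant_less)
  let ?v = "\<lambda>inp j. claim_eval N tg np pr inp cl e (pr i j)"
  have no3: "?v inp j \<noteq> 3" if "inp \<in> G" "j < np i" for inp j
    using relevant_refuted[OF relevant.intros(2)[OF Suc.prems(1) that(2)]] ok[OF that(1)] by blast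
  have not3: "claim_eval N tg np pr inp cl (Suc e) i \<noteq> 3" if "inp \<in> G" for inp
    using relevant_refuted[OF Suc.prems(1)] ok[OF that] by blast
  consider "tg i = 0" | "tg i = 1" "np i = 1" | "2 \<le> tg i" "np i = 2" | "2 \<le> tg i" "2 < np i"
    using i by (cases rule: np_cases) force+
  then show ?case
  proof cases
    case 1
    with Suc.prems(3) i show ?thesis by (simp add: eval_input)
  next
    case 2
    have "?v inp 0 = bval S (pr i 0)"
      using 2 Suc.prems by (intro Suc.IH relevant.intros(2)) auto
    moreover have no3': "\<not> (\<exists>j<np i. ?v inp j = 3)" using no3 Suc.prems(2) by blast
    ultimately show ?thesis
      using eval_neg[OF i no3' 2(1)] bval_neg[OF i 2(1), of S] bval_01[of S "pr i 0"] by auto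
  next
    case 3
    have v: "?v inp j = bval S (pr i j)" if "j < np i" for j
      using 3 Suc.prems that by (intro Suc.IH relevant.intros(2)) auto
    have no3': "\<not> (\<exists>j<np i. ?v inp j = 3)" using no3 Suc.prems(2) by blast
    have np2: "\<not> 2 < np i" using 3(2) by simp
    have ex: "(\<exists>j<np i. ?v inp j = forcing i) \<longleftrightarrow> (\<exists>j<np i. bval S (pr i j) = forcing i)" using v by auto
    have all: "\<forall>j<np i. ?v inp j = default_val i" if "\<not> (\<exists>j<np i. bval S (pr i j) = forcing i)"
      using that bval_cases v by metis
    show ?thesis
      unfolding eval_small[OF i no3' 3(1) np2] bval_gate[OF i 3(1)] ex by (rule if_cong) (use all in auto)
  next
    case 4
    \<comment> \<open>Each in-neighbour has its own view that settles all it depends on. No single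
      view needs to serve all in-neighbours, since the claims \<open>cl\<close> are common to all
      views.\<close>
    have cover: "\<exists>inp\<in>G. ?v inp j = bval S (pr i j)" if j: "j < np i" for j
    proof -
      let ?A = "supp tg np pr e (pr i j) \<inter> {..<n}"
      have rel: "relevant d e (pr i j)" using Suc.prems(1) j by (rule relevant.intros(2))
      have "card ?A \<le> 2 ^ e" using card_supp[of tg np pr e "pr i j"] card_mono[of "supp tg np pr e (pr i j)" ?A] by simp
      also have "\<dots> \<le> 2 ^ d" using relevant_le[OF rel] by (simp add: power_increasing)
      finally obtain inp' where "inp' \<in> G" "\<forall>x\<in>?A. tg x = 0 \<longrightarrow> inp' x = bval S x"
        using G[of ?A] card_supp[of tg np pr e "pr i j"] by auto
      moreover have "?A = supp tg np pr e (pr i j)" using supp_subset[OF pr_less_n[OF i j]] by blast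
      ultimately show ?thesis using Suc.IH[OF rel] by metis
    qed
    have tgi: "tg i \<noteq> 0" "tg i \<noteq> 1" using 4 by auto
    have ev: "claim_eval N tg np pr inp cl (Suc e) i =
       (if cl i < np i then (if ?v inp (cl i) = default_val i then 3 else forcing i)
        else (if \<exists>j<np i. ?v inp j = forcing i then 3 else default_val i))" if "inp \<in> G" for inp
      using eval_large[OF i _ 4, of inp cl e] no3[OF that] by blast
    show ?thesis
    proof (cases "cl i < np i")
      case True
      from cover[OF True] obtain inp' where "inp' \<in> G" "?v inp' (cl i) = bval S (pr i (cl i))" by blast
      with ev[of inp'] not3[of inp'] True have "bval S (pr i (cl i)) \<noteq> default_val i" by auto
      then have "bval S (pr i (cl i)) = forcing i" using bval_cases by blast
      then have "bval S i = forcing i" using bval_gate[OF i 4(1), of S] True by auto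
      moreover have "claim_eval N tg np pr inp cl (Suc e) i = forcing i"
        using ev[OF Suc.prems(2)] not3[OF Suc.prems(2)] True by (auto split: if_splits)
      ultimately show ?thesis by simp
    next
      case False
      \<comment> \<open>A forcing in-neighbour would refute the claim in the view that settles
        it.\<close>
      have "bval S (pr i j) \<noteq> forcing i" if "j < np i" for j
      proof
        assume f: "bval S (pr i j) = forcing i"
        from cover[OF that] obtain inp' where "inp' \<in> G" "?v inp' j = bval S (pr i j)" by blast
        with f that have "\<exists>j<np i. ?v inp' j = forcing i" by auto
        with ev[OF \<open>inp' \<in> G\<close>] not3[OF \<open>inp' \<in> G\<close>] False show False by presburger
      qed
      then have "bval S i = default_val i" using bval_gate[OF i 4(1), of S] by auto
      moreover have "claim_eval N tg np pr inp cl (Suc e) i = default_val i"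
        using ev[OF Suc.prems(2)] not3[OF Suc.prems(2)] False by (auto split: if_splits)
      ultimately show ?thesis by simp
    qed
  qed
qed

end

subsection \<open>Weighted satisfiability as a constraint satisfaction problem\<close>

text \<open>The places \<open>2 * j\<close> and \<open>2 * j + 1\<close> hold a pair of consecutive
  true inputs, shifted by one to make room for the sentinel \<open>0\<close>; whatever lies strictly
  between them is false.\<close>

definition input_view :: "nat \<Rightarrow> (nat \<Rightarrow> nat) \<Rightarrow> nat \<Rightarrow> nat" where
  "input_view r z x = (if \<exists>j<r. z (2 * j) = Suc x then 1
     else if \<exists>j<r. z (2 * j) < Suc x \<and> Suc x < z (2 * j + 1) then 0 else 2)"

text \<open>A lookup table: \<open>r\<close> gates from place \<open>2 * r\<close> on and their
  claims from place \<open>3 * r\<close> on. The default \<open>N\<close> is at least every arity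
  and so means that no in-neighbour is forcing.\<close>

primrec claim :: "nat \<Rightarrow> nat \<Rightarrow> (nat \<Rightarrow> nat) \<Rightarrow> nat \<Rightarrow> nat \<Rightarrow> nat" where
  "claim N r z 0 i = N"
| "claim N r z (Suc l) i = (if z (2 * r + l) = i then z (3 * r + l) else claim N r z l i)"

text \<open>The variables are \<open>0, \<dots>, k + 1\<close> for the true inputs in increasing order (input \<open>x\<close> being
  represented by \<open>x + 1\<close>, with sentinels \<open>0\<close> and \<open>n + 1\<close>), followed by \<open>r\<close> large gates and by \<open>r\<close>
  claims for these gates. Consecutive true inputs determine which inputs between them are false.\<close>

definition constraint :: "nat \<Rightarrow> (nat \<Rightarrow> nat) \<Rightarrow> (nat \<Rightarrow> nat) \<Rightarrow> (nat \<Rightarrow> nat \<Rightarrow> nat) \<Rightarrow> nat \<Rightarrow> nat \<Rightarrow> nat \<Rightarrow> nat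
    \<Rightarrow> (nat \<Rightarrow> nat) \<Rightarrow> (nat \<Rightarrow> nat) \<Rightarrow> bool" where
  "constraint N tg np pr d r n k P z \<longleftrightarrow>
    (\<forall>j<r. P (2 * j + 1) = Suc (P (2 * j)) \<and> P (2 * j) \<le> k) \<and> (\<forall>l<2 * r. P (2 * r + l) = k + 2 + l) \<longrightarrow>
    (\<forall>j<r. z (2 * j) < z (2 * j + 1) \<and> (P (2 * j) = 0 \<longrightarrow> z (2 * j) = 0) \<and>
       (P (2 * j) = k \<longrightarrow> z (2 * j + 1) = Suc n) \<and>
       (P (2 * j) \<noteq> 0 \<longrightarrow> 0 < z (2 * j) \<and> z (2 * j) \<le> n \<and> tg (z (2 * j) - 1) = 0)) \<and>
    claim_eval N tg np pr (input_view r z) (claim N r z r) d (n - 1) \<noteq> 0 \<and>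
    claim_eval N tg np pr (input_view r z) (claim N r z r) d (n - 1) \<noteq> 3"

lemma ex_enumeration:
  assumes "finite A" "card A \<le> r" "A \<subseteq> {..<n}" "0 < n"
  shows "\<exists>h. A \<subseteq> h ` {..<r} \<and> (\<forall>j. h j < (n::nat))"
proof -
  obtain h where h: "bij_betw h {0..<card A} A" using ex_bij_betw_nat_finite[OF assms(1)] by blast
  define h' where "h' j = (if j < card A then h j else 0)" for j
  have "A \<subseteq> h' ` {..<r}"
  proof
    fix x assume "x \<in> A"
    with h have "x \<in> h ` {0..<card A}" by (simp add: bij_betw_def)
    then obtain j where "j < card A" "x = h j" by auto
    with assms(2) show "x \<in> h' ` {..<r}" by (intro image_eqI[of _ _ j]) (auto simp: h'_def)
  qed
  moreover have "h' j < n" for j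
    using h assms(3,4) by (auto simp: h'_def bij_betw_def)
  ultimately show ?thesis by blast
qed

text \<open>The table may list a gate repeatedly, since it comes from an enumeration with
  repetitions; it suffices that all its entries for \<open>i\<close> agree.\<close>

lemma claim_eqI:
  "\<exists>l<m. z (2 * r + l) = i \<Longrightarrow> (\<And>l. l < m \<Longrightarrow> z (2 * r + l) = i \<Longrightarrow> z (3 * r + l) = w) \<Longrightarrow> claim N r z m i = w"
proof (induction m)
  case (Suc m)
  show ?case
  proof (cases "z (2 * r + m) = i")
    case False
    with Suc.prems(1) have "\<exists>l<m. z (2 * r + l) = i" by (auto simp: less_Suc_eq)
    with Suc False show ?thesis by simp
  qed (use Suc.prems(2)[of m] in simp)
qed simp

lemma claim_cong: "(\<And>l. l < m \<Longrightarrow> z (2 * r + l) = z' (2 * r + l) \<and> z (3 * r + l) = z' (3 * r + l)) \<Longrightarrow>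
    claim N r z m i = claim N r z' m i"
  by (induction m) auto

lemma constraint_cong:
  assumes "\<And>j. j < 4 * r \<Longrightarrow> P j = P' j" "\<And>j. j < 4 * r \<Longrightarrow> z j = z' j"
  shows "constraint N tg np pr d r n k P z = constraint N tg np pr d r n k P' z'"
proof -
  have "input_view r z = input_view r z'"
    using assms(2) by (auto simp: input_view_def fun_eq_iff)
  moreover have "claim N r z r = claim N r z' r"
    using assms(2) by (intro ext claim_cong) auto
  moreover have "P (2 * j) = P' (2 * j) \<and> P (2 * j + 1) = P' (2 * j + 1) \<and> z (2 * j) = z' (2 * j) \<and> z (2 * j + 1) = z' (2 * j + 1)"
    if "j < r" for j using that assms by auto
  moreover have "P (2 * r + l) = P' (2 * r + l)" if "l < 2 * r" for l using that assms by auto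
  ultimately show ?thesis unfolding constraint_def by (simp cong: all_cong1 conj_cong imp_cong)
qed

context circuit_view
begin

text \<open>The set \<open>S\<close> is read off the values of the first variables. Every choice of
  \<open>r\<close> pairs is the scope of some constraint, so all views of \<open>r\<close> gaps pass
  the evaluation with the same claims, and \<open>eval_complete\<close> applies.\<close>

lemma csp_complete:
  assumes depth: "depth_ok N np pr d (n - 1)"
    and ok: "\<And>P. (\<forall>j<4 * 2 ^ d. P j < k + 2 + 2 * 2 ^ d) \<Longrightarrow> constraint N tg np pr d (2 ^ d) n k P (\<lambda>j. \<sigma> (P j))"
  shows "\<exists>S. satisfies S C \<and> card S = k"
proof -
  define r where "r = (2::nat) ^ d"
  have r: "0 < r" by (simp add: r_def)
  \<comment> \<open>The scope that looks at the pairs \<open>(g j, g j + 1)\<close> and at all gate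
    and claim variables.\<close>
  define Pg where "Pg g j = (if j < 2 * r then if even j then g (j div 2) else Suc (g (j div 2)) else k + 2 + (j - 2 * r))"
    for g :: "nat \<Rightarrow> nat" and j
  define z where "z g j = \<sigma> (Pg g j)" for g j
  have z: "z g (2 * j) = \<sigma> (g j)" "z g (2 * j + 1) = \<sigma> (Suc (g j))" "Pg g (2 * j) = g j" "Pg g (2 * j + 1) = Suc (g j)"
    if "j < r" for g j
    using that by (auto simp: z_def Pg_def)
  define cl where "cl = claim N r (\<lambda>j. \<sigma> (k + 2 + (j - 2 * r))) r"
  have cl: "claim N r (z g) r = cl" for g
    unfolding cl_def by (intro ext claim_cong) (auto simp: z_def Pg_def)
  have con: "(\<forall>j<r. \<sigma> (g j) < \<sigma> (Suc (g j)) \<and> (g j = 0 \<longrightarrow> \<sigma> (g j) = 0) \<and> (g j = k \<longrightarrow> \<sigma> (Suc (g j)) = Suc n) \<and>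
       (g j \<noteq> 0 \<longrightarrow> 0 < \<sigma> (g j) \<and> \<sigma> (g j) \<le> n \<and> tg (\<sigma> (g j) - 1) = 0)) \<and>
    claim_eval N tg np pr (input_view r (z g)) cl d (n - 1) \<noteq> 0 \<and> claim_eval N tg np pr (input_view r (z g)) cl d (n - 1) \<noteq> 3"
    if g: "\<And>j. g j \<le> k" for g
  proof -
    have "Pg g j < k + 2 + 2 * r" if "j < 4 * r" for j
      using g[of "j div 2"] that by (auto simp: Pg_def)
    then have "constraint N tg np pr d r n k (Pg g) (z g)"
      using ok[of "Pg g"] by (simp add: r_def z_def[abs_def])
    moreover have "(\<forall>j<r. Pg g (2 * j + 1) = Suc (Pg g (2 * j)) \<and> Pg g (2 * j) \<le> k) \<and> (\<forall>l<2 * r. Pg g (2 * r + l) = k + 2 + l)"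
      using g by (auto simp: Pg_def)
    ultimately show ?thesis unfolding constraint_def cl by (auto simp: z simp del: One_nat_def)
  qed
  \<comment> \<open>Repeating one pair at all \<open>r\<close> places yields the conditions on that
    pair, for every pair.\<close>
  have s: "\<sigma> i < \<sigma> (Suc i) \<and> (i = 0 \<longrightarrow> \<sigma> i = 0) \<and> (i = k \<longrightarrow> \<sigma> (Suc i) = Suc n) \<and>
       (i \<noteq> 0 \<longrightarrow> 0 < \<sigma> i \<and> \<sigma> i \<le> n \<and> tg (\<sigma> i - 1) = 0)" if "i \<le> k" for i
    using con[of "\<lambda>_. i", OF that, THEN conjunct1, THEN spec, THEN mp, OF r] .
  have mono: "\<sigma> i < \<sigma> j" if "i < j" "j \<le> Suc k" for i j
    using that
  proof (induction j)
    case (Suc j)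
    then show ?case using s[of j] by (cases "i = j") (auto simp: less_Suc_eq)
  qed simp
  have mono_le: "\<sigma> i \<le> \<sigma> j" if "i \<le> j" "j \<le> Suc k" for i j
    using mono[of i j] that by (cases "i = j") auto
  define S where "S = (\<lambda>i. \<sigma> i - 1) ` {1..k}"
  have S_iff: "x \<in> S \<longleftrightarrow> (\<exists>i\<in>{1..k}. \<sigma> i = Suc x)" for x
  proof
    assume "x \<in> S"
    then obtain i where "i \<in> {1..k}" "x = \<sigma> i - 1" by (auto simp: S_def)
    then show "\<exists>i\<in>{1..k}. \<sigma> i = Suc x" using s[of i] by (intro bexI[of _ i]) auto
  next
    assume "\<exists>i\<in>{1..k}. \<sigma> i = Suc x"
    then obtain i where "i \<in> {1..k}" "\<sigma> i = Suc x" by blast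
    then show "x \<in> S" unfolding S_def by (intro image_eqI[of _ _ i]) auto
  qed
  have "inj_on (\<lambda>i. \<sigma> i - 1) {1..k}"
  proof (rule inj_onI)
    fix i j assume *: "i \<in> {1..k}" "j \<in> {1..k}" "\<sigma> i - 1 = \<sigma> j - 1"
    with s[of i] s[of j] have "\<sigma> i = \<sigma> j" by auto
    with mono[of i j] mono[of j i] * show "i = j" by (cases i j rule: linorder_cases) auto
  qed
  then have card: "card S = k" by (simp add: S_def card_image)
  have inputs: "S \<subseteq> input_nodes C"
    using s by (auto simp: S_def input_nodes_iff) (metis One_nat_def Suc_le_eq Suc_pred less_le_trans not_less_zero)+
  \<comment> \<open>The index of the last true input up to \<open>x\<close>, or \<open>0\<close> for
    the lower sentinel.\<close>
  define gap where "gap x = (GREATEST i. i \<le> k \<and> \<sigma> i \<le> Suc x)" for x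
  have gap: "gap x \<le> k \<and> \<sigma> (gap x) \<le> Suc x" "Suc x < \<sigma> (Suc (gap x))" if "x < n" for x
  proof -
    have ex: "0 \<le> k \<and> \<sigma> 0 \<le> Suc x" using s[of 0] by simp
    show g: "gap x \<le> k \<and> \<sigma> (gap x) \<le> Suc x"
      unfolding gap_def using ex by (rule GreatestI_nat[where P = "\<lambda>i. i \<le> k \<and> \<sigma> i \<le> Suc x" and b = k]) simp
    show "Suc x < \<sigma> (Suc (gap x))"
    proof (cases "gap x = k")
      case True
      with s[of k] that show ?thesis by simp
    next
      case False
      show ?thesis
      proof (rule ccontr)
        assume "\<not> Suc x < \<sigma> (Suc (gap x))"
        with g False have "Suc (gap x) \<le> k \<and> \<sigma> (Suc (gap x)) \<le> Suc x" by auto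
        then have "Suc (gap x) \<le> gap x"
          unfolding gap_def by (rule Greatest_le_nat[where P = "\<lambda>i. i \<le> k \<and> \<sigma> i \<le> Suc x" and b = k]) simp
        then show False by simp
      qed
    qed
  qed
  have view: "input_view r (z g) x = bval S x" if g: "\<And>j. g j \<le> k" and x: "x < n" "tg x = 0" "\<exists>j<r. g j = gap x" for g x
  proof -
    from x(3) obtain j0 where j0: "j0 < r" "g j0 = gap x" by blast
    show ?thesis
    proof (cases "x \<in> S")
      case True
      then obtain i where i: "i \<in> {1..k}" "\<sigma> i = Suc x" by (auto simp: S_iff)
      have "i = gap x"
      proof (cases i "gap x" rule: linorder_cases)
        case less
        with mono[OF less] gap(1)[OF x(1)] i show ?thesis by auto
      next
        case greater
        then have "\<sigma> (Suc (gap x)) \<le> \<sigma> i" using i by (intro mono_le) auto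
        with gap(2)[OF x(1)] i show ?thesis by simp
      qed
      with j0 i have "\<exists>j<r. z g (2 * j) = Suc x" by (intro exI[of _ j0]) (simp add: z)
      then show ?thesis using True x by (simp add: input_view_def bval_input)
    next
      case False
      have "\<sigma> (g j) \<noteq> Suc x" if "j < r" for j
      proof
        assume *: "\<sigma> (g j) = Suc x"
        moreover have "\<sigma> 0 = 0" using s[of 0] by simp
        ultimately have "g j \<noteq> 0" by (metis nat.distinct(1))
        with * g[of j] have "x \<in> S" unfolding S_iff by (intro bexI[of _ "g j"]) auto
        with False show False by blast
      qed
      then have n1: "\<not> (\<exists>j<r. z g (2 * j) = Suc x)" by (auto simp: z)
      have "z g (2 * j0) < Suc x \<and> Suc x < z g (2 * j0 + 1)"
        using gap[OF x(1)] j0 n1 z[OF j0(1), of g] by (metis le_neq_implies_less)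
      with j0 have ex: "\<exists>j<r. z g (2 * j) < Suc x \<and> Suc x < z g (2 * j + 1)" by blast
      show ?thesis unfolding input_view_def if_not_P[OF n1] if_P[OF ex] using False x by (simp add: bval_input)
    qed
  qed
  \<comment> \<open>The views of all choices of \<open>r\<close> pairs. A set of at most
    \<open>2 ^ d = r\<close> inputs meets at most \<open>r\<close> gaps, so one of these views
    settles it.\<close>
  let ?G = "(\<lambda>g. input_view r (z g)) ` {g. \<forall>j. g j \<le> k}"
  have cover: "\<exists>inp\<in>?G. \<forall>x\<in>A. tg x = 0 \<longrightarrow> inp x = bval S x" if A: "finite A" "A \<subseteq> {..<n}" "card A \<le> 2 ^ d" for A
  proof -
    from ex_enumeration[OF A(1) _ A(2) n_pos, of r] A(3) obtain h where h: "A \<subseteq> h ` {..<r}" "\<And>j. h j < n"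
      by (auto simp: r_def)
    define g where "g j = gap (h j)" for j
    have g: "\<And>j. g j \<le> k" using gap(1)[OF h(2)] by (simp add: g_def)
    have "input_view r (z g) x = bval S x" if "x \<in> A" "tg x = 0" for x
    proof (rule view[OF g])
      show "x < n" using that A by auto
      from that h(1) obtain j where "j < r" "x = h j" by auto
      then show "\<exists>j<r. g j = gap x" by (auto simp: g_def)
    qed (use that in auto)
    with g show ?thesis by (intro bexI[of _ "input_view r (z g)"]) auto
  qed
  have not3: "claim_eval N tg np pr inp cl d (n - 1) \<noteq> 3" if "inp \<in> ?G" for inp
    using that con by auto
  have "n - 1 < n" using n_pos by simp
  from cover[OF conjunct1[OF card_supp] supp_subset[OF this] conjunct2[OF card_supp]] obtain inp where
    inp: "inp \<in> ?G" "\<forall>x\<in>supp tg np pr d (n - 1). tg x = 0 \<longrightarrow> inp x = bval S x" by (rule bexE)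
  have "claim_eval N tg np pr inp cl d (n - 1) = bval S (n - 1)"
    by (rule eval_complete[OF depth cover not3 relevant.intros(1) inp])
  moreover have "claim_eval N tg np pr inp cl d (n - 1) \<noteq> 0" using inp(1) con by auto
  ultimately have "node_val C S (n - 1)" by (simp add: bval_def split: if_splits)
  with inputs card show ?thesis by (auto simp: satisfies_def)
qed

lemma csp_sound:
  assumes weft: "weft_ok N np pr d 1 (n - 1)"
    and S: "satisfies S C" "card S = k" and b: "n + 1 < b" "\<And>i. i < n \<Longrightarrow> np i < b"
  shows "\<exists>\<sigma>. (\<forall>c. \<sigma> c < b) \<and> (\<forall>P. constraint N tg np pr d (2 ^ d) n k P (\<lambda>j. \<sigma> (P j)))"
proof -
  define r where "r = (2::nat) ^ d"
  have S_sub: "S \<subseteq> {..<n}" and S_inp: "\<And>x. x \<in> S \<Longrightarrow> tg x = 0"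
    using S(1) by (auto simp: satisfies_def input_nodes_iff subset_iff)
  then have fin: "finite S" using finite_subset by blast
  define xs where "xs = sorted_list_of_set S"
  have xs: "set xs = S" "sorted_wrt (<) xs" "length xs = k"
    using fin S(2) by (auto simp: xs_def)
  have "n - 1 < n" using n_pos by simp
  \<comment> \<open>The guessed nodes are the whole support of the output; table entries for nodes
    that are not large gates are never consulted.\<close>
  from ex_enumeration[OF conjunct1[OF card_supp] conjunct2[OF card_supp] supp_subset[OF this] n_pos]
  obtain h where h: "supp tg np pr d (n - 1) \<subseteq> h ` {..<r}" "\<And>j. h j < n"
    unfolding r_def by blast
  \<comment> \<open>The honest claim: the index of a forcing in-neighbour, or \<open>b - 1\<close>,
    which is at least every arity.\<close>
  define wit where "wit i = (if \<exists>j<np i. bval S (pr i j) = forcing i then (SOME j. j < np i \<and> bval S (pr i j) = forcing i) else b - 1)" for i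
  have wit: "wit i < b \<and> (if wit i < np i then bval S (pr i (wit i)) = forcing i
     else (\<forall>j<np i. bval S (pr i j) \<noteq> forcing i))" if "i < n" for i
  proof (cases "\<exists>j<np i. bval S (pr i j) = forcing i")
    case True
    then have "wit i < np i \<and> bval S (pr i (wit i)) = forcing i"
      unfolding wit_def if_P[OF True] by (rule someI_ex)
    with b(2)[OF that] show ?thesis by auto
  next
    case False
    then have "wit i = b - 1" unfolding wit_def by (rule if_not_P)
    moreover have "\<not> b - 1 < np i" using b(2)[OF that] by simp
    ultimately show ?thesis using False b(1) by auto
  qed
  define \<sigma> where "\<sigma> c = (if c = 0 then 0 else if c \<le> k then Suc (xs ! (c - 1)) else if c = Suc k then Suc n
     else if c < k + 2 + r then h (c - (k + 2)) else wit (h (c - (k + 2 + r))))" for c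
  have xs_lt: "xs ! i < n" "xs ! i \<in> S" if "i < k" for i
    using that xs S_sub nth_mem[of i xs] by auto
  have \<sigma>_less: "\<sigma> c < b" for c
  proof -
    have "Suc (xs ! (c - 1)) < b" if "c \<noteq> 0" "c \<le> k"
    proof -
      have "c - 1 < k" using that by linarith
      from xs_lt(1)[OF this] b(1) show ?thesis by linarith
    qed
    moreover have "h (c - (k + 2)) < b" using h(2)[of "c - (k + 2)"] b(1) by simp
    ultimately show ?thesis using b(1) wit[OF h(2)] by (auto simp: \<sigma>_def)
  qed
  have mono: "\<sigma> i < \<sigma> (Suc i)" if "i \<le> k" for i
    using that xs sorted_wrt_nth_less[OF xs(2), of "i - 1" i] xs_lt[of "i - 1"] by (auto simp: \<sigma>_def)
  have mono': "\<sigma> i < \<sigma> j" if "i < j" "j \<le> Suc k" for i j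
    using that
  proof (induction j)
    case (Suc j)
    then show ?case using mono[of j] by (cases "i = j") (auto simp: less_Suc_eq)
  qed simp
  have S_iff: "x \<in> S \<longleftrightarrow> (\<exists>i\<in>{1..k}. \<sigma> i = Suc x)" for x
  proof
    assume "x \<in> S"
    then obtain i where "i < k" "xs ! i = x" using xs by (metis in_set_conv_nth)
    then show "\<exists>i\<in>{1..k}. \<sigma> i = Suc x" by (intro bexI[of _ "Suc i"]) (auto simp: \<sigma>_def)
  next
    assume "\<exists>i\<in>{1..k}. \<sigma> i = Suc x"
    then obtain i where "i \<in> {1..k}" "\<sigma> i = Suc x" by blast
    then show "x \<in> S" using xs_lt[of "i - 1"] by (auto simp: \<sigma>_def)
  qed
  have "constraint N tg np pr d r n k P (\<lambda>j. \<sigma> (P j))" for P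
    unfolding constraint_def
  proof (intro impI, elim conjE)
    let ?z = "\<lambda>j. \<sigma> (P j)"
    assume P1: "\<forall>j<r. P (2 * j + 1) = Suc (P (2 * j)) \<and> P (2 * j) \<le> k" and P2: "\<forall>l<2 * r. P (2 * r + l) = k + 2 + l"
    have gaps: "?z (2 * j) < ?z (2 * j + 1) \<and> (P (2 * j) = 0 \<longrightarrow> ?z (2 * j) = 0) \<and>
       (P (2 * j) = k \<longrightarrow> ?z (2 * j + 1) = Suc n) \<and>
       (P (2 * j) \<noteq> 0 \<longrightarrow> 0 < ?z (2 * j) \<and> ?z (2 * j) \<le> n \<and> tg (?z (2 * j) - 1) = 0)" if "j < r" for j
    proof -
      define i where "i = P (2 * j)"
      have i: "P (2 * j) = i" "P (2 * j + 1) = Suc i" "i \<le> k" using P1 that by (auto simp: i_def)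
      have "0 < \<sigma> i \<and> \<sigma> i \<le> n \<and> tg (\<sigma> i - 1) = 0" if "i \<noteq> 0"
      proof -
        have "i - 1 < k" "\<sigma> i = Suc (xs ! (i - 1))" using that i(3) by (auto simp: \<sigma>_def)
        with xs_lt[of "i - 1"] S_inp show ?thesis by simp
      qed
      moreover have "i = k \<Longrightarrow> \<sigma> (Suc i) = Suc n" "i = 0 \<Longrightarrow> \<sigma> i = 0" by (simp_all add: \<sigma>_def)
      ultimately show ?thesis using mono[OF i(3)] unfolding i by blast
    qed
    have view: "input_view r ?z x \<in> {2, bval S x}" if x: "x < n" "tg x = 0" for x
    proof (cases "\<exists>j<r. ?z (2 * j) = Suc x")
      case True
      then obtain j where j: "j < r" "\<sigma> (P (2 * j)) = Suc x" by blast
      then have "P (2 * j) \<in> {1..k}" using P1 by (cases "P (2 * j) = 0") (auto simp: \<sigma>_def)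
      with j have "x \<in> S" unfolding S_iff by blast
      then show ?thesis unfolding input_view_def if_P[OF True] using x by (simp add: bval_input)
    next
      case False
      show ?thesis
      proof (cases "\<exists>j<r. ?z (2 * j) < Suc x \<and> Suc x < ?z (2 * j + 1)")
        case True
        then obtain j where j: "j < r" "\<sigma> (P (2 * j)) < Suc x" "Suc x < \<sigma> (Suc (P (2 * j)))" using P1 by auto
        have Pk: "P (2 * j) \<le> k" using P1 j(1) by blast
        have "x \<notin> S"
        proof
          assume "x \<in> S"
          then obtain i where i: "i \<in> {1..k}" "\<sigma> i = Suc x" unfolding S_iff by blast
          have "\<not> i < P (2 * j)" using mono'[of i "P (2 * j)"] Pk i j by auto
          moreover have "i \<noteq> P (2 * j)" using i j by auto
          moreover have "\<not> Suc (P (2 * j)) < i" using mono'[of "Suc (P (2 * j))" i] i j by auto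
          moreover have "i \<noteq> Suc (P (2 * j))" using i j by auto
          ultimately show False by linarith
        qed
        then show ?thesis unfolding input_view_def if_not_P[OF False] if_P[OF True] using x by (simp add: bval_input)
      next
        case no: False
        show ?thesis unfolding input_view_def if_not_P[OF False] if_not_P[OF no] by simp
      qed
    qed
    have claims: "claim_ok S (claim N r ?z r) g" if g: "g \<in> supp tg np pr d (n - 1)" for g
    proof -
      obtain l where l: "l < r" "g = h l" using h(1) g by auto
      have z1: "?z (2 * r + l) = h l" if "l < r" for l using P2 that by (simp add: \<sigma>_def)
      have z2: "?z (3 * r + l) = wit (h l)" if "l < r" for l
        using P2[rule_format, of "r + l"] that by (simp add: \<sigma>_def add.assoc)
      have "claim N r ?z r g = wit g"
        by (rule claim_eqI) (use z1 z2 l in auto)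
      then show ?thesis unfolding claim_ok_def using wit[of g] l(2) h(2)[of l] by metis
    qed
    have "n - 1 < n" using n_pos by simp
    from eval_sound_weft_1[OF weft this view claims]
    have "claim_eval N tg np pr (input_view r ?z) (claim N r ?z r) d (n - 1) \<in> {2, bval S (n - 1)}" by blast
    moreover have "bval S (n - 1) = 1" using S(1) by (simp add: bval_def satisfies_def)
    ultimately have "claim_eval N tg np pr (input_view r ?z) (claim N r ?z r) d (n - 1) \<noteq> 0 \<and>
      claim_eval N tg np pr (input_view r ?z) (claim N r ?z r) d (n - 1) \<noteq> 3" by auto
    with gaps show "(\<forall>j<r. ?z (2 * j) < ?z (2 * j + 1) \<and> (P (2 * j) = 0 \<longrightarrow> ?z (2 * j) = 0) \<and>
       (P (2 * j) = k \<longrightarrow> ?z (2 * j + 1) = Suc n) \<and>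
       (P (2 * j) \<noteq> 0 \<longrightarrow> 0 < ?z (2 * j) \<and> ?z (2 * j) \<le> n \<and> tg (?z (2 * j) - 1) = 0)) \<and>
      claim_eval N tg np pr (input_view r ?z) (claim N r ?z r) d (n - 1) \<noteq> 0 \<and>
      claim_eval N tg np pr (input_view r ?z) (claim N r ?z r) d (n - 1) \<noteq> 3" by blast
  qed
  with \<sigma>_less show ?thesis unfolding r_def by blast
qed

text \<open>There are \<open>k + 2\<close> variables for the true inputs with the two sentinels, and
  \<open>2 ^ d\<close> each for gates and claims. A scope takes \<open>2 ^ d\<close> pairs and all
  gate and claim variables, which makes \<open>4 * 2 ^ d\<close> places.\<close>

theorem weighted_sat_iff_csp:
  assumes "n + 1 < b" "\<And>i. i < n \<Longrightarrow> np i < b" and V: "V = k + 2 + 2 * 2 ^ d" and q: "q = 4 * 2 ^ d"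
  shows "weft_le C 1 \<and> depth_le C d \<and> (\<exists>S. satisfies S C \<and> card S = k) \<longleftrightarrow>
    depth_ok N np pr d (n - 1) \<and> weft_ok N np pr d 1 (n - 1) \<and>
    (\<exists>\<sigma>. (\<forall>c<V. \<sigma> c < b) \<and>
      (\<forall>P. (\<forall>j<q. P j < V) \<longrightarrow> constraint N tg np pr d (2 ^ d) n k P (\<lambda>j. \<sigma> (P j))))"
  (is "?L \<longleftrightarrow> ?R")
proof
  assume ?L
  then have "depth_ok N np pr d (n - 1)" "weft_ok N np pr d 1 (n - 1)" using depth_le_iff weft_le_iff by auto
  moreover obtain S where "satisfies S C" "card S = k" using \<open>?L\<close> by blast
  ultimately show ?R using csp_sound[of d S k b] assms(1,2) by blast
next
  assume ?R
  then obtain \<sigma> where "\<forall>P. (\<forall>j<q. P j < V) \<longrightarrow> constraint N tg np pr d (2 ^ d) n k P (\<lambda>j. \<sigma> (P j))" by blast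
  then have "\<exists>S. satisfies S C \<and> card S = k"
    using csp_complete[of d k \<sigma>] \<open>?R\<close> unfolding V q by blast
  with \<open>?R\<close> show ?L using depth_le_iff weft_le_iff by auto
qed

end

section \<open>Parsing circuits\<close>

definition gate_length :: "(nat \<Rightarrow> nat) \<Rightarrow> nat \<Rightarrow> nat" where
  "gate_length X p = (if X p = 0 then 1 else if X p = 1 then 2 else 2 + X (p + 1))"

text \<open>The input word is \<open>k # length C # \<dots>\<close>, so the first gate starts at position \<open>2\<close>.\<close>

primrec offset :: "(nat \<Rightarrow> nat) \<Rightarrow> nat \<Rightarrow> nat" where
  "offset X 0 = 2"
| "offset X (Suc i) = offset X i + gate_length X (offset X i)"

definition node_tag :: "(nat \<Rightarrow> nat) \<Rightarrow> (nat \<Rightarrow> nat) \<Rightarrow> nat \<Rightarrow> nat" where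
  "node_tag X Q i = X (Q i)"

definition node_arity :: "(nat \<Rightarrow> nat) \<Rightarrow> (nat \<Rightarrow> nat) \<Rightarrow> nat \<Rightarrow> nat" where
  "node_arity X Q i = (if X (Q i) = 0 then 0 else if X (Q i) = 1 then 1 else X (Q i + 1))"

definition node_pred :: "(nat \<Rightarrow> nat) \<Rightarrow> (nat \<Rightarrow> nat) \<Rightarrow> nat \<Rightarrow> nat \<Rightarrow> nat" where
  "node_pred X Q i j = (if X (Q i) = 1 then X (Q i + 1) else X (Q i + 2 + j))"

text \<open>\<open>Q (X 1) = len\<close> says that parsing stops exactly at the end of the word. As
  offsets increase, every gate then lies inside the word, and the zeros read beyond it cannot pass
  for gates.\<close>

definition syntax_ok :: "nat \<Rightarrow> nat \<Rightarrow> (nat \<Rightarrow> nat) \<Rightarrow> (nat \<Rightarrow> nat) \<Rightarrow> bool" where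
  "syntax_ok N len X Q \<longleftrightarrow> 0 < X 1 \<and> X 1 < N \<and> Q (X 1) = len \<and>
    (\<forall>i<N. i < X 1 \<longrightarrow> node_tag X Q i \<le> 3 \<and> (2 \<le> node_tag X Q i \<longrightarrow> 2 \<le> node_arity X Q i) \<and>
      (\<forall>j<N. j < node_arity X Q i \<longrightarrow> node_pred X Q i j < i \<and>
        (\<forall>l<N. l < j \<longrightarrow> node_pred X Q i l \<noteq> node_pred X Q i j)))"

locale parse =
  fixes k :: nat and x :: "nat list" and N :: nat and Q :: "nat \<Rightarrow> nat" and X :: "nat \<Rightarrow> nat"
  assumes X: "X = init (k # x) 0" and len: "length (k # x) \<le> N" and Q: "\<And>i. i < N \<Longrightarrow> Q i = offset X i"
begin

lemma X_nth: "p < length (k # x) \<Longrightarrow> X p = (k # x) ! p"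
  by (simp add: X init_def)

lemma X_drop:
  assumes "p \<le> length (k # x)" "drop p (k # x) = ys" "t < length ys"
  shows "X (p + t) = ys ! t"
proof -
  have "p + t < length (k # x)" using assms by (auto simp del: length_Cons)
  with X_nth[OF this] assms show ?thesis by (metis nth_drop)
qed

lemma offset_encode:
  assumes "x = encode_circuit C" "i \<le> length C" "is_circuit C"
  shows "offset X i \<le> length (k # x) \<and> drop (offset X i) (k # x) = concat (map encode_gate (drop i C))"
  using assms(2)
proof (induction i)
  case 0
  show ?case by (simp add: assms(1) encode_circuit_def)
next
  case (Suc i)
  let ?p = "offset X i" and ?g = "encode_gate (C ! i)" and ?r = "concat (map encode_gate (drop (Suc i) C))"
  have IH: "?p \<le> length (k # x)" "drop ?p (k # x) = ?g @ ?r"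
    using Suc by (auto simp: Cons_nth_drop_Suc[symmetric])
  have Xp: "X (?p + t) = ?g ! t" if "t < length ?g" for t
    using X_drop[OF IH, of t] that by (simp add: nth_append)
  have "gate_length X ?p = length ?g"
    using Xp[of 0] Xp[of 1] by (cases "C ! i") (auto simp: gate_length_def)
  then have off: "offset X (Suc i) = ?p + length ?g" by simp
  have "drop (?p + length ?g) (k # x) = drop (length ?g) (?g @ ?r)"
    by (simp only: IH(2)[symmetric] drop_drop add.commute)
  moreover have "?p + length ?g \<le> length (k # x)"
    using arg_cong[OF IH(2), of length] IH(1) by (simp del: length_Cons)
  ultimately show ?case unfolding off by simp
qed

lemma encode_view:
  assumes "x = encode_circuit C" "is_circuit C"
  shows "X 1 = length C" "syntax_ok N (length (k # x)) X Q"
    "circuit_view C (node_tag X Q) (node_arity X Q) (node_pred X Q) N"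
    "\<And>i. i < length C \<Longrightarrow> node_arity X Q i < length (k # x)" "length C + 1 < length (k # x)"
proof -
  show X1: "X 1 = length C" using X_nth[of 1] assms(1) by (simp add: encode_circuit_def)
  have gate_pos: "1 \<le> length (encode_gate g)" for g by (cases g) auto
  have "length C \<le> length (concat (map encode_gate C))"
  proof (induction C)
    case (Cons g C)
    then show ?case using gate_pos[of g] by simp
  qed simp
  then show n_less: "length C + 1 < length (k # x)" using assms(1) by (simp add: encode_circuit_def)
  have Xg: "X (Q i + t) = encode_gate (C ! i) ! t" if "i < length C" "t < length (encode_gate (C ! i))" for i t
  proof -
    have "Q i = offset X i" using Q that(1) n_less len by simp
    moreover have "drop i C = C ! i # drop (Suc i) C" using that(1) by (simp add: Cons_nth_drop_Suc)
    ultimately show ?thesis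
      using offset_encode[OF assms(1) less_imp_le[OF that(1)] assms(2)] X_drop[of "offset X i" _ t] that(2)
      by (simp add: nth_append)
  qed
  have tg: "node_tag X Q i = tag (C ! i)" if "i < length C" for i
    using Xg[OF that, of 0] by (cases "C ! i") (auto simp: node_tag_def)
  have np: "node_arity X Q i = length (preds (C ! i))" if "i < length C" for i
    using Xg[OF that, of 0] Xg[OF that, of 1] by (cases "C ! i") (auto simp: node_arity_def)
  have pr: "node_pred X Q i j = preds (C ! i) ! j" if "i < length C" "j < length (preds (C ! i))" for i j
    using Xg[OF that(1), of 0] Xg[OF that(1), of 1] Xg[OF that(1), of "j + 2"] that(2)
    by (cases "C ! i") (auto simp: node_pred_def add.assoc)
  have np_less: "length (preds (C ! i)) < length (k # x)" if "i < length C" for i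
  proof -
    have "length (preds g) \<le> length (encode_gate g)" for g by (cases g) auto
    also have "length (encode_gate (C ! i)) \<le> length (concat (map encode_gate C))"
      using that by (simp add: length_concat member_le_sum_list comp_def)
    finally show ?thesis using assms(1) by (simp add: encode_circuit_def)
  qed
  then show "\<And>i. i < length C \<Longrightarrow> node_arity X Q i < length (k # x)" by (simp add: np)
  have circ: "distinct (preds (C ! i)) \<and> (\<forall>j \<in> set (preds (C ! i)). j < i) \<and>
        (\<forall>js. C ! i = And js \<or> C ! i = Or js \<longrightarrow> length js \<ge> 2)" if "i < length C" for i
    using assms(2) that by (simp add: is_circuit_def)
  show "circuit_view C (node_tag X Q) (node_arity X Q) (node_pred X Q) N"
    using assms(2) tg np pr order_trans[OF less_imp_le[OF np_less] len] by unfold_locales auto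
  have QC: "Q (length C) = length (k # x)"
  proof -
    have "Q (length C) = offset X (length C)" using Q n_less len by simp
    then show ?thesis using offset_encode[OF assms(1) order_refl assms(2)] by simp
  qed
  show "syntax_ok N (length (k # x)) X Q"
    unfolding syntax_ok_def X1
  proof (intro conjI allI impI)
    show "0 < length C" using assms(2) by (simp add: is_circuit_def)
    show "length C < N" using n_less len by simp
    show "Q (length C) = length (k # x)" by (rule QC)
    fix i assume i: "i < length C"
    show "node_tag X Q i \<le> 3" unfolding tg[OF i] by (cases "C ! i") auto
    show "2 \<le> node_arity X Q i" if "2 \<le> node_tag X Q i"
      using that circ[OF i] unfolding tg[OF i] np[OF i] by (cases "C ! i") auto
    fix j assume "j < node_arity X Q i"
    then have j: "j < length (preds (C ! i))" by (simp add: np[OF i])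
    show "node_pred X Q i j < i" using circ[OF i] j by (simp add: pr[OF i])
    fix l assume "l < j"
    then show "node_pred X Q i l \<noteq> node_pred X Q i j"
      using circ[OF i] j by (simp add: pr[OF i] nth_eq_iff_index_eq)
  qed
qed

text \<open>The reduction has to be correct on every word, so passing the test must guarantee an
  actual circuit. It is rebuilt gate by gate, and re-encoding it reproduces the word.\<close>

lemma syntax_ok_encode:
  assumes "syntax_ok N (length (k # x)) X Q"
  shows "\<exists>C. x = encode_circuit C \<and> is_circuit C"
proof -
  define n where "n = X 1"
  define gate_at where "gate_at i = (if node_tag X Q i = 0 then Input else if node_tag X Q i = 1 then Neg (node_pred X Q i 0)
     else if node_tag X Q i = 2 then And (map (node_pred X Q i) [0..<node_arity X Q i])
     else Or (map (node_pred X Q i) [0..<node_arity X Q i]))" for i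
  define C where "C = map gate_at [0..<n]"
  have n: "0 < n" "n < N" "Q n = length (k # x)"
    and ok: "\<And>i. i < n \<Longrightarrow> node_tag X Q i \<le> 3 \<and> (2 \<le> node_tag X Q i \<longrightarrow> 2 \<le> node_arity X Q i)"
    and ok2: "\<And>i j. i < n \<Longrightarrow> j < N \<Longrightarrow> j < node_arity X Q i \<Longrightarrow> node_pred X Q i j < i \<and>
        (\<forall>l<j. node_pred X Q i l \<noteq> node_pred X Q i j)"
    using assms unfolding syntax_ok_def n_def by (auto dest: less_trans)
  have off_n: "offset X n = length (k # x)" using Q[of n] n by simp
  have mono: "offset X i \<le> offset X j" if "i \<le> j" for i j
    using that by (induction rule: dec_induct) auto
  have Qi: "Q i = offset X i" if "i \<le> n" for i using Q[of i] that n by simp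
  have sub: "take m (drop p (k # x)) = map (\<lambda>t. X (p + t)) [0..<m]" if "p + m \<le> length (k # x)" for m p
    using that by (intro nth_equalityI) (auto simp: X_nth simp del: length_Cons)
  have upt2: "map f [0..<2 + m] = f 0 # f 1 # map (\<lambda>j. f (2 + j)) [0..<m]" for f :: "nat \<Rightarrow> nat" and m
  proof -
    have "[0..<2 + m] = 0 # 1 # [2..<m + 2]"
      by (simp add: upt_conv_Cons numeral_2_eq_2)
    moreover have "map f [2..<m + 2] = map (\<lambda>j. f (2 + j)) [0..<m]"
      unfolding map_add_upt[symmetric] by (simp add: comp_def add.commute)
    ultimately show ?thesis by simp
  qed
  have enc: "encode_gate (gate_at i) = map (\<lambda>t. X (offset X i + t)) [0..<gate_length X (offset X i)]" if i: "i < n" for i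
  proof -
    let ?p = "offset X i"
    have tag: "node_tag X Q i = X ?p" using Qi[of i] i by (simp add: node_tag_def)
    consider "X ?p = 0" | "X ?p = 1" | "X ?p = 2 \<or> X ?p = 3"
      using ok[OF i] unfolding tag by linarith
    then show ?thesis
    proof cases
      case 1
      then show ?thesis by (simp add: gate_at_def tag gate_length_def)
    next
      case 2
      then show ?thesis using upt2[of _ 0] Qi[of i] i by (simp add: gate_at_def tag gate_length_def node_pred_def)
    next
      case 3
      then have "gate_length X ?p = 2 + X (?p + 1)" by (auto simp: gate_length_def)
      then have "map (\<lambda>t. X (?p + t)) [0..<gate_length X ?p] = X ?p # X (?p + 1) # map (\<lambda>j. X (?p + (2 + j))) [0..<X (?p + 1)]"
        by (simp only: upt2 add_0_right)
      then show ?thesis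
        using 3 Qi[of i] i by (auto simp: gate_at_def tag node_pred_def node_arity_def add.assoc)
    qed
  qed
  have pre: "i \<le> n \<Longrightarrow> take (offset X i) (k # x) = k # n # concat (map encode_gate (take i C))" for i
  proof (induction i)
    case 0
    have "2 \<le> length (k # x)" using mono[of 0 n] off_n by simp
    then obtain y ys where "x = y # ys" by (cases x) auto
    then show ?case using X_nth[of 1] by (simp add: n_def numeral_2_eq_2)
  next
    case (Suc i)
    let ?p = "offset X i" and ?m = "gate_length X (offset X i)"
    have le: "?p + ?m \<le> length (k # x)" using mono[of "Suc i" n] off_n Suc.prems by simp
    have i: "i < n" using Suc.prems by simp
    have "take (offset X (Suc i)) (k # x) = take ?p (k # x) @ take ?m (drop ?p (k # x))"
      by (simp only: offset.simps take_add)
    also have "\<dots> = (k # n # concat (map encode_gate (take i C))) @ encode_gate (gate_at i)"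
      using Suc by (simp only: sub[OF le] enc[OF i])
    also have "\<dots> = k # n # concat (map encode_gate (take (Suc i) C))"
      using i by (simp add: take_Suc_conv_app_nth C_def)
    finally show ?case .
  qed
  have "k # x = k # n # concat (map encode_gate C)"
    using pre[of n] off_n by (simp add: C_def)
  then have x: "x = encode_circuit C" by (simp add: encode_circuit_def C_def)
  \<comment> \<open>The test inspects in-neighbours with index below \<open>N\<close> only; these
    are all, because the gate fits into the word.\<close>
  have arity: "node_arity X Q i < N" if i: "i < n" for i
  proof -
    have "offset X (Suc i) \<le> length (k # x)" using mono[of "Suc i" n] off_n i by simp
    moreover have "node_arity X Q i < offset X (Suc i)"
      using Qi[of i] i mono[of 0 i] by (auto simp: node_arity_def gate_length_def)
    ultimately show ?thesis using len by linarith
  qed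
  have "is_circuit C"
    unfolding is_circuit_def
  proof (intro conjI allI impI)
    show "C \<noteq> []" using n by (simp add: C_def)
    fix i assume "i < length C"
    then have i: "i < n" and Ci: "C ! i = gate_at i" by (auto simp: C_def)
    have pd: "node_pred X Q i j < i" "\<forall>l<j. node_pred X Q i l \<noteq> node_pred X Q i j" if "j < node_arity X Q i" for j
      using ok2[OF i _ that] arity[OF i] that by auto
    have dist: "distinct (map (node_pred X Q i) [0..<node_arity X Q i])"
      unfolding distinct_conv_nth using pd(2) by (auto) (metis linorder_neqE_nat)
    have ar1: "node_arity X Q i = 1" if "node_tag X Q i = 1" using that by (simp add: node_arity_def node_tag_def)
    show "distinct (preds (C ! i))" using dist unfolding Ci gate_at_def by auto
    show "\<forall>j\<in>set (preds (C ! i)). j < i" using pd(1) ar1 unfolding Ci gate_at_def by auto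
    fix js assume "C ! i = And js \<or> C ! i = Or js"
    then show "2 \<le> length js" using ok[OF i] unfolding Ci gate_at_def by (auto split: if_splits)
  qed
  with x show ?thesis by blast
qed

end

section \<open>The reduction\<close>

text \<open>Ranges such as \<open>r\<close> and \<open>q\<close> are constants of the program rather
  than contents of a cell, so these quantifiers are unrolled.\<close>

lemma definable_bool_all_const: "(\<And>j. definable_bool (\<lambda>m \<rho>. P j m \<rho>)) \<Longrightarrow> definable_bool (\<lambda>m \<rho>. \<forall>j<(c::nat). P j m \<rho>)"
proof (induction c)
  case 0
  show ?case using definable_bool_True by simp
next
  case (Suc c)
  have "definable_bool (\<lambda>m \<rho>. (\<forall>j<c. P j m \<rho>) \<and> P c m \<rho>)" using Suc by (intro definable_bool_conj) auto
  then show ?case by (rule definable_bool_eqI) (auto simp: less_Suc_eq)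
qed

lemma definable_bool_ex_const: "(\<And>j. definable_bool (\<lambda>m \<rho>. P j m \<rho>)) \<Longrightarrow> definable_bool (\<lambda>m \<rho>. \<exists>j<(c::nat). P j m \<rho>)"
  by (rule definable_bool_eqI[OF definable_bool_not[OF definable_bool_all_const[OF definable_bool_not]]]) auto

lemma definable_sum_const: "(\<And>j. definable (\<lambda>m \<rho>. F j m \<rho>)) \<Longrightarrow> definable (\<lambda>m \<rho>. \<Sum>j<(c::nat). F j m \<rho>)"
  by (induction c) (auto intro: definable_const definable_add)

lemmas definable_rules = definable_intros definable_bool_all_const definable_bool_ex_const definable_sum_const

text \<open>A power written as nested sums over the loop range, which is the form in which it is
  definable without multiplication.\<close>

primrec bound_power :: "nat \<Rightarrow> nat \<Rightarrow> nat" where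
  "bound_power N 0 = 1"
| "bound_power N (Suc j) = (\<Sum>v<N. bound_power N j)"

lemma bound_power_eq: "bound_power N j = N ^ j"
  by (induction j) auto

lemma definable_bound_power: "definable (\<lambda>m \<rho>. bound_power (m 1 0) j)"
proof (induction j)
  case 0
  show ?case unfolding bound_power.simps by (rule definable_const)
next
  case (Suc j)
  then show ?case unfolding bound_power.simps by (rule definable_sum)
qed

text \<open>What \<open>definable_div\<close> and \<open>definable_mult\<close> provide. The
  truncation has no effect on arguments up to \<open>N\<close>.\<close>

definition tdiv :: "nat \<Rightarrow> nat \<Rightarrow> nat \<Rightarrow> nat" where
  "tdiv N x y = min N (x div y)"

definition tmod :: "nat \<Rightarrow> nat \<Rightarrow> nat \<Rightarrow> nat" where
  "tmod N x y = x - min N (tdiv N x y) * y"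

primrec tdigit :: "nat \<Rightarrow> nat \<Rightarrow> nat \<Rightarrow> nat \<Rightarrow> nat" where
  "tdigit N b 0 e = tmod N e b"
| "tdigit N b (Suc j) e = tdigit N b j (tdiv N e b)"

lemma tdiv_eq: "x \<le> N \<Longrightarrow> tdiv N x y = x div y"
  by (metis div_le_dividend le_trans min.absorb2 tdiv_def)

lemma tmod_eq: "x \<le> N \<Longrightarrow> tmod N x y = x mod y"
proof -
  assume "x \<le> N"
  moreover from this have "x div y \<le> N" using div_le_dividend order_trans by blast
  ultimately have "tdiv N x y = x div y" "x div y \<le> N" using tdiv_eq by blast+
  then show ?thesis by (simp add: tmod_def minus_div_mult_eq_mod)
qed

lemma tdigit_eq: "e \<le> N \<Longrightarrow> tdigit N b j e = digit b j e"
proof (induction j arbitrary: e)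
  case (Suc j)
  have "e div b \<le> N" using Suc.prems div_le_dividend[of e b] by linarith
  with Suc show ?case by (simp add: tdiv_eq digit_Suc)
qed (simp add: tmod_eq digit_0)

lemma definable_tdiv: "definable X \<Longrightarrow> definable Y \<Longrightarrow> definable (\<lambda>m \<rho>. tdiv (m 1 0) (X m \<rho>) (Y m \<rho>))"
  unfolding tdiv_def by (rule definable_div)

lemma definable_tmod: "definable X \<Longrightarrow> definable Y \<Longrightarrow> definable (\<lambda>m \<rho>. tmod (m 1 0) (X m \<rho>) (Y m \<rho>))"
  unfolding tmod_def by (rule definable_sub definable_mult definable_tdiv | assumption)+

lemma definable_tdigit: "definable X \<Longrightarrow> definable (\<lambda>m \<rho>. tdigit (m 1 0) (m 3 0) j (X m \<rho>))"
proof (induction j arbitrary: X)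
  case 0
  then show ?case unfolding tdigit.simps by (rule definable_tmod) (rule definable_get definable_const)+
next
  case (Suc j)
  then show ?case unfolding tdigit.simps by (intro Suc.IH definable_tdiv) (rule definable_get definable_const | assumption)+
qed

text \<open>Memory layout: array \<open>0\<close> the input, \<open>1\<close> the loop bound, \<open>2\<close> the input length, \<open>3\<close> the base \<open>b\<close>,
  \<open>4\<close> \<open>b ^ q\<close>, \<open>5\<close> \<open>b ^ (2 * q)\<close>, \<open>6\<close> the gate offsets, \<open>7\<close> the powers of the loop bound, \<open>8\<close> the target,
  \<open>9\<close> the item numbers, \<open>10\<close> the number of scopes, \<open>11\<close> the constant \<open>D\<close> of the stars.\<close>

abbreviation "mem_tag m \<equiv> node_tag (m (0::nat)) (m 6)"
abbreviation "mem_arity m \<equiv> node_arity (m (0::nat)) (m 6)"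
abbreviation "mem_pred m \<equiv> node_pred (m (0::nat)) (m 6)"

lemma definable_mem_tag: "definable X \<Longrightarrow> definable (\<lambda>m \<rho>. mem_tag m (X m \<rho>))"
  unfolding node_tag_def by (rule definable_rules | assumption)+

lemma definable_mem_arity: "definable X \<Longrightarrow> definable (\<lambda>m \<rho>. mem_arity m (X m \<rho>))"
  unfolding node_arity_def by (rule definable_rules | assumption)+

lemma definable_mem_pred: "definable X \<Longrightarrow> definable Y \<Longrightarrow> definable (\<lambda>m \<rho>. mem_pred m (X m \<rho>) (Y m \<rho>))"
  unfolding node_pred_def by (rule definable_rules | assumption)+

lemmas definable_node = definable_mem_tag definable_mem_arity definable_mem_pred

lemma definable_syntax_ok: "definable_bool (\<lambda>m \<rho>. syntax_ok (m 1 0) (m 2 0) (m 0) (m 6))"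
  unfolding syntax_ok_def by (rule definable_rules definable_node | assumption | rule definable_tail)+

lemma definable_depth_ok:
  "definable X \<Longrightarrow> definable_bool (\<lambda>m \<rho>. depth_ok (m 1 0) (mem_arity m) (mem_pred m) e (X m \<rho>))"
proof (induction e arbitrary: X)
  case 0
  show ?case unfolding depth_ok.simps by (rule definable_rules definable_node | rule 0)+
next
  case (Suc e)
  show ?case unfolding depth_ok.simps
    by (rule definable_rules definable_node Suc.IH | rule definable_tail Suc.prems)+
qed

lemma definable_weft_ok:
  "definable X \<Longrightarrow> definable_bool (\<lambda>m \<rho>. weft_ok (m 1 0) (mem_arity m) (mem_pred m) e t (X m \<rho>))"
proof (induction e arbitrary: X t)
  case 0
  show ?case unfolding weft_ok.simps by (rule definable_rules)
next
  case (Suc e)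
  \<comment> \<open>A conditional between truth values is split into two implications, for which
    closure rules exist.\<close>
  have "definable_bool (\<lambda>m \<rho>. (2 < mem_arity m (X m \<rho>) \<longrightarrow> 0 < t \<and> (\<forall>j<m 1 0. j < mem_arity m (X m \<rho>) \<longrightarrow>
        weft_ok (m 1 0) (mem_arity m) (mem_pred m) e (t - 1) (mem_pred m (X m \<rho>) j))) \<and>
      (\<not> 2 < mem_arity m (X m \<rho>) \<longrightarrow> (\<forall>j<m 1 0. j < mem_arity m (X m \<rho>) \<longrightarrow>
        weft_ok (m 1 0) (mem_arity m) (mem_pred m) e t (mem_pred m (X m \<rho>) j))))"
    by (rule definable_rules definable_node Suc.IH | rule definable_tail Suc.prems)+
  then show ?case by (rule definable_bool_eqI) simp
qed

abbreviation "mem_digits m e \<equiv> (\<lambda>j. tdigit (m (1::nat) (0::nat)) (m 3 0) j e)"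

lemma definable_input_view:
  "definable Z \<Longrightarrow> definable X \<Longrightarrow> definable (\<lambda>m \<rho>. input_view r (mem_digits m (Z m \<rho>)) (X m \<rho>))"
  unfolding input_view_def by (rule definable_rules definable_tdigit | assumption)+

lemma definable_claim:
  "definable Z \<Longrightarrow> definable X \<Longrightarrow> definable (\<lambda>m \<rho>. claim (m 1 0) r (mem_digits m (Z m \<rho>)) l (X m \<rho>))"
proof (induction l)
  case 0
  show ?case unfolding claim.simps by (rule definable_rules)+
next
  case (Suc l)
  show ?case unfolding claim.simps by (rule definable_rules definable_tdigit Suc.IH | rule Suc.prems)+
qed

lemma definable_eval:
  "definable Z \<Longrightarrow> definable X \<Longrightarrow> definable (\<lambda>m \<rho>. claim_eval (m 1 0) (mem_tag m) (mem_arity m) (mem_pred m)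
     (input_view r (mem_digits m (Z m \<rho>))) (claim (m 1 0) r (mem_digits m (Z m \<rho>)) r) e (X m \<rho>))"
proof (induction e arbitrary: Z X)
  case 0
  show ?case unfolding claim_eval.simps
    by (rule definable_rules definable_node definable_input_view | rule 0)+
next
  case (Suc e)
  show ?case unfolding claim_eval.simps
    by (rule definable_rules definable_node definable_input_view definable_claim Suc.IH
        | rule Suc.prems | rule definable_tail)+
qed

lemma definable_constraint:
  "definable P \<Longrightarrow> definable Z \<Longrightarrow> definable_bool (\<lambda>m \<rho>. constraint (m 1 0) (mem_tag m) (mem_arity m) (mem_pred m)
     d r (m 0 1) (m 0 0) (mem_digits m (P m \<rho>)) (mem_digits m (Z m \<rho>)))"
  unfolding constraint_def
  by (rule definable_rules definable_node definable_tdigit definable_eval | assumption)+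

section \<open>Items and target in terms of the memory\<close>

definition mem_scope :: "nat \<Rightarrow> nat \<Rightarrow> memory \<Rightarrow> nat \<Rightarrow> bool" where
  "mem_scope q c m p \<longleftrightarrow> (\<forall>j<q. tdigit (m 1 0) (m 3 0) j p < m 0 0 + c)"

definition mem_allowed :: "nat \<Rightarrow> nat \<Rightarrow> memory \<Rightarrow> nat \<Rightarrow> nat \<Rightarrow> bool" where
  "mem_allowed d r m p z \<longleftrightarrow> syntax_ok (m 1 0) (m 2 0) (m 0) (m 6) \<and>
     depth_ok (m 1 0) (mem_arity m) (mem_pred m) d (m 0 1 - 1) \<and>
     weft_ok (m 1 0) (mem_arity m) (mem_pred m) d 1 (m 0 1 - 1) \<and>
     constraint (m 1 0) (mem_tag m) (mem_arity m) (mem_pred m) d r (m 0 1) (m 0 0) (mem_digits m p) (mem_digits m z)"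

definition mem_item_entry :: "nat \<Rightarrow> nat \<Rightarrow> memory \<Rightarrow> nat \<Rightarrow> nat \<Rightarrow> nat" where
  "mem_item_entry q c m e i =
    (if i < m 4 0 then (if i = tmod (m 1 0) e (m 4 0) then 1 else 0)
     else (\<Sum>j<q. if tdiv (m 1 0) i (m 4 0) = Suc j \<and> mem_scope q c m (tmod (m 1 0) i (m 4 0))
       then (if tmod (m 1 0) i (m 4 0) = tmod (m 1 0) e (m 4 0)
             then tdigit (m 1 0) (m 3 0) j (tdiv (m 1 0) e (m 4 0)) else 0) +
         (if \<forall>l<q. tdigit (m 1 0) (m 3 0) l (tmod (m 1 0) e (m 4 0)) = tdigit (m 1 0) (m 3 0) j (tmod (m 1 0) i (m 4 0))
          then m 3 0 - tdigit (m 1 0) (m 3 0) 0 (tdiv (m 1 0) e (m 4 0)) else 0)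
       else 0))"

definition mem_target_entry :: "nat \<Rightarrow> nat \<Rightarrow> memory \<Rightarrow> nat \<Rightarrow> nat" where
  "mem_target_entry q c m i =
    (if i < m 4 0 then (if mem_scope q c m i then 1 else 0)
     else (\<Sum>j<q. if tdiv (m 1 0) i (m 4 0) = Suc j \<and> mem_scope q c m (tmod (m 1 0) i (m 4 0)) then m 3 0 else 0))"

text \<open>The \<open>min\<close> is the truncation of \<open>definable_mult\<close>; it changes
  nothing, as entries are at most \<open>2 * b \<le> N\<close>.\<close>

definition mem_target :: "nat \<Rightarrow> nat \<Rightarrow> memory \<Rightarrow> nat" where
  "mem_target q c m = (\<Sum>i<m 1 0. min (m 1 0) (mem_target_entry q c m i) * m 7 i)"

definition mem_item :: "nat \<Rightarrow> nat \<Rightarrow> nat \<Rightarrow> nat \<Rightarrow> memory \<Rightarrow> nat \<Rightarrow> nat" where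
  "mem_item d r q c m e =
    (if mem_scope q c m (tmod (m 1 0) e (m 4 0)) \<and>
        mem_allowed d r m (tmod (m 1 0) e (m 4 0)) (tdiv (m 1 0) e (m 4 0))
     then \<Sum>i<m 1 0. min (m 1 0) (mem_item_entry q c m e i) * m 7 i else Suc (m 8 0))"

lemma definable_mem_scope: "definable X \<Longrightarrow> definable_bool (\<lambda>m \<rho>. mem_scope q c m (X m \<rho>))"
  unfolding mem_scope_def by (rule definable_rules definable_tdigit | assumption)+

lemma definable_mem_allowed:
  "definable P \<Longrightarrow> definable Z \<Longrightarrow> definable_bool (\<lambda>m \<rho>. mem_allowed d r m (P m \<rho>) (Z m \<rho>))"
  unfolding mem_allowed_def
  by (rule definable_bool_conj definable_syntax_ok definable_depth_ok definable_weft_ok definable_constraint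
      definable_sub definable_get definable_const | assumption)+

lemma definable_mem_item_entry:
  "definable X \<Longrightarrow> definable Y \<Longrightarrow> definable (\<lambda>m \<rho>. mem_item_entry q c m (X m \<rho>) (Y m \<rho>))"
  unfolding mem_item_entry_def
  by (rule definable_rules definable_tdigit definable_tdiv definable_tmod definable_mem_scope | assumption)+

lemma definable_mem_target_entry: "definable X \<Longrightarrow> definable (\<lambda>m \<rho>. mem_target_entry q c m (X m \<rho>))"
  unfolding mem_target_entry_def
  by (rule definable_rules definable_tdigit definable_tdiv definable_tmod definable_mem_scope | assumption)+

lemma definable_mem_target: "definable (\<lambda>m \<rho>. mem_target q c m)"
  unfolding mem_target_def by (rule definable_rules definable_mem_target_entry | assumption)+

lemma definable_mem_item: "definable X \<Longrightarrow> definable (\<lambda>m \<rho>. mem_item d r q c m (X m \<rho>))"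
  unfolding mem_item_def
  by (rule definable_rules definable_tdiv definable_tmod definable_mem_scope definable_mem_allowed
      definable_mem_item_entry | assumption | rule definable_tail)+

text \<open>Course-of-values recursion: entry \<open>i\<close> has to be right for every content
  \<open>h\<close> of the array that is right below \<open>i\<close>.\<close>

lemma fill_array_eq:
  assumes "a \<noteq> 1" and "\<And>i h. i < m 1 0 \<Longrightarrow> (\<And>j. j < i \<Longrightarrow> h j = g j) \<Longrightarrow>
    f (m(a := h)) (case_nat i (\<lambda>_. m 1 0)) = g i"
  shows "fill_array a f m = m(a := (\<lambda>i. if i < m 1 0 then g i else m a i))"
proof -
  have "n \<le> m 1 0 \<Longrightarrow> fold (fill_cell a f) [0..<n] m = m(a := (\<lambda>i. if i < n then g i else m a i))" for n
  proof (induction n)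
    case (Suc n)
    let ?h = "\<lambda>i. if i < n then g i else m a i"
    have "f (m(a := ?h)) (case_nat n (\<lambda>_. m 1 0)) = g n"
      using Suc.prems by (intro assms(2)) auto
    then have "fill_cell a f n (m(a := ?h)) = m(a := (\<lambda>i. if i < Suc n then g i else m a i))"
      using assms(1) by (auto simp: fill_cell_def fun_eq_iff less_Suc_eq)
    with Suc show ?case by (simp del: fun_upd_apply)
  qed simp
  from this[of "m 1 0"] show ?thesis by (simp add: fill_array_def)
qed

text \<open>The loop bound is raised twice. Set to \<open>b\<close>, it lets bounded sums form
  powers of \<open>b\<close>; set to \<open>N\<close>, it makes all tables \<open>N\<close> entries
  long. Each power of \<open>N\<close> is \<open>N\<close> copies of the previous one.\<close>

definition reduction_steps :: "nat \<Rightarrow> nat \<Rightarrow> nat \<Rightarrow> nat \<Rightarrow> (memory \<Rightarrow> memory) list" where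
  "reduction_steps d r q c =
    [set_cell 2 (\<lambda>m \<rho>. m 1 0),
     set_cell 1 (\<lambda>m \<rho>. m 1 0 + m 0 0 + (q + 4)),
     set_cell 3 (\<lambda>m \<rho>. m 1 0),
     set_cell 4 (\<lambda>m \<rho>. bound_power (m 1 0) q),
     set_cell 5 (\<lambda>m \<rho>. bound_power (m 1 0) (q + q)),
     set_cell 1 (\<lambda>m \<rho>. bound_power (m 1 0) (q + q + 2)),
     fill_array 6 (\<lambda>m \<rho>. if \<rho> 0 = 0 then 2 else m 6 (\<rho> 0 - 1) + gate_length (m 0) (m 6 (\<rho> 0 - 1))),
     fill_array 7 (\<lambda>m \<rho>. if \<rho> 0 = 0 then 1 else \<Sum>v<m 1 0. m 7 (\<rho> 0 - 1)),
     set_cell 8 (\<lambda>m \<rho>. mem_target q c m),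
     fill_array 9 (\<lambda>m \<rho>. mem_item d r q c m (\<rho> 0)),
     set_cell 10 (\<lambda>m \<rho>. \<Sum>p<m 1 0. if p < m 4 0 \<and> mem_scope q c m p then 1 else 0),
     set_cell 11 (\<lambda>m \<rho>. Suc ((\<Sum>i<m 1 0. if i < m 5 0 then m 9 i else 0) +
       ((\<Sum>i<m 1 0. if i < m 5 0 then m 9 i else 0) + (\<Sum>i<m 1 0. if i < m 5 0 then m 9 i else 0))))]"

definition reduction_output :: "memory \<Rightarrow> (nat \<Rightarrow> nat) \<Rightarrow> nat list" where
  "reduction_output m \<rho> = [m 10 0] @ [m 5 0 + m 5 0 + m 5 0] @
     concat (map (\<lambda>u. if u < m 5 0 + m 5 0 + m 5 0 then
        concat (map (\<lambda>v. if v < m 5 0 + m 5 0 + m 5 0 then [star_weight (m 5 0) (m 11 0) (m 9) u v] else []) [0..<m 1 0])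
        else []) [0..<m 1 0]) @
     [min (m 1 0) (m 10 0) * m 11 0 + m 8 0] @ [min (m 1 0) (m 10 0) * m 11 0 - m 8 0]"

lemma definable_gate_length: "definable X \<Longrightarrow> definable (\<lambda>m \<rho>. gate_length (m 0) (X m \<rho>))"
  unfolding gate_length_def by (rule definable_rules | assumption)+

lemma reduction_steps_is_step: "\<forall>F \<in> set (reduction_steps d r q c). is_step F"
  unfolding reduction_steps_def
  by (simp only: list.set ball_simps, intro conjI TrueI,
      (rule is_step.intros definable_rules definable_bound_power definable_gate_length definable_mem_target
        definable_mem_item definable_mem_scope | rule definable_tail | simp (no_asm))+)

lemma definable_star_weight: "definable X \<Longrightarrow> definable Y \<Longrightarrow> definable (\<lambda>m \<rho>. star_weight (m 5 0) (m 11 0) (m 9) (X m \<rho>) (Y m \<rho>))"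
  unfolding star_weight_def by (rule definable_rules | assumption)+

lemma reduction_output_emittable: "emittable reduction_output"
proof -
  have "emittable (\<lambda>m \<rho>. reduction_output m \<rho>)"
    unfolding reduction_output_def
    by (rule emittable_append emittable_single emittable_for emittable_if emittable_Nil definable_star_weight definable_rules
        | rule definable_tail)+
  then show ?thesis by simp
qed

lemma concat_map_if_less: "M \<le> n \<Longrightarrow> concat (map (\<lambda>u. if u < M then f u else []) [0..<n]) = concat (map f [0..<M])"
proof (induction n)
  case (Suc n)
  show ?case
  proof (cases "M = Suc n")
    case True
    then show ?thesis by (intro arg_cong[of _ _ concat] map_cong) auto
  qed (use Suc in simp)
qed simp

lemma sum_if_less_subset: "(M::nat) \<le> n \<Longrightarrow> (\<Sum>i<n. if i < M then f i else 0) = (\<Sum>i<M. f i :: nat)"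
proof -
  assume "M \<le> n"
  then have "{..<n} \<inter> {i. i < M} = {..<M}" by auto
  then show ?thesis by (simp add: sum.If_cases)
qed

section \<open>Correctness of the reduction\<close>

locale reduction =
  fixes d k :: nat and x :: "nat list"
begin

definition "r = (2::nat) ^ d"
definition "q = 4 * r"
definition "c = 2 + 2 * r"
definition "V = k + c"
definition "xs = k # x"
text \<open>Values of variables are shifted inputs, gates and claims, so \<open>b\<close> has to
  exceed the number of nodes plus one and all arities, which the length of the word ensures. The
  terms \<open>k\<close> and \<open>q + 4\<close> make it at least \<open>V\<close>.\<close>

definition "b = length xs + k + (q + 4)"
text \<open>\<open>b ^ (q + q)\<close> is the number of items; the spare factor \<open>b ^ 2\<close>
  makes room for the three vertices of each star.\<close>

definition "N = b ^ (q + q + 2)"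
definition "X = init xs 0"
definition "Q = (\<lambda>i. if i < N then offset X i else 0)"
definition "E = b ^ q * b ^ q"

text \<open>The tests on the word as a whole are attached to every scope: if one fails, no item is
  admissible and the instance has no solution, without a separate branch of the program.\<close>

definition allowed :: "nat \<Rightarrow> nat \<Rightarrow> bool" where
  "allowed p z \<longleftrightarrow> syntax_ok N (length xs) X Q \<and>
     depth_ok N (node_arity X Q) (node_pred X Q) d (X 1 - 1) \<and>
     weft_ok N (node_arity X Q) (node_pred X Q) d 1 (X 1 - 1) \<and>
     constraint N (node_tag X Q) (node_arity X Q) (node_pred X Q) d r (X 1) k (\<lambda>j. digit b j p) (\<lambda>j. digit b j z)"

lemma r_pos: "0 < r"
  by (simp add: r_def)

lemma b_ge: "q + 4 \<le> b"
  by (simp add: b_def)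

lemma pow_le_N: "j \<le> q + q + 2 \<Longrightarrow> b ^ j \<le> N"
  unfolding N_def using b_ge by (intro power_increasing) auto

lemma Nq: "(q + 1) * b ^ q \<le> N"
proof -
  have "(q + 1) * b ^ q \<le> b * b ^ q" using b_ge by (intro mult_le_mono1) simp
  also have "\<dots> = b ^ (q + 1)" by simp
  also have "\<dots> \<le> N" by (rule pow_le_N) simp
  finally show ?thesis .
qed

lemma b_N: "b \<le> N"
  using pow_le_N[of 1] by simp

lemma bq_N: "b ^ q \<le> N"
  by (rule pow_le_N) simp

sublocale csp_sum N b q V allowed
proof
  show "3 \<le> b" "0 < q" using b_ge r_pos by (auto simp: q_def)
  show "V \<le> b" by (simp add: V_def b_def c_def q_def)
  show "b ^ (q + 2) \<le> N" by (rule pow_le_N) simp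
  show "(q + 1) * b ^ q \<le> N" by (rule Nq)
qed

lemma E_N: "E + E + E \<le> N"
proof -
  have "E + E + E \<le> b * E" using mult_le_mono1[of 3 b E, OF b] by linarith
  also have "\<dots> = b ^ (q + q + 1)" by (simp add: E_def power_add)
  also have "\<dots> \<le> N" by (rule pow_le_N) simp
  finally show ?thesis .
qed

sublocale parse k x N Q X
proof
  show "X = init (k # x) 0" by (simp add: X_def xs_def)
  show "length (k # x) \<le> N" using b_N by (simp add: b_def xs_def)
qed (simp add: Q_def)

lemma allowed_iff_ok:
  "p < b ^ q \<Longrightarrow> z < b ^ q \<Longrightarrow> allowed p z \<longleftrightarrow>
    (\<lambda>P z. syntax_ok N (length xs) X Q \<and>
     depth_ok N (node_arity X Q) (node_pred X Q) d (X 1 - 1) \<and>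
     weft_ok N (node_arity X Q) (node_pred X Q) d 1 (X 1 - 1) \<and>
     constraint N (node_tag X Q) (node_arity X Q) (node_pred X Q) d r (X 1) k P z) (\<lambda>j. digit b j p) (\<lambda>j. digit b j z)"
  by (simp only: allowed_def)

lemma csp_iff_WCS:
  "(\<exists>\<sigma>. (\<forall>c<V. \<sigma> c < b) \<and> (\<forall>p\<in>scopes. \<exists>z<b ^ q. (\<forall>j<q. digit b j z = \<sigma> (digit b j p)) \<and> allowed p z)) \<longleftrightarrow>
    (x, k) \<in> WCS 1 d"
proof -
  let ?con = "constraint N (node_tag X Q) (node_arity X Q) (node_pred X Q) d r (X 1) k"
  let ?D = "depth_ok N (node_arity X Q) (node_pred X Q) d (X 1 - 1)"
  let ?W = "weft_ok N (node_arity X Q) (node_pred X Q) d 1 (X 1 - 1)"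
  let ?Y = "syntax_ok N (length xs) X Q"
  have V0: "0 < V" by (simp add: V_def c_def)
  have "(\<exists>\<sigma>. (\<forall>c<V. \<sigma> c < b) \<and> (\<forall>p\<in>scopes. \<exists>z<b ^ q. (\<forall>j<q. digit b j z = \<sigma> (digit b j p)) \<and> allowed p z)) \<longleftrightarrow>
    (\<exists>\<sigma>. (\<forall>c<V. \<sigma> c < b) \<and> (\<forall>P. (\<forall>j<q. P j < V) \<longrightarrow> ?Y \<and> ?D \<and> ?W \<and> ?con P (\<lambda>j. \<sigma> (P j))))"
  proof (rule csp_iff[OF allowed_iff_ok])
    fix P P' z z' :: "nat \<Rightarrow> nat"
    assume "\<And>j. j < q \<Longrightarrow> P j = P' j" "\<And>j. j < q \<Longrightarrow> z j = z' j"
    then have "?con P z = ?con P' z'" unfolding q_def by (rule constraint_cong)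
    then show "(?Y \<and> ?D \<and> ?W \<and> ?con P z) = (?Y \<and> ?D \<and> ?W \<and> ?con P' z')" by simp
  qed
  also have "\<dots> \<longleftrightarrow> ?Y \<and> ?D \<and> ?W \<and> (\<exists>\<sigma>. (\<forall>c<V. \<sigma> c < b) \<and> (\<forall>P. (\<forall>j<q. P j < V) \<longrightarrow> ?con P (\<lambda>j. \<sigma> (P j))))"
    (is "?L \<longleftrightarrow> ?R")
  proof
    assume ?L
    then obtain \<sigma> where \<sigma>: "\<forall>c<V. \<sigma> c < b" and *: "\<And>P. (\<forall>j<q. P j < V) \<Longrightarrow> ?Y \<and> ?D \<and> ?W \<and> ?con P (\<lambda>j. \<sigma> (P j))" by blast
    \<comment> \<open>Since \<open>V > 0\<close> there is at least one scope, which yields the tests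
      on the word.\<close>
    from *[of "\<lambda>_. 0"] V0 have 1: ?Y ?D ?W by simp_all
    have "\<forall>P. (\<forall>j<q. P j < V) \<longrightarrow> ?con P (\<lambda>j. \<sigma> (P j))" using * by simp
    with \<sigma> 1 show ?R by blast
  next
    assume R: ?R
    then obtain \<sigma> where "\<forall>c<V. \<sigma> c < b" "\<forall>P. (\<forall>j<q. P j < V) \<longrightarrow> ?con P (\<lambda>j. \<sigma> (P j))" by blast
    with R show ?L by (intro exI[of _ \<sigma>]) simp
  qed
  also have "\<dots> \<longleftrightarrow> (x, k) \<in> WCS 1 d"
  proof -
    have view: "?Y \<and> (?D \<and> ?W \<and> (\<exists>\<sigma>. (\<forall>c<V. \<sigma> c < b) \<and> (\<forall>P. (\<forall>j<q. P j < V) \<longrightarrow> ?con P (\<lambda>j. \<sigma> (P j)))) \<longleftrightarrow>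
      weft_le C 1 \<and> depth_le C d \<and> (\<exists>S. satisfies S C \<and> card S = k))"
      if "x = encode_circuit C" "is_circuit C" for C
    proof
      note v = encode_view[OF that]
      show ?Y using v(2) by (simp add: xs_def)
      interpret view: circuit_view C "node_tag X Q" "node_arity X Q" "node_pred X Q" N by (rule v(3))
      have b1: "length C + 1 < b" using v(5) by (simp add: b_def xs_def)
      have b2: "node_arity X Q i < b" if "i < length C" for i using v(4)[OF that] by (simp add: b_def xs_def)
      show "?D \<and> ?W \<and> (\<exists>\<sigma>. (\<forall>c<V. \<sigma> c < b) \<and> (\<forall>P. (\<forall>j<q. P j < V) \<longrightarrow> ?con P (\<lambda>j. \<sigma> (P j)))) \<longleftrightarrow>
        weft_le C 1 \<and> depth_le C d \<and> (\<exists>S. satisfies S C \<and> card S = k)"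
        using view.weighted_sat_iff_csp[OF b1 b2, of V k d q] unfolding v(1)
        by (simp add: V_def c_def q_def r_def)
    qed
    show ?thesis
    proof
      assume R: "?Y \<and> ?D \<and> ?W \<and> (\<exists>\<sigma>. (\<forall>c<V. \<sigma> c < b) \<and> (\<forall>P. (\<forall>j<q. P j < V) \<longrightarrow> ?con P (\<lambda>j. \<sigma> (P j))))"
      then obtain C where C: "x = encode_circuit C" "is_circuit C" using syntax_ok_encode by (auto simp: xs_def)
      with view[OF C] R have "weft_le C 1 \<and> depth_le C d \<and> (\<exists>S. satisfies S C \<and> card S = k)" by blast
      with C show "(x, k) \<in> WCS 1 d" unfolding WCS_def by blast
    next
      assume "(x, k) \<in> WCS 1 d"
      then obtain C where C: "x = encode_circuit C" "is_circuit C" and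
        "weft_le C 1 \<and> depth_le C d \<and> (\<exists>S. satisfies S C \<and> card S = k)"
        unfolding WCS_def by blast
      with view[OF C] show "?Y \<and> ?D \<and> ?W \<and> (\<exists>\<sigma>. (\<forall>c<V. \<sigma> c < b) \<and> (\<forall>P. (\<forall>j<q. P j < V) \<longrightarrow> ?con P (\<lambda>j. \<sigma> (P j))))"
        by blast
    qed
  qed
  finally show ?thesis .
qed

definition "K = card scopes"
definition "D = 3 * (\<Sum>i<E. item_number i) + 1"
definition "output = 3 * E # concat (map (\<lambda>u. map (star_weight E D item_number u) [0..<3 * E]) [0..<3 * E]) @
  [K * D + target, K * D - target]"

lemma K_pos: "0 < K"
proof -
  have "const_scope 0 \<in> scopes" by (rule const_scope_in) (simp add: V_def c_def)
  then show ?thesis using finite_scopes card_gt_0_iff unfolding K_def by blast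
qed

lemma output_correct: "(output, K) \<in> M_EPVCB \<longleftrightarrow> (x, k) \<in> WCS 1 d"
proof -
  have "(output, K) \<in> M_EPVCB \<longleftrightarrow> (\<exists>I \<subseteq> {..<E}. card I = K \<and> sum item_number I = target)"
    unfolding output_def by (rule subset_sum_iff_M_EPVCB[OF _ D_def K_pos]) (simp add: E_def item_number_pos)
  then show ?thesis
    unfolding E_def K_def subset_sum_iff_csp csp_iff_WCS .
qed

definition layout :: "memory \<Rightarrow> bool" where
  "layout m \<longleftrightarrow> m 0 = X \<and> m 1 0 = N \<and> m 2 0 = length xs \<and> m 3 0 = b \<and> m 4 0 = b ^ q \<and> m 5 0 = E \<and>
    m 6 = Q \<and> (\<forall>i<N. m 7 i = N ^ i)"

lemma X0: "X 0 = k"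
  by (simp add: X_def xs_def init_def)

context
  fixes m assumes m: "layout m"
begin

lemma mem_scope_eq: "p \<le> N \<Longrightarrow> mem_scope q c m p \<longleftrightarrow> is_scope b q V p"
  using m X0 by (simp add: layout_def mem_scope_def is_scope_def tdigit_eq V_def)

lemma le_N: "i \<le> N \<Longrightarrow> i mod b ^ q \<le> N" "i \<le> N \<Longrightarrow> i div b ^ q \<le> N"
  using div_le_dividend[of i "b ^ q"] mod_less_eq_dividend[of i "b ^ q"] by linarith+

lemma cells: "m 0 = X" "m 1 0 = N" "m 2 0 = length xs" "m 3 0 = b" "m 4 0 = b ^ q" "m 5 0 = E"
  using m by (simp_all add: layout_def)

lemma mem_target_entry_eq:
  assumes "i < N"
  shows "mem_target_entry q c m i = target_entry b q V i"
proof -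
  note i = less_imp_le[OF assms]
  show ?thesis
    unfolding mem_target_entry_def target_entry_def cells tdiv_eq[OF i] tmod_eq[OF i]
      mem_scope_eq[OF i] mem_scope_eq[OF le_N(1)[OF i]] by (rule refl)
qed

lemma mem_item_entry_eq:
  assumes "e < N" "i < N"
  shows "mem_item_entry q c m e i = item_entry b q V e i"
proof -
  note e = less_imp_le[OF assms(1)] and i = less_imp_le[OF assms(2)]
  show ?thesis
    unfolding mem_item_entry_def item_entry_def cells tdiv_eq[OF i] tmod_eq[OF i] tdiv_eq[OF e] tmod_eq[OF e]
      mem_scope_eq[OF le_N(1)[OF i]] tdigit_eq[OF le_N(1)[OF i]] tdigit_eq[OF le_N(1)[OF e]]
      tdigit_eq[OF le_N(2)[OF e]] by (rule refl)
qed

lemma two_b_N: "2 * b \<le> N"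
proof -
  have "2 * b \<le> b ^ 2" using b_ge by (simp add: power2_eq_square)
  also have "\<dots> \<le> N" by (rule pow_le_N) simp
  finally show ?thesis .
qed

lemma mem_target_eq: "mem_target q c m = target"
proof -
  have "mem_target q c m = (\<Sum>i<N. min N (mem_target_entry q c m i) * m 7 i)"
    using m by (simp add: mem_target_def layout_def)
  also have "\<dots> = target"
    unfolding target_def
  proof (rule sum.cong)
    fix i assume "i \<in> {..<N}"
    then have i: "i < N" by simp
    have "target_entry b q V i \<le> N" using target_entry_le[of i] two_b_N by linarith
    then show "min N (mem_target_entry q c m i) * m 7 i = target_entry b q V i * N ^ i"
      using m i by (simp add: mem_target_entry_eq layout_def min_absorb2)
  qed simp
  finally show ?thesis .
qed

lemma mem_allowed_eq: "p \<le> N \<Longrightarrow> z \<le> N \<Longrightarrow> mem_allowed d r m p z \<longleftrightarrow> allowed p z"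
  using m X0 by (simp add: layout_def mem_allowed_def allowed_def tdigit_eq)

lemma mem_item_eq:
  assumes "m 8 0 = target" "e < N"
  shows "mem_item d r q c m e = item_number e"
proof -
  have e: "e \<le> N" using assms by simp
  have "(\<Sum>i<m 1 0. min (m 1 0) (mem_item_entry q c m e i) * m 7 i) = (\<Sum>i<N. item_entry b q V e i * N ^ i)"
  proof (rule sum.cong)
    fix i assume "i \<in> {..<N}"
    then have i: "i < N" by simp
    have "item_entry b q V e i \<le> N" using item_entry_le[of e i] two_b_N by linarith
    then show "min (m 1 0) (mem_item_entry q c m e i) * m 7 i = item_entry b q V e i * N ^ i"
      using m i assms(2) by (simp add: mem_item_entry_eq layout_def min_absorb2)
  qed (use m in \<open>simp add: layout_def\<close>)
  moreover have "tmod (m 1 0) e (m 4 0) = e mod b ^ q" "tdiv (m 1 0) e (m 4 0) = e div b ^ q"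
    using m e by (simp_all add: layout_def tmod_eq tdiv_eq)
  ultimately show ?thesis
    using le_N[OF e] by (simp add: mem_item_def item_number_def mem_scope_eq mem_allowed_eq assms(1))
qed

lemma sum_mem_scope: "(\<Sum>p<m 1 0. if p < m 4 0 \<and> mem_scope q c m p then 1 else 0) = K"
proof -
  have "(\<Sum>p<m 1 0. if p < m 4 0 \<and> mem_scope q c m p then 1 else 0) = (\<Sum>p<N. if p \<in> scopes then 1 else 0)"
    using m by (intro sum.cong) (auto simp: layout_def mem_scope_eq scopes_def)
  also have "\<dots> = card ({..<N} \<inter> scopes)" by (simp add: sum.If_cases)
  also have "{..<N} \<inter> scopes = scopes" using bq_N by (auto simp: scopes_def)
  finally show ?thesis by (simp add: K_def)
qed

end

lemma memory_after:
  assumes "m = fold id (reduction_steps d r q c) (init xs)"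
  shows "layout m" "m 8 0 = target" "\<And>i. i < N \<Longrightarrow> m 9 i = item_number i" "m 10 0 = K" "m 11 0 = D"
    "loops_bounded N (reduction_steps d r q c) (init xs)"
proof -
  let ?F = "reduction_steps d r q c"
  define m1 where "m1 = set_cell 2 (\<lambda>m \<rho>. m 1 0) (init xs)"
  define m2 where "m2 = set_cell 1 (\<lambda>m \<rho>. m 1 0 + m 0 0 + (q + 4)) m1"
  define m3 where "m3 = set_cell 3 (\<lambda>m \<rho>. m 1 0) m2"
  define m4 where "m4 = set_cell 4 (\<lambda>m \<rho>. bound_power (m 1 0) q) m3"
  define m5 where "m5 = set_cell 5 (\<lambda>m \<rho>. bound_power (m 1 0) (q + q)) m4"
  define m6 where "m6 = set_cell 1 (\<lambda>m \<rho>. bound_power (m 1 0) (q + q + 2)) m5"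
  define m7 where "m7 = fill_array 6 (\<lambda>m \<rho>. if \<rho> 0 = 0 then 2 else m 6 (\<rho> 0 - 1) + gate_length (m 0) (m 6 (\<rho> 0 - 1))) m6"
  define m8 where "m8 = fill_array 7 (\<lambda>m \<rho>. if \<rho> 0 = 0 then 1 else \<Sum>v<m 1 0. m 7 (\<rho> 0 - 1)) m7"
  define m9 where "m9 = set_cell 8 (\<lambda>m \<rho>. mem_target q c m) m8"
  define m10 where "m10 = fill_array 9 (\<lambda>m \<rho>. mem_item d r q c m (\<rho> 0)) m9"
  define m11 where "m11 = set_cell 10 (\<lambda>m \<rho>. \<Sum>p<m 1 0. if p < m 4 0 \<and> mem_scope q c m p then 1 else 0) m10"
  define m12 where "m12 = set_cell 11 (\<lambda>m \<rho>. Suc ((\<Sum>i<m 1 0. if i < m 5 0 then m 9 i else 0) +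
       ((\<Sum>i<m 1 0. if i < m 5 0 then m 9 i else 0) + (\<Sum>i<m 1 0. if i < m 5 0 then m 9 i else 0)))) m11"
  note defs = m1_def m2_def m3_def m4_def m5_def m6_def m7_def m8_def m9_def m10_def m11_def m12_def
  have m: "m = m12" unfolding assms reduction_steps_def defs by simp
  have i0: "init xs 0 = X" "init xs 1 0 = length xs" "init xs (Suc 0) 0 = length xs" "init xs 6 i = 0" for i by (simp_all add: X_def init_def)
  have s1: "m1 0 = X" "m1 1 0 = length xs" "m1 2 0 = length xs" "m1 6 = (\<lambda>_. 0)"
    by (auto simp: m1_def set_cell_def i0 fun_eq_iff)
  have s2: "m2 0 = X" "m2 1 0 = b" "m2 2 0 = length xs" "m2 6 = (\<lambda>_. 0)"
    by (simp_all add: m2_def set_cell_def s1 b_def X0 del: One_nat_def)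
  have s5: "m5 0 = X" "m5 1 0 = b" "m5 2 0 = length xs" "m5 3 0 = b" "m5 4 0 = b ^ q" "m5 5 0 = E" "m5 6 = (\<lambda>_. 0)"
    "m3 1 0 = b" "m4 1 0 = b"
    by (simp_all add: m5_def m4_def m3_def set_cell_def s2 bound_power_eq E_def power_add del: One_nat_def)
  have s6: "m6 0 = X" "m6 1 0 = N" "m6 2 0 = length xs" "m6 3 0 = b" "m6 4 0 = b ^ q" "m6 5 0 = E" "m6 6 = (\<lambda>_. 0)"
    by (simp_all add: m6_def set_cell_def s5 bound_power_eq N_def del: One_nat_def)
  have "m7 = m6(6 := (\<lambda>i. if i < m6 1 0 then offset X i else m6 6 i))"
    unfolding m7_def
  proof (rule fill_array_eq)
    fix i h assume "\<And>j. j < i \<Longrightarrow> h j = offset X j"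
    then show "(if case_nat i (\<lambda>_. m6 1 0) 0 = 0 then 2 else (m6(6 := h)) 6 (case_nat i (\<lambda>_. m6 1 0) 0 - 1) +
        gate_length ((m6(6 := h)) 0) ((m6(6 := h)) 6 (case_nat i (\<lambda>_. m6 1 0) 0 - 1))) = offset X i"
      by (cases i) (simp_all add: s6)
  qed simp
  then have s7: "m7 0 = X" "m7 1 0 = N" "m7 2 0 = length xs" "m7 3 0 = b" "m7 4 0 = b ^ q" "m7 5 0 = E" "m7 6 = Q"
    by (simp_all add: s6 Q_def fun_eq_iff del: One_nat_def)
  have "m8 = m7(7 := (\<lambda>i. if i < m7 1 0 then N ^ i else m7 7 i))"
    unfolding m8_def
  proof (rule fill_array_eq)
    fix i h assume "\<And>j. j < i \<Longrightarrow> h j = N ^ j"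
    then show "(if case_nat i (\<lambda>_. m7 1 0) 0 = 0 then 1 else \<Sum>v<(m7(7 := h)) 1 0. (m7(7 := h)) 7 (case_nat i (\<lambda>_. m7 1 0) 0 - 1)) = N ^ i"
      using s7 by (cases i) simp_all
  qed simp
  then have l8: "layout m8" using s7 by (simp add: layout_def)
  have l9: "layout m9" "m9 8 0 = target"
    using l8 mem_target_eq[OF l8] by (auto simp: m9_def set_cell_def layout_def)
  \<comment> \<open>\<open>layout\<close> does not mention array \<open>9\<close>, so it persists
    while the items are filled in.\<close>
  have l9': "layout (m9(9 := h))" "(m9(9 := h)) 8 0 = target" for h
    using l9 by (auto simp: layout_def)
  have N9: "m9 1 0 = N" using l9(1) by (simp add: layout_def)
  have "m10 = m9(9 := (\<lambda>i. if i < m9 1 0 then item_number i else m9 9 i))"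
    unfolding m10_def by (rule fill_array_eq) (simp_all add: mem_item_eq[OF l9'] N9 del: fun_upd_apply One_nat_def)
  then have l10: "layout m10" "m10 8 0 = target" "\<And>i. i < N \<Longrightarrow> m10 9 i = item_number i"
    using l9'[of "\<lambda>i. if i < m9 1 0 then item_number i else m9 9 i"] N9 by auto
  have l11: "layout m11" "m11 8 0 = target" "\<And>i. i < N \<Longrightarrow> m11 9 i = item_number i" "m11 10 0 = K"
    using l10 sum_mem_scope[OF l10(1)] by (auto simp: m11_def set_cell_def layout_def)
  have "(\<Sum>i<m11 1 0. if i < m11 5 0 then m11 9 i else 0) = (\<Sum>i<N. if i < E then item_number i else 0)"
    using l11 by (intro sum.cong) (auto simp: layout_def)
  also have "\<dots> = (\<Sum>i<E. item_number i)" using E_N by (intro sum_if_less_subset) simp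
  finally have "(\<Sum>i<m11 1 0. if i < m11 5 0 then m11 9 i else 0) = (\<Sum>i<E. item_number i)" .
  then have l12: "layout m12" "m12 8 0 = target" "\<And>i. i < N \<Longrightarrow> m12 9 i = item_number i" "m12 10 0 = K" "m12 11 0 = D"
    using l11 by (auto simp: m12_def set_cell_def layout_def D_def)
  then show "layout m" "m 8 0 = target" "\<And>i. i < N \<Longrightarrow> m 9 i = item_number i" "m 10 0 = K" "m 11 0 = D"
    unfolding m by blast+
  have "length xs \<le> N" using len by (simp add: xs_def)
  then show "loops_bounded N ?F (init xs)"
    unfolding reduction_steps_def loops_bounded.simps defs[symmetric]
    using i0 s1 s2 s5 s6 s7 l8 l9 l10 l11 l12 b_N by (simp add: layout_def)
qed

lemma reduction_output_eq:
  assumes "m = fold id (reduction_steps d r q c) (init xs)"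
  shows "reduction_output m \<rho> = K # output"
proof -
  note M = memory_after[OF assms]
  have cells: "m 1 0 = N" "m 5 0 = E" using M(1) by (simp_all add: layout_def)
  have "star_weight E D (m 9) u v = star_weight E D item_number u v" for u v
    using M(3) E_N by (simp add: star_weight_def)
  moreover have "K \<le> N" using card_scopes bq_N by (simp add: K_def)
  moreover have "concat (map (\<lambda>v. [f v]) ys) = map f ys" for f :: "nat \<Rightarrow> nat" and ys by (induction ys) auto
  moreover have E3: "E + E + E = 3 * E" by simp
  ultimately show ?thesis
    unfolding reduction_output_def cells M concat_map_if_less[OF E_N] unfolding output_def E3 by (simp add: min_absorb2)
qed

end

text \<open>The time is polynomial in \<open>k\<close> and the length of the word for fixed
  \<open>d\<close>, because \<open>N\<close> is a fixed power of \<open>b\<close>. The parameter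
  bound comes from \<open>card_scopes_le\<close>.\<close>

theorem WCS_reduction:
  "\<exists>p e. \<forall>k x. \<exists>k' ys t. computes_in p (k # x) (k' # ys) t \<and> ((ys, k') \<in> M_EPVCB \<longleftrightarrow> (x, k) \<in> WCS 1 d) \<and>
    k' \<le> (k + e) ^ e \<and> t \<le> (k + length x + e) ^ e"
proof -
  define r where "r = (2::nat) ^ d"
  define q where "q = 4 * r"
  define c where "c = 2 + 2 * r"
  obtain p e0 where p: "\<And>xs B m. m = fold id (reduction_steps d r q c) (init xs) \<and>
      loops_bounded B (reduction_steps d r q c) (init xs) \<and> m 1 0 \<le> B \<Longrightarrow>
      (\<exists>t. computes_in p xs (reduction_output m (\<lambda>_. m 1 0)) t \<and> t \<le> (B + 2) ^ e0)"
    using steps_computes_in[OF reduction_steps_is_step reduction_output_emittable, of d r q c] by auto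
  \<comment> \<open>One constant for all purposes: \<open>q + 5\<close> is the additive part of
    \<open>b\<close>, \<open>c\<close> that of \<open>V\<close>, and the product is the exponent of
    the running time.\<close>
  define e where "e = q + 5 + c + (q + q + 3) * e0"
  show ?thesis
  proof (rule exI[of _ p], rule exI[of _ e], intro allI)
    fix k x
    interpret R: reduction d k x .
    have eqs: "R.r = r" "R.q = q" "R.c = c" by (simp_all add: R.r_def R.q_def R.c_def r_def q_def c_def)
    define m where "m = fold id (reduction_steps d r q c) (init (k # x))"
    have m: "m = fold id (reduction_steps d R.r R.q R.c) (init R.xs)" by (simp add: m_def eqs R.xs_def)
    note M = R.memory_after[OF m]
    have "m 1 0 = R.N" using M(1) by (simp add: R.layout_def)
    then obtain t where t: "computes_in p (k # x) (reduction_output m (\<lambda>_. m 1 0)) t" "t \<le> (R.N + 2) ^ e0"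
      using p[of m "k # x" R.N] M(6) m_def by (auto simp: eqs R.xs_def)
    have b: "R.b = k + length x + (q + 5)" by (simp add: R.b_def R.xs_def eqs)
    have b1: "1 \<le> k + length x + e" "R.b \<le> k + length x + e" by (simp_all add: b e_def)
    have "R.N + 2 \<le> R.b * R.N"
    proof -
      have "1 \<le> R.N" using R.b by (simp add: R.N_def)
      moreover have "3 * R.N \<le> R.b * R.N" using R.b by (rule mult_le_mono1)
      ultimately show ?thesis by linarith
    qed
    also have "\<dots> = R.b ^ (q + q + 3)" by (simp add: R.N_def eqs numeral_3_eq_3)
    finally have "(R.N + 2) ^ e0 \<le> (R.b ^ (q + q + 3)) ^ e0" by (rule power_mono) simp
    also have "\<dots> = R.b ^ ((q + q + 3) * e0)" by (simp add: power_mult)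
    also have "\<dots> \<le> (k + length x + e) ^ ((q + q + 3) * e0)" using b1(2) by (rule power_mono) simp
    also have "\<dots> \<le> (k + length x + e) ^ e" using b1(1) by (rule power_increasing[rotated]) (simp add: e_def)
    finally have time: "t \<le> (k + length x + e) ^ e" using t(2) by linarith
    have "R.K \<le> R.V ^ q" using R.card_scopes_le by (simp add: R.K_def eqs)
    also have "\<dots> \<le> (k + e) ^ q" by (rule power_mono) (simp_all add: R.V_def eqs e_def)
    also have "\<dots> \<le> (k + e) ^ e" by (rule power_increasing) (simp_all add: e_def)
    finally have "R.K \<le> (k + e) ^ e" .
    with t(1) time R.output_correct
    show "\<exists>k' ys t. computes_in p (k # x) (k' # ys) t \<and> ((ys, k') \<in> M_EPVCB \<longleftrightarrow> (x, k) \<in> WCS 1 d) \<and>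
      k' \<le> (k + e) ^ e \<and> t \<le> (k + length x + e) ^ e"
      unfolding R.reduction_output_eq[OF m] by blast
  qed
qed

section \<open>Composition with a given reduction\<close>

lemma exec_output_length: "exec c s t s' \<Longrightarrow> length (snd s') \<le> length (snd s) + t"
  by (induction rule: exec.induct) auto

text \<open>The second reduction is timed in the length of the intermediate word, which the time of
  the first one bounds.\<close>

lemma computes_in_length: "computes_in p xs ys t \<Longrightarrow> length ys \<le> t"
  unfolding computes_in_def using exec_output_length by fastforce

lemma length_le_word_size: "length xs \<le> word_size xs"
  by (induction xs) (auto simp: word_size_def)

text \<open>Bounds of an fpt-reduction have to be computable. The composed bound arises by setting
  the loop bound to the sum and emitting its power.\<close>

lemma computable_power_add:
  assumes "computable f" "computable g"
  shows "computable (\<lambda>n. (f n + g n + e) ^ e')"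
proof -
  obtain p where p: "\<And>n. \<exists>t. computes_in p [n] [f n, g n] t"
    using computes_pair[OF assms] by blast
  let ?F = "[set_cell 1 (\<lambda>m \<rho>. m 0 0 + m 0 1 + e)]"
  have steps: "\<forall>F \<in> set ?F. is_step F"
    by (simp only: list.set ball_simps, intro conjI TrueI, (rule is_step.intros definable_rules)+)
  have emit: "emittable (\<lambda>m \<rho>. [bound_power (m 1 0) e'])"
    by (intro emittable_single definable_bound_power)
  obtain p' e0 where *: "\<forall>xs B m. m = fold id ?F (init xs) \<and> loops_bounded B ?F (init xs) \<and> m 1 0 \<le> B \<longrightarrow>
      (\<exists>t. computes_in p' xs [bound_power (m 1 0) e'] t \<and> t \<le> (B + 2) ^ e0)"
    using steps_computes_in[OF steps emit] by (elim exE)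
  have p': "\<exists>t. computes_in p' xs [bound_power (m 1 0) e'] t"
    if "m = fold id ?F (init xs) \<and> loops_bounded B ?F (init xs) \<and> m 1 0 \<le> B" for xs B m
    using *[THEN spec, THEN spec, THEN spec, THEN mp, OF that] by (elim exE conjE) (rule exI)
  have "\<exists>t. computes_in p' [u, v] [(u + v + e) ^ e'] t" for u v
  proof -
    let ?m = "fold id ?F (init [u, v])"
    have m: "?m 1 0 = u + v + e" by (simp add: set_cell_def init_def)
    have "loops_bounded (2 + ?m 1 0) ?F (init [u, v])" by (simp add: init_def set_cell_def)
    then have "\<exists>t. computes_in p' [u, v] [bound_power (?m 1 0) e'] t"
      by (intro p'[where B = "2 + ?m 1 0"] conjI refl) auto
    then show ?thesis unfolding m bound_power_eq .
  qed
  then have "\<exists>t. computes_in (pipe p p') [n] [(f n + g n + e) ^ e'] t" for n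
    using computes_in_pipe p[of n] by meson
  then show ?thesis unfolding computable_def by blast
qed

text \<open>Each of \<open>len\<close>, \<open>1\<close>, \<open>t1\<close> and \<open>t2\<close> is
  at most \<open>F ^ (e + 1)\<close> times the power of \<open>w\<close>; their coefficients add up
  to \<open>4 + 1 + 2 + 2 = 9\<close>, which one more factor \<open>F \<ge> 9\<close>
  absorbs.\<close>

lemma reduction_time_bound:
  fixes w F u v e :: nat
  assumes "1 \<le> w" "F = u + v + (e + 9)" "t1 \<le> u * w ^ c" "k' \<le> v" "l \<le> t1" "t2 \<le> (k' + l + e) ^ e" "len \<le> w"
    "t \<le> 4 * len + 1 + 2 * t1 + 2 * t2"
  shows "t \<le> F ^ (e + 2) * w ^ (c * e + c + 1)"
proof -
  let ?W = "w ^ (c * e + c + 1)"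
  have F: "1 \<le> F" "9 \<le> F" using assms(2) by auto
  have F1: "F \<le> F ^ (e + 1)" using F by (simp add: self_le_power)
  have W: "w \<le> ?W" "w ^ c \<le> ?W" "w ^ (c * e) \<le> ?W" "1 \<le> ?W"
    using assms(1) by (auto intro!: power_increasing self_le_power simp del: power_Suc power_add)
  have one: "1 \<le> F ^ (e + 1)" using F by simp
  have a: "len \<le> F ^ (e + 1) * ?W" using mult_le_mono[OF one W(1)] assms(7) by linarith
  have b: "t1 \<le> F ^ (e + 1) * ?W"
  proof -
    have "u \<le> F ^ (e + 1)" using F1 assms(2) by linarith
    from mult_le_mono[OF this W(2)] assms(3) show ?thesis by linarith
  qed
  have c: "t2 \<le> F ^ (e + 1) * ?W"
  proof -
    have "k' + l + e \<le> v + u * w ^ c + e" using assms by linarith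
    also have "\<dots> \<le> (v + u + e) * w ^ c"
    proof -
      have "1 \<le> w ^ c" using assms(1) by simp
      from mult_le_mono2[OF this, of "v + e"] show ?thesis by (simp add: algebra_simps)
    qed
    also have "\<dots> \<le> F * w ^ c" using assms(2) by (intro mult_le_mono1) simp
    finally have "(k' + l + e) ^ e \<le> (F * w ^ c) ^ e" by (rule power_mono) simp
    also have "\<dots> = F ^ e * w ^ (c * e)" by (simp add: power_mult_distrib power_mult)
    also have "\<dots> \<le> F ^ (e + 1) * ?W" using F W(3) by (intro mult_le_mono[OF power_increasing]) auto
    finally show ?thesis using assms(6) by linarith
  qed
  have d: "1 \<le> F ^ (e + 1) * ?W" using mult_le_mono[OF one W(4)] by linarith
  have "t \<le> 9 * (F ^ (e + 1) * ?W)" using a b c d assms(8) by linarith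
  also have "\<dots> \<le> F * (F ^ (e + 1) * ?W)" using F(2) by (rule mult_le_mono1)
  also have "\<dots> = F ^ (e + 2) * ?W" by simp
  finally show ?thesis .
qed

theorem theorem5: "W_hard 1 M_EPVCB"
  unfolding W_hard_def W_def
proof (intro ballI, elim CollectE exE conjE)
  fix A d assume "A \<le>\<^sub>f\<^sub>p\<^sub>t WCS 1 d"
  then obtain p1 f g c where f: "computable f" and g: "computable g" and
    red: "\<And>x k. \<exists>x' k' t. computes_in p1 (k # x) (k' # x') t \<and> ((x, k) \<in> A \<longleftrightarrow> (x', k') \<in> WCS 1 d) \<and>
        k' \<le> g k \<and> t \<le> f k * (word_size x + 1) ^ c"
    unfolding fpt_reducible_def by blast
  obtain p2 e where p2: "\<And>k x. \<exists>k' ys t. computes_in p2 (k # x) (k' # ys) t \<and>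
      ((ys, k') \<in> M_EPVCB \<longleftrightarrow> (x, k) \<in> WCS 1 d) \<and> k' \<le> (k + e) ^ e \<and> t \<le> (k + length x + e) ^ e"
    using WCS_reduction[of d] by blast
  \<comment> \<open>One function bounds both the new parameter and the time factor.\<close>
  define F where "F k = (f k + g k + (e + 9)) ^ (e + 2)" for k
  have F: "computable F" unfolding F_def by (rule computable_power_add[OF f g])
  have "\<exists>x' k' t. computes_in (pipe p1 p2) (k # x) (k' # x') t \<and> ((x, k) \<in> A \<longleftrightarrow> (x', k') \<in> M_EPVCB) \<and>
      k' \<le> F k \<and> t \<le> F k * (word_size x + 1) ^ (c * e + c + 1)" for x k
  proof -
    from red[of k x] obtain x1 k1 t1 where 1: "computes_in p1 (k # x) (k1 # x1) t1"
      "(x, k) \<in> A \<longleftrightarrow> (x1, k1) \<in> WCS 1 d" "k1 \<le> g k" "t1 \<le> f k * (word_size x + 1) ^ c" by blast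
    from p2[of k1 x1] obtain k2 x2 t2 where 2: "computes_in p2 (k1 # x1) (k2 # x2) t2"
      "(x2, k2) \<in> M_EPVCB \<longleftrightarrow> (x1, k1) \<in> WCS 1 d" "k2 \<le> (k1 + e) ^ e" "t2 \<le> (k1 + length x1 + e) ^ e" by blast
    from computes_in_pipe[OF 1(1) 2(1)] obtain t where
      t: "computes_in (pipe p1 p2) (k # x) (k2 # x2) t" "t \<le> 4 * length (k # x) + 1 + 2 * t1 + 2 * t2" by blast
    have "length x1 \<le> t1" using computes_in_length[OF 1(1)] by simp
    moreover have "length (k # x) \<le> word_size x + 1" using length_le_word_size[of x] by simp
    ultimately have "t \<le> F k * (word_size x + 1) ^ (c * e + c + 1)"
      unfolding F_def using 1(3,4) 2(4) t(2)
      by (intro reduction_time_bound[OF _ refl, where ?t1.0 = t1 and ?t2.0 = t2 and k' = k1 and l = "length x1"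
            and len = "length (k # x)"]) auto
    moreover have "k2 \<le> F k"
    proof -
      have "k2 \<le> (f k + g k + (e + 9)) ^ e"
        using 2(3) power_mono[of "k1 + e" "f k + g k + (e + 9)" e] 1(3) by linarith
      also have "\<dots> \<le> F k" unfolding F_def by (intro power_increasing) auto
      finally show ?thesis .
    qed
    ultimately show ?thesis using t(1) 1(2) 2(2) by blast
  qed
  then show "A \<le>\<^sub>f\<^sub>p\<^sub>t M_EPVCB"
    unfolding fpt_reducible_def using F by blast
qed

end
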